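(* Let $\mathbb{K}$ be an infinite field, $m,n\ge 2$ integers, and $q\in\mathbb{K}$ nonzero and not a root of unity. Let $B\subseteq[m]\times[n]$ be a Cauchon diagram, let $t\in[mn]$, let $(r,s)$ be the $t$-th smallest coordinate in $[m]\times[n]$ (lexicographic order), let $[x_{i,j}]$ be the matrix of generators of $A^{(t)}$, and let $K_t=\ker(\sigma_B^{(t)})$. Let $G_t$ be the set consisting of all $x_{i,j}$ with $(i,j)>(r,s)$ and $(i,j)\in B$, together with all quantum minors $[I\,|\,J]^{(t)}$ in $K_t$ whose maximum coordinate is at most $(r,s)$. Then $G_t$ is a Gröbner basis for $K_t$ as a right ideal of $A^{(t)}$ (with respect to the matrix lexicographic order).
   Context: Notation: $[k]=\{1,\dots,k\}$. Elements of $[m]\times[n]$ are called coordinates, ordered lexicographically: $(i,j)<(k,\ell)$ iff $i<k$, or $i=k$ and $j<\ell$. Quantum torus: $\mathcal{O}_q((\mathbb{K}^\times)^{m\times n})$ is the $\mathbb{K}$-algebra generated by $t_{i,j}^{\pm1}$, $(i,j)\in[m]\times[n]$, such that for every $2\times2$ submatrix $\begin{bmatrix}a&b\\c&d\end{bmatrix}$ of $[t_{i,j}]$: $ab=qba$, $cd=qdc$, $ac=qca$, $bd=qdb$, $bc=cb$, $ad=da$. Cauchon diagram: a subset $B\subseteq[m]\times[n]$ ("black squares") such that for each $(i,j)\in B$, either $(i,j')\in B$ for all $j'<j$, or $(i',j)\in B$ for all $i'<i$. Cauchon graph $G_B^{m\times n}$: the directed graph whose vertices are the white vertices $W=([m]\times[n])\setminus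 B$, row vertices $1,\dots,m$ and column vertices $1,\dots,n$ (row and column vertices being different objects), with edges: (1) $(i,j)\to(i,j')$ for $(i,j),(i,j')\in W$, $j>j'$, with no white vertex $(i,j'')$, $j'<j''<j$; (2) $(i,j)\to(i',j)$ for $(i,j),(i',j)\in W$, $i<i'$, with no white vertex $(i'',j)$, $i<i''<i'$; (3) from row vertex $i$ to $(i,j)$, where $j$ is largest with $(i,j)\in W$ (if it exists); (4) from $(i,j)$ to column vertex $j$, where $i$ is largest with $(i,j)\in W$ (if it exists). Edges of types (1),(3) are horizontal, those of types (2),(4) are vertical. Edge weights in the quantum torus: type (1) has weight $t_{i,j}^{-1}t_{i,j'}$, type (2) weight $1$, type (3) weight $t_{i,j}$, type (4) weight $1$. The weight $w(P)$ of a directed path is the product of its edge weights in the order of the path. A ⅃-turn (backwards-L turn) of a path is a white vertex of the path entered by a vertical edge and left by a horizontal edge. For a row vertex $i$ and column vertex $j$, $\Gamma_B^{(t)}(i,j)$ is the set of directed paths from $i$ to $j$ in $G_B^{m\times n}$ in which no vertex larger than $(r,s)$ (the $t$-th smallest coordinate) is a ⅃-turn. $A_B^{(t)}$ is the subalgebra of the quantum torus generated by the elements $x^B_{i,j}=\sum_{P\in\Gamma_B^{(t)}(i,j)}w(P)$, $(i,j)\in[m]\times[n]$. Put $A^{(t)}=A_\emptyset^{(t)}$, with generators $x_{i,j}=x^{\emptyset}_{i,j}$. It is known that there is a well-defined surjective algebra homomorphism $\sigma_B^{(t)}:A^{(t)}\to A_B^{(t)}$ with $x_{i,j}\mapsto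 x_{i,j}^B$. For $N\in\mathcal{M}_{m,n}(\mathbb{Z}_{\ge0})$ put $\boldsymbol{x}^N=x_{1,1}^{(N)_{1,1}}x_{1,2}^{(N)_{1,2}}\cdots x_{m,n}^{(N)_{m,n}}$ (factors in lexicographic order of indices). These elements form a $\mathbb{K}$-basis of $A^{(t)}$. The matrix lexicographic order: for $M\ne N$, $M\prec N$ (and $\boldsymbol{x}^M\prec\boldsymbol{x}^N$) iff $(M)_{k,\ell}<(N)_{k,\ell}$ at the least coordinate $(k,\ell)$ where $M,N$ differ. The leading term $\ell t(a)$ of a nonzero $a\in A^{(t)}$ is the $\prec$-maximal $\boldsymbol{x}^N$ occurring with nonzero coefficient when $a$ is expanded in this basis. $\boldsymbol{x}^M$ divides $\boldsymbol{x}^N$ if $(M)_{i,j}\le(N)_{i,j}$ for all $(i,j)$. A finite subset $G$ of a right ideal $J$ of $A^{(t)}$ is a Gröbner basis for $J$ if for every nonzero $a\in J$ there is $g\in G$ such that $\ell t(g)$ divides $\ell t(a)$. Quantum minors: for $I=\{i_1<\dots<i_k\}\subseteq[m]$, $J=\{j_1<\dots<j_k\}\subseteq[n]$ with $k\ge1$, $[I\,|\,J]^{(t)}=\sum_{\sigma\in S_k}(-q)^{\ell(\sigma)}x_{i_1,j_{\sigma(1)}}\cdots x_{i_k,j_{\sigma(k)}}\in A^{(t)}$, where $\ell(\sigma)$ is the number of inversions of $\sigma$. Its maximum coordinate is $(i_k,j_k)$. *)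

theory Defs
  imports
    "HOL-Algebra.QuotRing"
    "HOL-Algebra.Generated_Rings"
    "HOL-Library.Poly_Mapping"
    "HOL-Library.Product_Lexorder"
    "HOL-Library.FuncSet"
    "HOL-Combinatorics.Permutations"
    "Graph_Theory.Arc_Walk"
begin

text \<open>
  Coordinates are pairs of positive natural numbers. \<^theory>\<open>HOL-Library.Product_Lexorder\<close> makes
  the order on \<^typ>\<open>nat \<times> nat\<close>, and hence \<^const>\<open>sorted_list_of_set\<close> on sets of pairs, the
  lexicographic one.
\<close>

definition coords :: "nat \<Rightarrow> nat \<Rightarrow> (nat \<times> nat) set" where
  "coords m n = {1..m} \<times> {1..n}"

definition nth_coord :: "nat \<Rightarrow> nat \<Rightarrow> nat \<Rightarrow> nat \<times> nat" where
  "nth_coord m n t = sorted_list_of_set (coords m n) ! (t - 1)"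


section \<open>The quantum torus\<close>

subsection \<open>Free associative algebras\<close>

text \<open>
  Words under concatenation, written additively: the product of \<open>'a word \<Rightarrow>\<^sub>0 'k\<close> is then the
  convolution product, so that this type is the free associative \<open>'k\<close>-algebra on \<open>'a\<close>.
\<close>

datatype 'a word = Word (letters: "'a list")

instantiation word :: (type) monoid_add
begin

definition zero_word :: "'a word" where
  "0 = Word []"

definition plus_word :: "'a word \<Rightarrow> 'a word \<Rightarrow> 'a word" where
  "u + v = Word (letters u @ letters v)"

instance
  by standard (simp_all add: zero_word_def plus_word_def)

end

text \<open>\<open>Pos c\<close> stands for the generator \<open>t\<^sub>c\<close> and \<open>Neg c\<close> for its inverse.\<close>

datatype torus_letter = Pos "nat \<times> nat" | Neg "nat \<times> nat"

definition free_alg :: "nat \<Rightarrow> nat \<Rightarrow> (torus_letter word \<Rightarrow>\<^sub>0 'k::field) ring" where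
  "free_alg m n =
    \<lparr>carrier = {f. \<forall>w \<in> Poly_Mapping.keys f. set (letters w) \<subseteq> Pos ` coords m n \<union> Neg ` coords m n},
     monoid.mult = (*), one = 1, ring.zero = 0, ring.add = (+)\<rparr>"

definition letter :: "torus_letter \<Rightarrow> torus_letter word \<Rightarrow>\<^sub>0 'k::field" where
  "letter a = Poly_Mapping.single (Word [a]) 1"

definition const :: "'k \<Rightarrow> torus_letter word \<Rightarrow>\<^sub>0 'k::field" where
  "const c = Poly_Mapping.single 0 c"

subsection \<open>The presentation\<close>

text \<open>The six relations of a \<open>2 \<times> 2\<close> submatrix with rows \<open>a b\<close> and \<open>c d\<close>.\<close>

definition submatrix_relators ::
    "'k::field \<Rightarrow> (nat \<times> nat) \<Rightarrow> (nat \<times> nat) \<Rightarrow> (nat \<times> nat) \<Rightarrow> (nat \<times> nat)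
      \<Rightarrow> (torus_letter word \<Rightarrow>\<^sub>0 'k) set" where
  "submatrix_relators q a b c d =
    (let A = letter (Pos a); B = letter (Pos b); C = letter (Pos c); D = letter (Pos d) in
      {A * B - const q * B * A, C * D - const q * D * C,
       A * C - const q * C * A, B * D - const q * D * B,
       B * C - C * B, A * D - D * A})"

definition torus_relators :: "nat \<Rightarrow> nat \<Rightarrow> 'k::field \<Rightarrow> (torus_letter word \<Rightarrow>\<^sub>0 'k) set" where
  "torus_relators m n q =
    (\<Union>c \<in> coords m n. {letter (Pos c) * letter (Neg c) - 1, letter (Neg c) * letter (Pos c) - 1})
    \<union> (\<Union>{submatrix_relators q (i, j) (i, j') (i', j) (i', j') | i i' j j'.
          1 \<le> i \<and> i < i' \<and> i' \<le> m \<and> 1 \<le> j \<and> j < j' \<and> j' \<le> n})"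

definition torus_ideal :: "nat \<Rightarrow> nat \<Rightarrow> 'k::field \<Rightarrow> (torus_letter word \<Rightarrow>\<^sub>0 'k) set" where
  "torus_ideal m n q = genideal (free_alg m n) (torus_relators m n q)"

definition torus :: "nat \<Rightarrow> nat \<Rightarrow> 'k::field \<Rightarrow> (torus_letter word \<Rightarrow>\<^sub>0 'k) set ring" where
  "torus m n q = free_alg m n Quot torus_ideal m n q"

definition torus_class ::
    "nat \<Rightarrow> nat \<Rightarrow> 'k::field \<Rightarrow> (torus_letter word \<Rightarrow>\<^sub>0 'k) \<Rightarrow> (torus_letter word \<Rightarrow>\<^sub>0 'k) set" where
  "torus_class m n q f = torus_ideal m n q +>\<^bsub>free_alg m n\<^esub> f"

definition tgen :: "nat \<Rightarrow> nat \<Rightarrow> 'k::field \<Rightarrow> nat \<times> nat \<Rightarrow> (torus_letter word \<Rightarrow>\<^sub>0 'k) set" where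
  "tgen m n q c = torus_class m n q (letter (Pos c))"

definition tinv :: "nat \<Rightarrow> nat \<Rightarrow> 'k::field \<Rightarrow> nat \<times> nat \<Rightarrow> (torus_letter word \<Rightarrow>\<^sub>0 'k) set" where
  "tinv m n q c = torus_class m n q (letter (Neg c))"

definition scalar :: "nat \<Rightarrow> nat \<Rightarrow> 'k::field \<Rightarrow> 'k \<Rightarrow> (torus_letter word \<Rightarrow>\<^sub>0 'k) set" where
  "scalar m n q c = torus_class m n q (const c)"

lemma ring_free_alg: "ring (free_alg m n :: (torus_letter word \<Rightarrow>\<^sub>0 'k::field) ring)"
  (is "ring ?F")
proof -
  let ?L = "Pos ` coords m n \<union> Neg ` coords m n"
  have car: "f \<in> carrier ?F \<longleftrightarrow> (\<forall>w \<in> Poly_Mapping.keys f. set (letters w) \<subseteq> ?L)" for f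
    by (simp add: free_alg_def)
  have add: "f + g \<in> carrier ?F" if "f \<in> carrier ?F" "g \<in> carrier ?F" for f g
    using that Poly_Mapping.keys_add[of f g] unfolding car by blast
  have uminus: "- f \<in> carrier ?F" if "f \<in> carrier ?F" for f
    using that unfolding car by (simp add: in_keys_iff)
  have mult: "f * g \<in> carrier ?F" if f: "f \<in> carrier ?F" and g: "g \<in> carrier ?F" for f g
    unfolding car
  proof
    fix w assume "w \<in> Poly_Mapping.keys (f * g)"
    then obtain u v where "u \<in> Poly_Mapping.keys f" "v \<in> Poly_Mapping.keys g" "w = u + v"
      using Poly_Mapping.keys_mult[of f g] by blast
    then have "set (letters u) \<subseteq> ?L" "set (letters v) \<subseteq> ?L" "w = u + v"
      using f g unfolding car by blast+
    then show "set (letters w) \<subseteq> ?L"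
      by (simp add: plus_word_def)
  qed
  have zero: "0 \<in> carrier ?F" and one: "1 \<in> carrier ?F"
    by (simp_all add: car zero_word_def)
  have ops: "\<zero>\<^bsub>?F\<^esub> = 0" "\<one>\<^bsub>?F\<^esub> = 1" "f \<oplus>\<^bsub>?F\<^esub> g = f + g" "f \<otimes>\<^bsub>?F\<^esub> g = f * g" for f g
    by (simp_all add: free_alg_def)
  show ?thesis
  proof (rule ringI)
    show "abelian_group ?F"
    proof (rule abelian_groupI; unfold ops)
      show "\<exists>g\<in>carrier ?F. g + f = 0" if "f \<in> carrier ?F" for f
        using uminus[OF that] by (rule bexI[rotated]) simp
    qed (simp_all add: add zero add.assoc add.commute)
    show "Group.monoid ?F"
      by (rule Group.monoidI; unfold ops) (simp_all add: mult one mult.assoc)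
  qed (simp_all add: ops distrib_left distrib_right)
qed

lemma letter_in_free_alg:
  assumes "c \<in> coords m n"
  shows "letter (Pos c) \<in> carrier (free_alg m n)" "letter (Neg c) \<in> carrier (free_alg m n)"
  using assms by (auto simp: letter_def free_alg_def)

lemma const_in_free_alg: "const c \<in> carrier (free_alg m n)"
  by (auto simp: const_def free_alg_def zero_word_def)

lemma torus_relators_in_free_alg:
  fixes q :: "'k::field"
  shows "torus_relators m n q \<subseteq> carrier (free_alg m n)"
proof -
  interpret R: ring "free_alg m n :: (torus_letter word \<Rightarrow>\<^sub>0 'k) ring"
    by (rule ring_free_alg)
  have mult: "f * g \<in> carrier (free_alg m n)"
    if "f \<in> carrier (free_alg m n)" "g \<in> carrier (free_alg m n)" for f g :: "torus_letter word \<Rightarrow>\<^sub>0 'k"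
    using R.m_closed[OF that] by (simp add: free_alg_def)
  have minus: "f - g \<in> carrier (free_alg m n)"
    if "f \<in> carrier (free_alg m n)" "g \<in> carrier (free_alg m n)" for f g :: "torus_letter word \<Rightarrow>\<^sub>0 'k"
    using that Poly_Mapping.keys_diff[of f g]
    by (simp only: free_alg_def partial_object.simps mem_Collect_eq) blast
  have one: "1 \<in> carrier (free_alg m n :: (torus_letter word \<Rightarrow>\<^sub>0 'k) ring)"
    using R.one_closed by (simp add: free_alg_def)
  have letter: "letter (Pos c) \<in> carrier (free_alg m n)" "letter (Neg c) \<in> carrier (free_alg m n)"
    if "c \<in> coords m n" for c
    using that by (rule letter_in_free_alg)+
  have sub: "submatrix_relators q a b c d \<subseteq> carrier (free_alg m n)"
    if "a \<in> coords m n" "b \<in> coords m n" "c \<in> coords m n" "d \<in> coords m n" for a b c d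
    unfolding submatrix_relators_def Let_def insert_subset
    by (intro conjI empty_subsetI minus mult letter const_in_free_alg that)
  have inv: "{letter (Pos c) * letter (Neg c) - 1, letter (Neg c) * letter (Pos c) - 1}
      \<subseteq> carrier (free_alg m n :: (torus_letter word \<Rightarrow>\<^sub>0 'k) ring)" if "c \<in> coords m n" for c
    unfolding insert_subset by (intro conjI empty_subsetI minus mult letter one that)
  show ?thesis
    unfolding torus_relators_def
  proof (rule Un_least)
    show "(\<Union>c \<in> coords m n. {letter (Pos c) * letter (Neg c) - 1,
        letter (Neg c) * letter (Pos c) - 1}) \<subseteq> carrier (free_alg m n :: (torus_letter word \<Rightarrow>\<^sub>0 'k) ring)"
      by (rule UN_least) (rule inv)
  next
    show "\<Union>{submatrix_relators q (i, j) (i, j') (i', j) (i', j') | i i' j j'.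
      1 \<le> i \<and> i < i' \<and> i' \<le> m \<and> 1 \<le> j \<and> j < j' \<and> j' \<le> n} \<subseteq> carrier (free_alg m n)"
    proof (rule Union_least, elim CollectE exE conjE)
      fix S i i' j j'
      assume "S = submatrix_relators q (i, j) (i, j') (i', j) (i', j')"
        and "1 \<le> i" "i < i'" "i' \<le> m" "1 \<le> j" "j < j'" "j' \<le> n"
      then show "S \<subseteq> carrier (free_alg m n)"
        using sub[of "(i, j)" "(i, j')" "(i', j)" "(i', j')"] by (simp add: coords_def)
    qed
  qed
qed

lemma torus_ideal_is_ideal: "ideal (torus_ideal m n q) (free_alg m n)"
  unfolding torus_ideal_def
  by (rule ring.genideal_ideal[OF ring_free_alg torus_relators_in_free_alg])

lemma ring_torus: "ring (torus m n q)"
  unfolding torus_def by (rule ideal.quotient_is_ring[OF torus_ideal_is_ideal])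


section \<open>Algebras inside the quantum torus\<close>

text \<open>
  The scalar action of \<open>'k\<close> is multiplication by \<^const>\<open>scalar\<close>: \<open>'k\<close>-subalgebras are the subrings
  containing all scalars, and \<open>'k\<close>-algebra homomorphisms the ring homomorphisms fixing them.
\<close>

definition subalg :: "nat \<Rightarrow> nat \<Rightarrow> 'k::field \<Rightarrow> (torus_letter word \<Rightarrow>\<^sub>0 'k) set set
    \<Rightarrow> (torus_letter word \<Rightarrow>\<^sub>0 'k) set ring" where
  "subalg m n q S =
    (torus m n q)\<lparr>carrier := generate_ring (torus m n q) (range (scalar m n q) \<union> S)\<rparr>"

definition alg_hom :: "nat \<Rightarrow> nat \<Rightarrow> 'k::field
    \<Rightarrow> (torus_letter word \<Rightarrow>\<^sub>0 'k) set ring \<Rightarrow> (torus_letter word \<Rightarrow>\<^sub>0 'k) set ring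
    \<Rightarrow> ((torus_letter word \<Rightarrow>\<^sub>0 'k) set \<Rightarrow> (torus_letter word \<Rightarrow>\<^sub>0 'k) set) set" where
  "alg_hom m n q R S = {f \<in> ring_hom R S. \<forall>c. f (scalar m n q c) = scalar m n q c}"

definition ordered_prod :: "('a, 'b) monoid_scheme \<Rightarrow> 'a list \<Rightarrow> 'a" where
  "ordered_prod R xs = foldr (monoid.mult R) xs \<one>\<^bsub>R\<^esub>"


section \<open>Cauchon diagrams and Cauchon graphs\<close>

definition cauchon_diagram :: "nat \<Rightarrow> nat \<Rightarrow> (nat \<times> nat) set \<Rightarrow> bool" where
  "cauchon_diagram m n B \<longleftrightarrow> B \<subseteq> coords m n \<and>
    (\<forall>(i, j) \<in> B. (\<forall>j'. 1 \<le> j' \<and> j' < j \<longrightarrow> (i, j') \<in> B) \<or> (\<forall>i'. 1 \<le> i' \<and> i' < i \<longrightarrow> (i', j) \<in> B))"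

datatype vertex = White "nat \<times> nat" | Row nat | Col nat

definition horizontal_arcs :: "nat \<Rightarrow> nat \<Rightarrow> (nat \<times> nat) set \<Rightarrow> (vertex \<times> vertex) set" where
  "horizontal_arcs m n B = (let W = coords m n - B in
    {(White (i, j), White (i, j')) | i j j'. (i, j) \<in> W \<and> (i, j') \<in> W \<and> j' < j \<and>
      (\<forall>j''. j' < j'' \<and> j'' < j \<longrightarrow> (i, j'') \<notin> W)}
    \<union> {(Row i, White (i, j)) | i j. (i, j) \<in> W \<and> (\<forall>j' > j. (i, j') \<notin> W)})"

definition vertical_arcs :: "nat \<Rightarrow> nat \<Rightarrow> (nat \<times> nat) set \<Rightarrow> (vertex \<times> vertex) set" where
  "vertical_arcs m n B = (let W = coords m n - B in
    {(White (i, j), White (i', j)) | i i' j. (i, j) \<in> W \<and> (i', j) \<in> W \<and> i < i' \<and>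
      (\<forall>i''. i < i'' \<and> i'' < i' \<longrightarrow> (i'', j) \<notin> W)}
    \<union> {(White (i, j), Col j) | i j. (i, j) \<in> W \<and> (\<forall>i' > i. (i', j) \<notin> W)})"

definition cauchon_graph ::
    "nat \<Rightarrow> nat \<Rightarrow> (nat \<times> nat) set \<Rightarrow> (vertex, vertex \<times> vertex) pre_digraph" where
  "cauchon_graph m n B =
    \<lparr>verts = White ` (coords m n - B) \<union> Row ` {1..m} \<union> Col ` {1..n},
     arcs = horizontal_arcs m n B \<union> vertical_arcs m n B, tail = fst, head = snd\<rparr>"

lemma wf_cauchon_graph: "wf_digraph (cauchon_graph m n B)"
  by standard
    (auto simp: cauchon_graph_def horizontal_arcs_def vertical_arcs_def coords_def Let_def)

text \<open>An arc between two white vertices is horizontal iff both lie in the same row.\<close>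

fun arc_weight ::
    "nat \<Rightarrow> nat \<Rightarrow> 'k::field \<Rightarrow> vertex \<times> vertex \<Rightarrow> (torus_letter word \<Rightarrow>\<^sub>0 'k) set" where
  "arc_weight m n q (White (i, j), White (i', j')) =
    (if i = i' then tinv m n q (i, j) \<otimes>\<^bsub>torus m n q\<^esub> tgen m n q (i', j') else \<one>\<^bsub>torus m n q\<^esub>)"
| "arc_weight m n q (Row _, White c) = tgen m n q c"
| "arc_weight m n q _ = \<one>\<^bsub>torus m n q\<^esub>"

definition path_weight ::
    "nat \<Rightarrow> nat \<Rightarrow> 'k::field \<Rightarrow> (vertex \<times> vertex) list \<Rightarrow> (torus_letter word \<Rightarrow>\<^sub>0 'k) set" where
  "path_weight m n q p = ordered_prod (torus m n q) (map (arc_weight m n q) p)"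

text \<open>The coordinates of the backwards-L turns of a path, given as its list of arcs.\<close>

definition turns :: "nat \<Rightarrow> nat \<Rightarrow> (nat \<times> nat) set \<Rightarrow> (vertex \<times> vertex) list \<Rightarrow> (nat \<times> nat) set" where
  "turns m n B p = {c. \<exists>k. Suc k < length p \<and> p ! k \<in> vertical_arcs m n B \<and>
    p ! Suc k \<in> horizontal_arcs m n B \<and> snd (p ! k) = White c}"

definition paths :: "nat \<Rightarrow> nat \<Rightarrow> (nat \<times> nat) set \<Rightarrow> nat \<Rightarrow> nat \<times> nat
    \<Rightarrow> (vertex \<times> vertex) list set" where
  "paths m n B t = (\<lambda>(i, j). {p. pre_digraph.apath (cauchon_graph m n B) (Row i) p (Col j) \<and>
    (\<forall>c \<in> turns m n B p. c \<le> nth_coord m n t)})"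


section \<open>The algebras generated by path sums\<close>

definition xgen :: "nat \<Rightarrow> nat \<Rightarrow> 'k::field \<Rightarrow> (nat \<times> nat) set \<Rightarrow> nat \<Rightarrow> nat \<times> nat
    \<Rightarrow> (torus_letter word \<Rightarrow>\<^sub>0 'k) set" where
  "xgen m n q B t c = (\<Oplus>\<^bsub>torus m n q\<^esub>p \<in> paths m n B t c. path_weight m n q p)"

definition path_alg :: "nat \<Rightarrow> nat \<Rightarrow> 'k::field \<Rightarrow> (nat \<times> nat) set \<Rightarrow> nat
    \<Rightarrow> (torus_letter word \<Rightarrow>\<^sub>0 'k) set ring" where
  "path_alg m n q B t = subalg m n q (xgen m n q B t ` coords m n)"

definition qminor :: "nat \<Rightarrow> nat \<Rightarrow> 'k::field \<Rightarrow> nat \<Rightarrow> nat set \<Rightarrow> nat set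
    \<Rightarrow> (torus_letter word \<Rightarrow>\<^sub>0 'k) set" where
  "qminor m n q t I J = (\<Oplus>\<^bsub>torus m n q\<^esub>\<sigma> \<in> {\<sigma>. \<sigma> permutes {..<card I}}.
    scalar m n q ((- q) ^ card {(a, b). a < b \<and> b < card I \<and> \<sigma> a > \<sigma> b})
    \<otimes>\<^bsub>torus m n q\<^esub> ordered_prod (torus m n q)
      (map (\<lambda>a. xgen m n q {} t (sorted_list_of_set I ! a, sorted_list_of_set J ! \<sigma> a))
        [0..<card I]))"

text \<open>
  Exponent matrices are functions on the coordinates, extensional in the sense of
  \<^const>\<open>PiE\<close> so that distinct functions are distinct matrices.
\<close>

definition exponents :: "nat \<Rightarrow> nat \<Rightarrow> (nat \<times> nat \<Rightarrow> nat) set" where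
  "exponents m n = coords m n \<rightarrow>\<^sub>E UNIV"

definition matrix_less ::
    "nat \<Rightarrow> nat \<Rightarrow> (nat \<times> nat \<Rightarrow> nat) \<Rightarrow> (nat \<times> nat \<Rightarrow> nat) \<Rightarrow> bool" where
  "matrix_less m n M N \<longleftrightarrow>
    (\<exists>c \<in> coords m n. M c < N c \<and> (\<forall>c' \<in> coords m n. c' < c \<longrightarrow> M c' = N c'))"

definition xmonom :: "nat \<Rightarrow> nat \<Rightarrow> 'k::field \<Rightarrow> nat \<Rightarrow> (nat \<times> nat \<Rightarrow> nat)
    \<Rightarrow> (torus_letter word \<Rightarrow>\<^sub>0 'k) set" where
  "xmonom m n q t N = ordered_prod (torus m n q)
    (map (\<lambda>c. xgen m n q {} t c [^]\<^bsub>torus m n q\<^esub> N c) (sorted_list_of_set (coords m n)))"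

definition xmonom_dvd :: "nat \<Rightarrow> nat \<Rightarrow> 'k::field \<Rightarrow> nat
    \<Rightarrow> (torus_letter word \<Rightarrow>\<^sub>0 'k) set \<Rightarrow> (torus_letter word \<Rightarrow>\<^sub>0 'k) set \<Rightarrow> bool" where
  "xmonom_dvd m n q t u v \<longleftrightarrow> (\<exists>M \<in> exponents m n. \<exists>N \<in> exponents m n.
    u = xmonom m n q t M \<and> v = xmonom m n q t N \<and> (\<forall>c \<in> coords m n. M c \<le> N c))"

text \<open>
  The expansion of an element in the basis of ordered monomials and its leading term. Both
  descriptions rely on these monomials being a basis, for \<open>q\<close> nonzero.
\<close>

definition expansion :: "nat \<Rightarrow> nat \<Rightarrow> 'k::field \<Rightarrow> nat \<Rightarrow> (torus_letter word \<Rightarrow>\<^sub>0 'k) set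
    \<Rightarrow> (nat \<times> nat \<Rightarrow> nat) \<Rightarrow>\<^sub>0 'k" where
  "expansion m n q t a = (THE f. Poly_Mapping.keys f \<subseteq> exponents m n \<and>
    a = (\<Oplus>\<^bsub>torus m n q\<^esub>N \<in> Poly_Mapping.keys f.
          scalar m n q (Poly_Mapping.lookup f N) \<otimes>\<^bsub>torus m n q\<^esub> xmonom m n q t N))"

definition leading_term :: "nat \<Rightarrow> nat \<Rightarrow> 'k::field \<Rightarrow> nat \<Rightarrow> (torus_letter word \<Rightarrow>\<^sub>0 'k) set
    \<Rightarrow> (torus_letter word \<Rightarrow>\<^sub>0 'k) set" where
  "leading_term m n q t a = xmonom m n q t (THE N. N \<in> Poly_Mapping.keys (expansion m n q t a) \<and>
    (\<forall>M \<in> Poly_Mapping.keys (expansion m n q t a). M \<noteq> N \<longrightarrow> matrix_less m n M N))"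

definition right_ideal :: "'a set \<Rightarrow> ('a, 'b) ring_scheme \<Rightarrow> bool" where
  "right_ideal J R \<longleftrightarrow> additive_subgroup J R \<and> (\<forall>a \<in> J. \<forall>r \<in> carrier R. a \<otimes>\<^bsub>R\<^esub> r \<in> J)"

text \<open>
  Zero has no leading term, so a zero element of \<open>G\<close> does not count as a witness.
\<close>

definition groebner_basis :: "nat \<Rightarrow> nat \<Rightarrow> 'k::field \<Rightarrow> nat
    \<Rightarrow> (torus_letter word \<Rightarrow>\<^sub>0 'k) set set \<Rightarrow> (torus_letter word \<Rightarrow>\<^sub>0 'k) set set \<Rightarrow> bool" where
  "groebner_basis m n q t J G \<longleftrightarrow>
    right_ideal J (path_alg m n q {} t) \<and> finite G \<and> G \<subseteq> J \<and>
    (\<forall>a \<in> J. a \<noteq> \<zero>\<^bsub>torus m n q\<^esub> \<longrightarrow> (\<exists>g \<in> G. g \<noteq> \<zero>\<^bsub>torus m n q\<^esub> \<and>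
      xmonom_dvd m n q t (leading_term m n q t g) (leading_term m n q t a)))"

end

theory Submission
  imports Defs
begin

text \<open>
  The weight of a path telescopes, so up to a power of \<open>q\<close> it is determined by the columns in which
  the path leaves the rows, and the weights of two families of paths are proportional iff both
  families leave every row in the same columns. Exchanging the tails (or heads) of two paths at a
  meeting point multiplies the product of their weights by a power of \<open>q\<close>. This yields the
  commutation relations of the generators, hence that the ordered monomials span, and the vanishing
  of every quantum minor for which there is no non-crossing family of paths (a quantum version of the
  lemma of Lindstroem, Gessel and Viennot).

  Now let \<open>a\<close> be an element of \<open>A\<^sup>(\<^sup>t\<^sup>)\<close> with leading term \<open>x\<^sup>N\<close> such that no element of \<open>G\<^sub>t\<close> has a leading
  term dividing \<open>x\<^sup>N\<close>. By the vanishing criterion, every chain of coordinates in the support of \<open>N\<close> is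
  joined by non-crossing paths. Choose the leftmost paths for all coordinates of the support
  simultaneously. No other family of paths with the same or a smaller exponent matrix leaves every
  row in the same columns as this one. So the monomial of the family occurs in \<open>\<sigma> (x\<^sup>N)\<close> and in no
  \<open>\<sigma> (x\<^sup>M)\<close> with \<open>M \<prec> N\<close>, whence \<open>\<sigma> a \<noteq> 0\<close>. For \<open>B = {}\<close> the same argument shows that the ordered
  monomials are linearly independent.
\<close>

section \<open>Paths as column sequences\<close>

text \<open>The obstacle is that the support of \<open>N\<close> is in general not a chain, while a
  vanishing minor speaks about one chain only. In a family for the whole support, paths of
  coordinates not related by \<open>nw\<close> may meet, and exchanging tails there preserves all
  columns, so another family could produce the same monomial. Between a lower-left and an
  upper-right coordinate the exchange leads to a larger exponent matrix, which is harmless; within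
  one row or column it keeps the matrix. What has to be excluded is settled by leftmost choices: the
  meeting patterns they allow (\<open>crossing1\<close> to \<open>crossing3\<close>) are rigid
  enough to recover the path of the least coordinate from the columns alone, and after removing it
  the next one. The word monomials of the torus must also be known to be independent. This comes
  from linear functionals \<open>coef e\<close> on the free algebra that annihilate the defining
  ideal.\<close>

text \<open>
  A path from row \<open>i\<close> to column \<open>j\<close> is encoded by the function \<open>a\<close> giving the column \<open>a k\<close> in which
  it leaves row \<open>k\<close> downwards, with \<open>a k = Suc n\<close> above its starting row and \<open>a k = j\<close> from row
  \<open>m\<close> on.
\<close>

lemma nat_SUP_attained:
  fixes f :: "'a \<Rightarrow> nat"
  assumes "A \<noteq> {}" "bdd_above (f ` A)"
  shows "\<exists>a\<in>A. (SUP a\<in>A. f a) = f a"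
proof -
  have "Max (f ` A) \<in> f ` A" using assms by (intro Max_in) (auto simp: bdd_above_nat)
  then show ?thesis using assms(1) by (auto simp: Sup_nat_def)
qed

locale cauchon_grid =
  fixes m n :: nat and B :: "(nat \<times> nat) set" and rs :: "nat \<times> nat"
  assumes cauchon: "cauchon_diagram m n B"
begin

definition W :: "(nat \<times> nat) set" where "W = coords m n - B"

text \<open>Passage through row \<open>k\<close>, arriving in column \<open>u\<close> and leaving in
  column \<open>w\<close>. The case \<open>w = u\<close> includes passing over a black square and,
  for \<open>u = Suc n\<close>, not having started. Entering from the row vertex is not a turn, so
  it escapes the bound \<open>rs\<close>.\<close>

definition step :: "nat \<Rightarrow> nat \<Rightarrow> nat \<Rightarrow> bool" where
  "step k u w \<longleftrightarrow> w = u \<or> (w < u \<and> (k, w) \<in> W \<and> (u = Suc n \<or> (k, u) \<in> W \<and> (k, u) \<le> rs))"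

definition vpath :: "nat \<times> nat \<Rightarrow> (nat \<Rightarrow> nat) \<Rightarrow> bool" where
  "vpath c a \<longleftrightarrow> c \<in> coords m n \<and> (\<forall>k < fst c. a k = Suc n) \<and> a (fst c) \<le> n \<and>
    (\<forall>k < m. step (Suc k) (a k) (a (Suc k))) \<and> (\<forall>k \<ge> m. a k = snd c)"

definition above :: "nat \<Rightarrow> nat \<Rightarrow> bool" where
  "above k u \<longleftrightarrow> u = Suc n \<or> (\<exists>k0 < k. (k0, u) \<in> W)"

lemma W_range: "(k, u) \<in> W \<Longrightarrow> 1 \<le> k \<and> k \<le> m \<and> 1 \<le> u \<and> u \<le> n"
  by (auto simp: W_def coords_def)

text \<open>Were \<open>(k, u)\<close> black, all squares to its left or all squares above it would
  be black, against \<open>(k, w)\<close> or the white square higher up. This is how the Cauchon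
  condition acts on paths: a horizontal and a vertical run that cross do so at a white
  vertex.\<close>

lemma W_cauchon:
  assumes "above k u" "u \<le> n" "(k, w) \<in> W" "w < u"
  shows "(k, u) \<in> W"
proof (rule ccontr)
  assume "(k, u) \<notin> W"
  moreover have "(k, u) \<in> coords m n"
    using assms W_range[of k w] by (auto simp: coords_def)
  ultimately have "(k, u) \<in> B" by (simp add: W_def)
  then consider "\<forall>j'. 1 \<le> j' \<and> j' < u \<longrightarrow> (k, j') \<in> B" | "\<forall>i'. 1 \<le> i' \<and> i' < k \<longrightarrow> (i', u) \<in> B"
    using cauchon unfolding cauchon_diagram_def by fast
  then show False
  proof cases
    case 1
    then show ?thesis using assms W_range[of k w] by (auto simp: W_def)
  next
    case 2
    obtain k0 where "k0 < k" "(k0, u) \<in> W" using assms(1,2) by (auto simp: above_def)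
    then show ?thesis using 2 W_range[of k0 u] by (auto simp: W_def)
  qed
qed

lemma step_le: "step k u w \<Longrightarrow> w \<le> u"
  by (auto simp: step_def)

lemma step_refl [simp]: "step k u u"
  by (simp add: step_def)

text \<open>Overlapping runs in one row may exchange their exits. A missing vertex is white by
  \<open>W_cauchon\<close>, and a new turn lies left of a turn of the other run, hence is
  \<open>\<le> rs\<close>. This argument fails only if the other run comes from the row vertex, the
  case of the last premise.\<close>

lemma step_swap:
  assumes s: "step k u w" and s': "step k u' w'" and "above k u" "above k u'"
    and "w' \<le> u" "w \<le> u'" "u \<le> Suc n"
    and rs: "u' = Suc n \<Longrightarrow> u \<le> n \<Longrightarrow> w' < u \<Longrightarrow> (k, u) \<le> rs"
  shows "step k u w'"
proof (cases "w' = u")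
  case False
  then have less: "w' < u" using assms by simp
  have w': "(k, w') \<in> W"
  proof (cases "w' < u'")
    case True then show ?thesis using s' by (auto simp: step_def)
  next
    case False
    then have eq: "w' = u'" using step_le[OF s'] by simp
    then have "w < u" using less assms by simp
    then have w: "(k, w) \<in> W" using s by (auto simp: step_def)
    show ?thesis
    proof (cases "w = w'")
      case True then show ?thesis using w by simp
    next
      case False
      then show ?thesis using W_cauchon[OF \<open>above k u'\<close> _ w] eq less assms by simp
    qed
  qed
  have "(k, u) \<in> W \<and> (k, u) \<le> rs" if "u \<le> n"
  proof (cases "w < u")
    case True then show ?thesis using s that by (auto simp: step_def)
  next
    case False
    then have "w = u" using step_le[OF s] by simp
    then have le: "u \<le> u'" using assms by simp
    have "(k, u) \<le> rs"
    proof (cases "u' = Suc n")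
      case False
      then have "(k, u') \<le> rs" using s' le less by (auto simp: step_def)
      moreover have "(k, u) \<le> (k, u')" using le by (simp add: less_eq_prod_def)
      ultimately show ?thesis by (rule order_trans[rotated])
    qed (use rs that less in simp)
    then show ?thesis using W_cauchon[OF \<open>above k u\<close> that w' less] by simp
  qed
  then show ?thesis using w' less assms(7) unfolding step_def by (cases "u = Suc n") auto
qed simp

lemma vpath_step: "vpath c a \<Longrightarrow> k < m \<Longrightarrow> step (Suc k) (a k) (a (Suc k))"
  by (simp add: vpath_def)

lemma vpath_end: "vpath c a \<Longrightarrow> m \<le> k \<Longrightarrow> a k = snd c"
  by (simp add: vpath_def)

lemma vpath_before: "vpath c a \<Longrightarrow> k < fst c \<Longrightarrow> a k = Suc n"
  by (simp add: vpath_def)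

lemma vpath_range: "vpath c a \<Longrightarrow> 1 \<le> fst c \<and> fst c \<le> m \<and> 1 \<le> snd c \<and> snd c \<le> n"
  by (auto simp: vpath_def coords_def)

lemma vpath_Suc: "vpath c a \<Longrightarrow> a (Suc k) \<le> a k"
  by (cases "k < m") (auto dest: vpath_step step_le simp: vpath_end)

lemma vpath_antimono: "vpath c a \<Longrightarrow> k \<le> l \<Longrightarrow> a l \<le> a k"
  by (rule lift_Suc_antimono_le[of a]) (auto dest: vpath_Suc)

lemma vpath_le: "vpath c a \<Longrightarrow> a k \<le> Suc n"
  using vpath_antimono[of c a 0 k] vpath_before[of c a 0] vpath_range[of c a] by simp

lemma vpath_after: "vpath c a \<Longrightarrow> fst c \<le> k \<Longrightarrow> a k \<le> n"
  using vpath_antimono[of c a "fst c" k] by (simp add: vpath_def)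

lemma vpath_eq_Suc_iff: "vpath c a \<Longrightarrow> a k = Suc n \<longleftrightarrow> k < fst c"
  using vpath_after[of c a k] vpath_before[of c a k] by (cases "k < fst c") auto

lemma vpath_le_iff: "vpath c a \<Longrightarrow> a k \<le> n \<longleftrightarrow> fst c \<le> k"
  using vpath_after[of c a k] vpath_before[of c a k] by (cases "k < fst c") auto

lemma vpath_ge: "vpath c a \<Longrightarrow> snd c \<le> a k"
  using vpath_antimono[of c a k "max k m"] vpath_end[of c a "max k m"] by simp

lemma vpath_above:
  assumes "vpath c a" "k < m"
  shows "above (Suc k) (a k)"
  using assms(2)
proof (induction k)
  case 0
  then show ?case using vpath_before[OF assms(1), of 0] vpath_range[OF assms(1)] by (simp add: above_def)
next
  case (Suc k)
  then have "above (Suc k) (a k)" by simp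
  with vpath_step[OF assms(1), of k] Suc show ?case
    unfolding above_def step_def by (metis Suc_lessD lessI less_SucI)
qed

text \<open>To get left of column \<open>a l\<close>, the path must turn out of it in some row below
  \<open>l\<close>. That turn is \<open>\<le> rs\<close>, and moving up in a column decreases the
  coordinate.\<close>

lemma vpath_turn_le:
  assumes "vpath c a" "a k < a l" "l < m" "a l \<le> n"
  shows "(Suc l, a l) \<le> rs"
proof -
  have "l < k"
    using assms(2) vpath_antimono[OF assms(1), of k l] by (meson leD not_le_imp_less)
  define h where "h = (LEAST h. l \<le> h \<and> a (Suc h) < a l)"
  have ex: "\<exists>h. l \<le> h \<and> a (Suc h) < a l"
    using assms(2) \<open>l < k\<close> by (intro exI[of _ "k - 1"]) auto
  have h: "l \<le> h" "a (Suc h) < a l"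
    using LeastI_ex[OF ex] unfolding h_def by auto
  have eq: "a h = a l"
  proof (cases "h = l")
    case False
    then have "\<not> a (Suc (h - 1)) < a l"
      using not_less_Least[of "h - 1" "\<lambda>h. l \<le> h \<and> a (Suc h) < a l"] h unfolding h_def[symmetric] by auto
    moreover have "Suc (h - 1) = h" using False h by simp
    ultimately show ?thesis using vpath_antimono[OF assms(1), of l h] h by simp
  qed simp
  have "h < m"
  proof (rule ccontr)
    assume "\<not> h < m"
    then show False using h eq vpath_end[OF assms(1)] by simp
  qed
  then have "(Suc h, a h) \<le> rs"
    using vpath_step[OF assms(1), of h] h eq assms(4) by (auto simp: step_def)
  moreover have "(Suc l, a l) \<le> (Suc h, a h)" using h eq by (simp add: less_eq_prod_def)
  ultimately show ?thesis by (rule order_trans[rotated])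
qed

lemma vpath_swap:
  assumes a: "vpath c a" and b: "vpath d b" and "k < m" "b (Suc k) \<le> a k" "a (Suc k) \<le> b k"
    and "b k = Suc n \<Longrightarrow> a k \<le> n \<Longrightarrow> b (Suc k) < a k \<Longrightarrow> (Suc k, a k) \<le> rs"
  shows "step (Suc k) (a k) (b (Suc k))"
  using step_swap[OF vpath_step[OF a] vpath_step[OF b] vpath_above[OF a] vpath_above[OF b]] assms vpath_le[OF a]
  by blast

text \<open>Around each row the infimum is attained by some \<open>a\<close> above and some
  \<open>b\<close> below. Minimality makes their runs overlap, so \<open>a\<close> may continue
  along \<open>b\<close>. As all paths start in the same row, the exceptional case of
  \<open>vpath_swap\<close> cannot occur.\<close>

lemma vpath_Inf:
  assumes A: "A \<noteq> {}" "\<And>a. a \<in> A \<Longrightarrow> vpath c a"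
  shows "vpath c (\<lambda>k. INF a\<in>A. a k)" (is "vpath c ?f")
proof -
  have att: "\<exists>a\<in>A. ?f k = a k" for k
    using Inf_nat_def1[of "(\<lambda>a. a k) ` A"] A(1) by auto
  have low: "?f k \<le> a k" if "a \<in> A" for a k
    using that by (intro cINF_lower) auto
  obtain a0 where a0: "a0 \<in> A" using A(1) by auto
  have "step (Suc k) (?f k) (?f (Suc k))" if k: "k < m" for k
  proof -
    obtain a b where a: "a \<in> A" "?f k = a k" and b: "b \<in> A" "?f (Suc k) = b (Suc k)"
      using att by metis
    note va = A(2)[OF a(1)] and vb = A(2)[OF b(1)]
    have 1: "b (Suc k) \<le> a (Suc k)" using low[OF a(1), of "Suc k"] b(2) by simp
    have 2: "a k \<le> b k" using low[OF b(1), of k] a(2) by simp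
    show ?thesis unfolding a(2) b(2)
    proof (rule vpath_swap[OF va vb k])
      show "b (Suc k) \<le> a k" using 1 vpath_Suc[OF va, of k] by simp
      show "a (Suc k) \<le> b k" using 2 vpath_Suc[OF va, of k] by simp
      show "(Suc k, a k) \<le> rs" if "b k = Suc n" "a k \<le> n"
        using that vpath_eq_Suc_iff[OF vb, of k] vpath_le_iff[OF va, of k] by simp
    qed
  qed
  moreover have "?f k = Suc n" if "k < fst c" for k
    using att[of k] A(2) that by (metis vpath_before)
  moreover have "?f (fst c) \<le> n"
    using low[OF a0, of "fst c"] A(2)[OF a0] by (simp add: vpath_def)
  moreover have "?f k = snd c" if "m \<le> k" for k
    using att[of k] A(2) that by (metis vpath_end)
  ultimately show ?thesis using A(2)[OF a0] unfolding vpath_def by blast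
qed

lemma vpath_Sup:
  assumes A: "A \<noteq> {}" "\<And>a. a \<in> A \<Longrightarrow> vpath c a"
  shows "vpath c (\<lambda>k. SUP a\<in>A. a k)" (is "vpath c ?f")
proof -
  have bdd: "bdd_above ((\<lambda>a. a k) ` A)" for k
    using vpath_le[OF A(2)] by (intro bdd_aboveI[of _ "Suc n"]) auto
  have att: "\<exists>a\<in>A. ?f k = a k" for k
    by (rule nat_SUP_attained[OF A(1) bdd])
  have upp: "a k \<le> ?f k" if "a \<in> A" for a k
    using that bdd by (intro cSUP_upper) auto
  obtain a0 where a0: "a0 \<in> A" using A(1) by auto
  have "step (Suc k) (?f k) (?f (Suc k))" if k: "k < m" for k
  proof -
    obtain a b where a: "a \<in> A" "?f k = a k" and b: "b \<in> A" "?f (Suc k) = b (Suc k)"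
      using att by metis
    note va = A(2)[OF a(1)] and vb = A(2)[OF b(1)]
    have 1: "a (Suc k) \<le> b (Suc k)" using upp[OF a(1), of "Suc k"] b(2) by simp
    have 2: "b k \<le> a k" using upp[OF b(1), of k] a(2) by simp
    show ?thesis unfolding a(2) b(2)
    proof (rule vpath_swap[OF va vb k])
      show "b (Suc k) \<le> a k" using 2 vpath_Suc[OF vb, of k] by simp
      show "a (Suc k) \<le> b k" using 1 vpath_Suc[OF vb, of k] by simp
      show "(Suc k, a k) \<le> rs" if "b k = Suc n" "a k \<le> n"
        using that vpath_eq_Suc_iff[OF vb, of k] vpath_le_iff[OF va, of k] by simp
    qed
  qed
  moreover have "?f k = Suc n" if "k < fst c" for k
    using att[of k] A(2) that by (metis vpath_before)
  moreover have "?f (fst c) \<le> n"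
    using att[of "fst c"] A(2) by (metis order_refl vpath_after)
  moreover have "?f k = snd c" if "m \<le> k" for k
    using att[of k] A(2) that by (metis vpath_end)
  ultimately show ?thesis using A(2)[OF a0] unfolding vpath_def by blast
qed

section \<open>Non-crossing families\<close>

text \<open>In row \<open>Suc k\<close> the path \<open>a\<close> occupies the columns from
  \<open>a (Suc k)\<close> to \<open>a k\<close>; they have to lie strictly left of those of
  \<open>b\<close>, unless \<open>b\<close> has not started. For paths this forces \<open>a\<close>
  to start in a strictly higher row.\<close>

definition prec :: "(nat \<Rightarrow> nat) \<Rightarrow> (nat \<Rightarrow> nat) \<Rightarrow> bool" where
  "prec a b \<longleftrightarrow> (\<forall>k < m. a k < b (Suc k) \<or> b (Suc k) = Suc n)"

definition nw :: "nat \<times> nat \<Rightarrow> nat \<times> nat \<Rightarrow> bool" where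
  "nw c d \<longleftrightarrow> fst c < fst d \<and> snd c < snd d"

lemma prec_mono: "prec a b \<Longrightarrow> (\<And>k. a' k \<le> a k) \<Longrightarrow> prec a' b"
  unfolding prec_def by (meson order_le_less_trans)

text \<open>
  Chains are lists with the south-easternmost coordinate first. The greedy system along a chain is
  the leftmost one: its paths are pointwise at most those of any other system.
\<close>

fun cands :: "(nat \<times> nat) list \<Rightarrow> (nat \<Rightarrow> nat) set"
and greedy :: "(nat \<times> nat) list \<Rightarrow> nat \<Rightarrow> nat" where
  "cands [] = {}"
| "cands [c] = {a. vpath c a}"
| "cands (c # d # C) = {a. vpath c a \<and> prec (greedy (d # C)) a}"
| "greedy C = (\<lambda>k. INF a \<in> cands C. a k)"

declare greedy.simps [simp del]

definition system :: "(nat \<times> nat) list \<Rightarrow> (nat \<Rightarrow> nat) list \<Rightarrow> bool" where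
  "system C Q \<longleftrightarrow> list_all2 vpath C Q \<and> (\<forall>l. Suc l < length Q \<longrightarrow> prec (Q ! Suc l) (Q ! l))"

definition chain :: "(nat \<times> nat) list \<Rightarrow> bool" where
  "chain C \<longleftrightarrow> C \<noteq> [] \<and> (\<forall>l. Suc l < length C \<longrightarrow> nw (C ! Suc l) (C ! l))"

lemma cands_vpath: "a \<in> cands (c # C) \<Longrightarrow> vpath c a"
  by (cases C) auto

lemma greedy_vpath: "cands (c # C) \<noteq> {} \<Longrightarrow> vpath c (greedy (c # C))"
  unfolding greedy.simps by (rule vpath_Inf) (auto dest: cands_vpath)

lemma greedy_le: "a \<in> cands C \<Longrightarrow> greedy C k \<le> a k"
  unfolding greedy.simps by (intro cINF_lower) auto

lemma greedy_prec:
  assumes "cands (c # d # C) \<noteq> {}"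
  shows "prec (greedy (d # C)) (greedy (c # d # C))"
proof -
  have "\<exists>a\<in>cands (c # d # C). greedy (c # d # C) k = a k" for k
    using Inf_nat_def1[of "(\<lambda>a. a k) ` cands (c # d # C)"] assms unfolding greedy.simps[of "c # d # C"] by auto
  then show ?thesis unfolding prec_def by (metis (no_types, lifting) cands.simps(3) mem_Collect_eq prec_def)
qed

text \<open>Greediness never blocks: \<open>prec\<close> is monotone in its left argument, so
  replacing a path of a system by the smaller greedy one keeps the next path a candidate.\<close>

lemma greedy_least:
  assumes "system C Q" "C \<noteq> []"
  shows "hd Q \<in> cands C"
  using assms
proof (induction C arbitrary: Q)
  case (Cons c C)
  then obtain a Q' where Q: "Q = a # Q'" "vpath c a" "list_all2 vpath C Q'"
    by (auto simp: system_def list_all2_Cons1)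
  show ?case
  proof (cases C)
    case Nil then show ?thesis using Q by simp
  next
    case (Cons d C')
    then obtain b Q'' where Q': "Q' = b # Q''" using Q by (auto simp: list_all2_Cons1)
    have "system C Q'" unfolding system_def
      using Q Cons.prems(1) by (auto simp: system_def dest: spec[of _ "Suc _"])
    then have "hd Q' \<in> cands C" using Cons.IH local.Cons by simp
    then have "greedy C k \<le> b k" for k using greedy_le Q' by fastforce
    moreover have "prec b a" using Cons.prems(1) Q Q' by (auto simp: system_def dest: spec[of _ 0])
    ultimately show ?thesis using prec_mono Q Cons by auto
  qed
qed simp


text \<open>
  The greedy path to \<open>c\<close> depends on the chain; taking suprema over all chains ending in \<open>c\<close> makes the
  paths of all comparable coordinates non-crossing at once and keeps them leftmost.
\<close>

definition least_family :: "(nat \<times> nat) set \<Rightarrow> (nat \<times> nat \<Rightarrow> nat \<Rightarrow> nat) \<Rightarrow> bool" where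
  "least_family S P \<longleftrightarrow> (\<forall>c\<in>S. vpath c (P c)) \<and> (\<forall>c\<in>S. \<forall>d\<in>S. nw c d \<longrightarrow> prec (P c) (P d)) \<and>
    (\<forall>c\<in>S. \<forall>a. vpath c a \<and> (\<forall>d\<in>S. nw d c \<longrightarrow> prec (P d) a) \<longrightarrow> (\<forall>k. P c k \<le> a k))"

lemma least_family_exists:
  assumes route: "\<And>C. chain C \<Longrightarrow> set C \<subseteq> S \<Longrightarrow> \<exists>Q. system C Q"
  obtains P where "least_family S P"
proof -
  define Ch where "Ch c = {C. chain C \<and> set C \<subseteq> S \<and> hd C = c}" for c
  define P where "P c = (\<lambda>k. SUP a\<in>greedy ` Ch c. a k)" for c
  have ne: "cands C \<noteq> {}" if "chain C" "set C \<subseteq> S" for C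
    using route[OF that] greedy_least that(1) by (metis chain_def emptyE)
  have path: "vpath c a" if aC: "a \<in> greedy ` Ch c" for a c
  proof -
    obtain C where C: "C \<in> Ch c" "a = greedy C" using aC by blast
    then obtain C' where "C = c # C'" by (cases C) (auto simp: Ch_def chain_def)
    then show ?thesis using greedy_vpath ne C by (auto simp: Ch_def)
  qed
  have bdd: "bdd_above ((\<lambda>a. a k) ` greedy ` Ch c)" for c k
  proof (rule bdd_aboveI[of _ "Suc n"])
    fix x assume "x \<in> (\<lambda>a. a k) ` greedy ` Ch c"
    then obtain a where "a \<in> greedy ` Ch c" "x = a k" by blast
    then show "x \<le> Suc n" using vpath_le[OF path] by blast
  qed
  have single: "[c] \<in> Ch c" if "c \<in> S" for c using that by (auto simp: Ch_def chain_def)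
  have upp: "greedy C k \<le> P c k" if "C \<in> Ch c" for C c k
    unfolding P_def using that bdd by (intro cSUP_upper) auto
  have att: "\<exists>C\<in>Ch c. P c k = greedy C k" if "c \<in> S" for c k
    unfolding P_def using nat_SUP_attained[OF _ bdd[of k c]] single[OF that] by fastforce
  have ext: "c # C \<in> Ch c" if "C \<in> Ch d" "c \<in> S" "nw d c" for c d C
    using that unfolding Ch_def chain_def by (auto simp: nth_Cons hd_conv_nth split: nat.split)
  have P: "vpath c (P c)" if "c \<in> S" for c
    unfolding P_def using path single[OF that] by (intro vpath_Sup) auto
  \<comment> \<open>The supremum for \<open>d\<close> is attained by a chain \<open>C\<close>.
    Prepending \<open>c\<close> gives a chain for \<open>c\<close>, whose greedy path lies right of
    that of \<open>C\<close> and is at most \<open>P c\<close>.\<close>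
  have good: "prec (P d) (P c)" if c: "c \<in> S" and d: "d \<in> S" and "nw d c" for c d
    unfolding prec_def
  proof (intro allI impI)
    fix k assume k: "k < m"
    obtain C where C: "C \<in> Ch d" "P d k = greedy C k" using att[OF d] by blast
    then obtain C' where C': "C = d # C'" by (cases C) (auto simp: Ch_def chain_def)
    have "c # C \<in> Ch c" using ext C that by blast
    then have "cands (c # C) \<noteq> {}" using ne by (auto simp: Ch_def)
    then have "prec (greedy C) (greedy (c # C))" using greedy_prec C' by simp
    then have "greedy C k < greedy (c # C) (Suc k) \<or> greedy (c # C) (Suc k) = Suc n"
      using k by (simp add: prec_def)
    then show "P d k < P c (Suc k) \<or> P c (Suc k) = Suc n"
      using upp[OF \<open>c # C \<in> Ch c\<close>, of "Suc k"] vpath_le[OF P[OF c], of "Suc k"] C(2) by linarith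
  qed
  \<comment> \<open>The value \<open>P c k\<close> comes from a chain \<open>c # d # C''\<close>. A
    path right of \<open>P d\<close> is right of the smaller greedy path of \<open>d # C''\<close>,
    hence a candidate.\<close>
  have least: "P c k \<le> a k" if c: "c \<in> S" and a: "vpath c a" and dom: "\<And>d. d \<in> S \<Longrightarrow> nw d c \<Longrightarrow> prec (P d) a" for c a k
  proof -
    obtain C where C: "C \<in> Ch c" "P c k = greedy C k" using att[OF c] by blast
    then obtain C' where C': "C = c # C'" by (cases C) (auto simp: Ch_def chain_def)
    have "a \<in> cands C"
    proof (cases C')
      case Nil then show ?thesis using C' a by simp
    next
      case (Cons d C'')
      then have d: "d \<in> S" "nw d c" using C C' by (auto simp: Ch_def chain_def)
      have "C' \<in> Ch d" using C C' Cons by (auto simp: Ch_def chain_def)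
      then have "prec (greedy C') a" using prec_mono[OF dom[OF d]] upp by blast
      then show ?thesis using C' Cons a by simp
    qed
    then show ?thesis using greedy_le C(2) by simp
  qed
  show ?thesis using that[of P] P good least unfolding least_family_def by blast
qed

end

section \<open>Meeting patterns of the paths in a least family\<close>

lemma bool_first_change:
  assumes "(k::nat) \<le> l" "Q k" "\<not> Q l"
  obtains h where "k \<le> h" "h < l" "Q h" "\<not> Q (Suc h)"
  using assms by (induction l) (auto simp: le_Suc_eq)

lemma run_start:
  assumes "Q (k::nat)" "\<not> Q 0"
  obtains h where "0 < h" "h \<le> k" "\<not> Q (h - 1)" "\<And>l. h \<le> l \<Longrightarrow> l \<le> k \<Longrightarrow> Q l"
  using assms
proof (induction k arbitrary: thesis)
  case (Suc k)
  show ?case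
  proof (cases "Q k")
    case True
    then obtain h where "0 < h" "h \<le> k" "\<not> Q (h - 1)" "\<And>l. h \<le> l \<Longrightarrow> l \<le> k \<Longrightarrow> Q l"
      using Suc.IH Suc.prems(3) by blast
    then show ?thesis using Suc.prems by (intro Suc.prems(1)[of h]) (auto simp: le_Suc_eq)
  next
    case False
    show ?thesis by (rule Suc.prems(1)[of "Suc k"]) (use False Suc.prems in \<open>auto simp: le_Suc_eq\<close>)
  qed
qed simp

lemma run_end:
  assumes "Q (k::nat)" "\<not> Q m" "k \<le> m"
  obtains h where "k \<le> h" "h < m" "\<not> Q (Suc h)" "\<And>l. k \<le> l \<Longrightarrow> l \<le> h \<Longrightarrow> Q l"
  using assms
proof (induction "m - k" arbitrary: k thesis)
  case (Suc d)
  show ?case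
  proof (cases "Q (Suc k)")
    case True
    have "d = m - Suc k" "Suc k \<le> m" using Suc by auto
    then obtain h where "Suc k \<le> h" "h < m" "\<not> Q (Suc h)" "\<And>l. Suc k \<le> l \<Longrightarrow> l \<le> h \<Longrightarrow> Q l"
      using Suc.hyps(1)[of "Suc k"] Suc.prems(3) True by blast
    moreover have "Q l" if "k \<le> l" "l \<le> h" for l
      using that \<open>\<And>l. Suc k \<le> l \<Longrightarrow> l \<le> h \<Longrightarrow> Q l\<close> Suc.prems(2) by (cases "l = k") auto
    ultimately show ?thesis by (intro Suc.prems(1)[of h]) auto
  next
    case False
    have "k < m" using Suc by simp
    show ?thesis by (rule Suc.prems(1)[of k]) (use False \<open>k < m\<close> Suc.prems in \<open>auto simp: le_Suc_eq\<close>)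
  qed
qed simp

context cauchon_grid
begin

text \<open>The device for contradicting leastness: in rows \<open>h\<close> to \<open>k\<close> the
  path \<open>a\<close> is rerouted along a path on its left.\<close>

lemma vpath_splice:
  assumes a: "vpath c a" and b: "vpath d b" and h: "0 < h" "h \<le> k" "k < m"
    and le: "\<And>l. h \<le> l \<Longrightarrow> l \<le> k \<Longrightarrow> b l \<le> a l"
    and start: "step h (a (h - 1)) (b h)" and stop: "step (Suc k) (b k) (a (Suc k))"
    and before: "\<And>l. h \<le> l \<Longrightarrow> l < fst c \<Longrightarrow> l \<le> k \<Longrightarrow> b l = Suc n"
  shows "vpath c (\<lambda>l. if h \<le> l \<and> l \<le> k then b l else a l)" (is "vpath c ?f")
proof -
  have "step (Suc l) (?f l) (?f (Suc l))" if l: "l < m" for l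
  proof -
    consider "Suc l = h" | "l = k" | "h \<le> l" "l < k" | "Suc l < h \<or> k < l" by linarith
    then show ?thesis
    proof cases
      case 1 then show ?thesis using start h by auto
    next
      case 2 then show ?thesis using stop h by auto
    next
      case 3 then show ?thesis using vpath_step[OF b l] by auto
    next
      case 4 then show ?thesis using vpath_step[OF a l] h by auto
    qed
  qed
  moreover have "?f (fst c) \<le> n"
    using le[of "fst c"] vpath_after[OF a, of "fst c"] by auto
  ultimately show ?thesis using a h before unfolding vpath_def by auto
qed

lemma least_familyD:
  assumes "least_family S P" "c \<in> S"
  shows "vpath c (P c)"
    and "d \<in> S \<Longrightarrow> nw c d \<Longrightarrow> prec (P c) (P d)"
    and "vpath c a \<Longrightarrow> P c k > a k \<Longrightarrow> \<exists>d\<in>S. nw d c \<and> \<not> prec (P d) a"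
  using assms unfolding least_family_def by (blast, blast, metis leD)

text \<open>
  How the path \<open>x\<close> of a later coordinate can meet the path \<open>p\<close> of an earlier one in a least family:
  once left of \<open>p\<close>, it is never touched by \<open>p\<close> again (1); if it starts in a lower row, it does not
  touch \<open>p\<close> in any row that it leaves to the right of \<open>p\<close> (2); if both start in the same row, it stays
  weakly to the right of \<open>p\<close> and does not touch \<open>p\<close> again once it has left it (3). Otherwise one
  of the two paths could be moved to the left along the other.
\<close>

definition crossing1 :: "(nat \<Rightarrow> nat) \<Rightarrow> (nat \<Rightarrow> nat) \<Rightarrow> bool" where
  "crossing1 p x \<longleftrightarrow> (\<forall>k < m. x k < p k \<longrightarrow> x k < p (Suc k))"

definition crossing2 :: "(nat \<Rightarrow> nat) \<Rightarrow> (nat \<Rightarrow> nat) \<Rightarrow> bool" where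
  "crossing2 p x \<longleftrightarrow> (\<forall>k < m. p k \<le> n \<longrightarrow> p (Suc k) < x (Suc k) \<longrightarrow> x (Suc k) \<le> n \<longrightarrow> p k < x (Suc k))"

definition crossing3 :: "(nat \<Rightarrow> nat) \<Rightarrow> (nat \<Rightarrow> nat) \<Rightarrow> bool" where
  "crossing3 p x \<longleftrightarrow> (\<forall>k. p k \<le> x k) \<and> (\<forall>k < m. p k < x k \<longrightarrow> p k < x (Suc k))"

text \<open>At the first row where \<open>x\<close> passes from the left of \<open>p\<close> to its
  right one would have \<open>x (Suc h) \<le> x h \<le> p h\<close>, which \<open>crossing2\<close>
  excludes.\<close>

lemma crossing2_le:
  assumes "crossing2 p x" "vpath d x" "vpath c p" "p k \<le> n" "k \<le> l" "l \<le> m" "x l \<le> n" "p l < x l"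
    and "x k \<le> n" "x k \<le> p k"
  shows False
proof -
  obtain h where h: "k \<le> h" "h < l" "x h \<le> p h" "\<not> x (Suc h) \<le> p (Suc h)"
    using bool_first_change[of k l "\<lambda>h. x h \<le> p h"] assms by (metis leD)
  have "p h \<le> n" using vpath_antimono[OF assms(3) h(1)] assms(4) by simp
  moreover have "x (Suc h) \<le> n" using vpath_antimono[OF assms(2), of k "Suc h"] h(1) assms(9) by simp
  ultimately have "p h < x (Suc h)" using assms(1,6) h unfolding crossing2_def by auto
  then show False using vpath_Suc[OF assms(2), of h] h(3) by simp
qed

text \<open>If \<open>p\<close> touched \<open>x\<close> again, it could be rerouted along
  \<open>x\<close> while \<open>x\<close> is on its left. By leastness the path \<open>y\<close> of
  some \<open>d\<close> north-west of \<open>c\<close> blocks the detour, so it touches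
  \<open>x\<close>. But \<open>y\<close> stays left of \<open>p\<close>, so it is left of
  \<open>x\<close> where \<open>p\<close> rejoins \<open>x\<close>, and \<open>crossing2\<close> for
  \<open>d\<close> and \<open>c'\<close> forbids this.\<close>

lemma least_crossing1:
  assumes L: "least_family S P" and c: "c \<in> S" and c': "c' \<in> S" and "c < c'"
    and IH2: "\<And>d. d \<in> S \<Longrightarrow> fst d < fst c \<Longrightarrow> d < c' \<Longrightarrow> crossing2 (P d) (P c')"
  shows "crossing1 (P c) (P c')"
  unfolding crossing1_def
proof (intro allI impI, rule ccontr)
  fix k assume k: "k < m" "P c' k < P c k" "\<not> P c' k < P c (Suc k)"
  define p where "p = P c"
  define x where "x = P c'"
  note p = least_familyD(1)[OF L c, folded p_def] and x = least_familyD(1)[OF L c', folded x_def]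
  have xk: "x k < p k" "p (Suc k) \<le> x k" using k by (auto simp: p_def x_def)
  have cc: "fst c \<le> fst c'" using \<open>c < c'\<close> by (auto simp: less_prod_def)
  have z: "\<not> x 0 < p 0" using vpath_before[OF x, of 0] vpath_range[OF x] vpath_le[OF p, of 0] by simp
  obtain h where h: "0 < h" "h \<le> k" "\<not> x (h - 1) < p (h - 1)" "\<And>l. h \<le> l \<Longrightarrow> l \<le> k \<Longrightarrow> x l < p l"
    using run_start[of "\<lambda>l. x l < p l" k] xk z by blast
  have hx: "x (h - 1) \<ge> p (h - 1)" "Suc (h - 1) = h" "h - 1 < m" using h k by auto
  have hc': "fst c' \<le> h" using h(4)[of h] h(2) vpath_before[OF x, of h] vpath_le[OF p, of h] by (metis leD leI order.refl)
  define a where "a = (\<lambda>l. if h \<le> l \<and> l \<le> k then x l else p l)"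
  have "vpath c a" unfolding a_def
  proof (rule vpath_splice[OF p x h(1,2) k(1)])
    show "x l \<le> p l" if "h \<le> l" "l \<le> k" for l using h(4)[OF that] by simp
    have "step (Suc (h - 1)) (p (h - 1)) (x (Suc (h - 1)))"
    proof (rule vpath_swap[OF p x hx(3)])
      show "x (Suc (h - 1)) \<le> p (h - 1)" using h(4)[of h] h(2) hx(2) vpath_Suc[OF p, of "h - 1"] by simp
      show "p (Suc (h - 1)) \<le> x (h - 1)" using hx vpath_Suc[OF p, of "h - 1"] by simp
      assume n: "x (h - 1) = Suc n" "p (h - 1) \<le> n"
      show "(Suc (h - 1), p (h - 1)) \<le> rs"
      proof (rule vpath_turn_le[OF p _ hx(3) n(2)])
        have "p (Suc k) < p k" using xk by simp
        also have "p k \<le> p (h - 1)" using vpath_antimono[OF p] h by simp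
        finally show "p (Suc k) < p (h - 1)" .
      qed
    qed
    then show "step h (p (h - 1)) (x h)" using hx by simp
    show "step (Suc k) (x k) (p (Suc k))"
    proof (rule vpath_swap[OF x p k(1)])
      show "p (Suc k) \<le> x k" by (rule xk)
      show "x (Suc k) \<le> p k" using xk(1) vpath_Suc[OF x, of k] by simp
      show "(Suc k, x k) \<le> rs" if "p k = Suc n" "x k \<le> n"
        using that cc vpath_eq_Suc_iff[OF p] vpath_le_iff[OF x] by auto
    qed
    show "x l = Suc n" if "h \<le> l" "l < fst c" for l using that cc hc' by simp
  qed
  moreover have "a k < p k" using xk h by (auto simp: a_def)
  ultimately obtain d where d: "d \<in> S" "nw d c" "\<not> prec (P d) a"
    using least_familyD(3)[OF L c] unfolding p_def by blast
  define y where "y = P d"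
  note y = least_familyD(1)[OF L d(1), folded y_def]
  have yp: "prec y p" using least_familyD(2)[OF L d(1) c d(2)] by (simp add: y_def p_def)
  obtain l where l: "l < m" "a (Suc l) \<le> y l" "a (Suc l) \<noteq> Suc n"
    using d(3) unfolding prec_def y_def[symmetric] by force
  have lk: "h \<le> Suc l" "Suc l \<le> k"
    using yp l unfolding prec_def a_def by (auto split: if_splits)
  have xl: "x (Suc l) \<le> y l" "x (Suc l) \<le> n"
    using l lk vpath_le[OF x, of "Suc l"] by (auto simp: a_def)
  have "\<not> nw d c'"
    using least_familyD(2)[OF L d(1) c'] xl l unfolding prec_def y_def x_def by force
  moreover have dc: "fst d < fst c" "snd d < snd c" using d(2) by (auto simp: nw_def)
  ultimately have C2: "crossing2 y x"
    unfolding y_def x_def using IH2[OF d(1) dc(1)] cc by (auto simp: less_prod_def)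
  have yn: "y l' \<le> n" if "l \<le> l'" for l'
    using that lk hc' cc dc vpath_le_iff[OF y] by simp
  have "x (Suc l) \<le> y (Suc l)"
    using C2 l(1) xl yn[of l] unfolding crossing2_def by (meson leD leI order.refl)
  moreover have "y k < x k"
  proof -
    have "p (Suc k) \<noteq> Suc n" using xk xl(2) vpath_antimono[OF x lk(2)] by simp
    then show ?thesis using yp k(1) xk unfolding prec_def by force
  qed
  ultimately show False
    using crossing2_le[OF C2 x y yn[of "Suc l"] lk(2)] k(1) xl(2) vpath_antimono[OF x, of "Suc l" k] lk by simp
qed

text \<open>Here \<open>x\<close> is rerouted. Touching \<open>p\<close> from the right excludes
  \<open>nw c c'\<close>, so \<open>x\<close> ends at or left of the end of \<open>p\<close> and
  must return to \<open>p\<close>; in between it could follow \<open>p\<close>. The path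
  \<open>y\<close> blocking this touches \<open>p\<close> after being left of it, which contradicts
  \<open>crossing3\<close> if \<open>d\<close> precedes \<open>c\<close> in its row and
  \<open>crossing1\<close> if \<open>d\<close> is later than \<open>c\<close>.\<close>

lemma least_crossing2:
  assumes L: "least_family S P" and c: "c \<in> S" and c': "c' \<in> S" and cc: "fst c < fst c'"
    and IH1: "\<And>d. d \<in> S \<Longrightarrow> fst d < fst c' \<Longrightarrow> c < d \<Longrightarrow> crossing1 (P c) (P d)"
    and IH3: "\<And>d. d \<in> S \<Longrightarrow> fst d = fst c \<Longrightarrow> d < c \<Longrightarrow> crossing3 (P d) (P c)"
  shows "crossing2 (P c) (P c')"
  unfolding crossing2_def
proof (intro allI impI, rule ccontr)
  fix k assume k: "k < m" "P c k \<le> n" "P c (Suc k) < P c' (Suc k)" "P c' (Suc k) \<le> n" "\<not> P c k < P c' (Suc k)"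
  define p where "p = P c"
  define x where "x = P c'"
  note p = least_familyD(1)[OF L c, folded p_def] and x = least_familyD(1)[OF L c', folded x_def]
  have xk: "p k \<le> n" "p (Suc k) < x (Suc k)" "x (Suc k) \<le> p k" "x (Suc k) \<le> n" using k by (auto simp: p_def x_def)
  have kc': "fst c' \<le> Suc k" using xk(4) vpath_le_iff[OF x] by simp
  have "\<not> nw c c'"
    using least_familyD(2)[OF L c c'] xk k(1) unfolding prec_def p_def x_def by force
  then have "snd c' \<le> snd c" using cc by (simp add: nw_def)
  then have "\<not> p m < x m" using vpath_end[OF p, of m] vpath_end[OF x, of m] by simp
  then obtain h where h: "Suc k \<le> h" "h < m" "\<not> p (Suc h) < x (Suc h)" "\<And>l. Suc k \<le> l \<Longrightarrow> l \<le> h \<Longrightarrow> p l < x l"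
    using run_end[of "\<lambda>l. p l < x l" "Suc k" m] xk k(1) by (metis Suc_leI)
  define a where "a = (\<lambda>l. if Suc k \<le> l \<and> l \<le> h then p l else x l)"
  have "vpath c' a" unfolding a_def
  proof (rule vpath_splice[OF x p _ h(1,2)])
    show "p l \<le> x l" if "Suc k \<le> l" "l \<le> h" for l using h(4)[OF that] by simp
    have "step (Suc k) (x k) (p (Suc k))"
    proof (rule vpath_swap[OF x p k(1)])
      show "p (Suc k) \<le> x k" using xk(2) vpath_Suc[OF x, of k] by simp
      show "x (Suc k) \<le> p k" by (rule xk)
      show "(Suc k, x k) \<le> rs" if "p k = Suc n" using that xk by simp
    qed
    then show "step (Suc k) (x (Suc k - 1)) (p (Suc k))" by simp
    show "step (Suc h) (p h) (x (Suc h))"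
    proof (rule vpath_swap[OF p x h(2)])
      show "x (Suc h) \<le> p h" using h(3) vpath_Suc[OF p, of h] by simp
      show "p (Suc h) \<le> x h" using h(4)[of h] h(1) vpath_Suc[OF p, of h] by simp
      show "(Suc h, p h) \<le> rs" if "x h = Suc n" using that vpath_eq_Suc_iff[OF x] h kc' by simp
    qed
    show "p l = Suc n" if "Suc k \<le> l" "l < fst c'" for l using that kc' by simp
  qed simp
  moreover have "a (Suc k) < x (Suc k)" using xk h by (auto simp: a_def)
  ultimately obtain d where d: "d \<in> S" "nw d c'" "\<not> prec (P d) a"
    using least_familyD(3)[OF L c'] unfolding x_def by blast
  define y where "y = P d"
  note y = least_familyD(1)[OF L d(1), folded y_def]
  have yx: "prec y x" using least_familyD(2)[OF L d(1) c' d(2)] by (simp add: y_def x_def)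
  obtain l where l: "l < m" "a (Suc l) \<le> y l" "a (Suc l) \<noteq> Suc n"
    using d(3) unfolding prec_def y_def[symmetric] by force
  have lk: "k \<le> l" "Suc l \<le> h"
    using yx l unfolding prec_def a_def by (auto split: if_splits)
  have pl: "p (Suc l) \<le> y l" using l lk by (auto simp: a_def)
  have dc: "fst d < fst c'" "snd d < snd c" using d(2) \<open>snd c' \<le> snd c\<close> by (auto simp: nw_def)
  have pn: "p l' \<le> n" if "k \<le> l'" for l' using vpath_antimono[OF p that] xk by simp
  have xn: "x l' \<le> n" if "Suc k \<le> l'" for l' using vpath_antimono[OF x that] xk by simp
  have yk: "y k < p k" using yx k(1) xk xn[of "Suc k"] unfolding prec_def by force
  have yn: "y l' \<le> n" if "k \<le> l'" for l' using vpath_antimono[OF y that] yk xk by simp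
  have "\<not> nw d c"
  proof
    assume "nw d c"
    then have "prec y p" using least_familyD(2)[OF L d(1) c] by (simp add: y_def p_def)
    then show False using pl l(1) pn[of "Suc l"] lk unfolding prec_def by force
  qed
  then consider "fst d = fst c" "d < c" | "c < d" using dc(2) unfolding nw_def less_prod_def' by (metis linorder_neqE_nat)
  then show False
  proof cases
    case 1
    then have C: "crossing3 y p" unfolding y_def p_def using IH3 d(1) by blast
    then have "\<not> y l < p l" using pl l(1) unfolding crossing3_def by force
    then obtain l' where l': "k \<le> l'" "l' < l" "y l' < p l'" "\<not> y (Suc l') < p (Suc l')"
      using bool_first_change[of k l "\<lambda>h. y h < p h"] yk lk by blast
    then have "y l' < p (Suc l')" using C l(1) unfolding crossing3_def by force
    then show False using l' vpath_Suc[OF y, of l'] by simp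
  next
    case 2
    then have C: "crossing1 p y" unfolding y_def p_def using IH1 d(1) dc by blast
    have "y l' < p l'" if "k \<le> l'" "l' \<le> l" for l'
      using that
    proof (induction l' rule: dec_induct)
      case (step l')
      then have "y l' < p (Suc l')" using C l(1) unfolding crossing1_def by auto
      then show ?case using vpath_Suc[OF y, of l'] by simp
    qed (rule yk)
    then have "y l < p (Suc l)" using C l(1) lk unfolding crossing1_def by auto
    then show False using pl by simp
  qed
qed

text \<open>By \<open>crossing1\<close>, \<open>x\<close> could not return once it is left of
  \<open>p\<close>, yet it ends on the right. If \<open>p\<close> touched \<open>x\<close> after a
  separation, \<open>x\<close> could follow \<open>p\<close> in between; a path blocking this
  contradicts \<open>crossing2\<close> with \<open>p\<close>.\<close>

lemma least_crossing3:
  assumes L: "least_family S P" and c: "c \<in> S" and c': "c' \<in> S" and cc: "fst c = fst c'" "c < c'"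
    and IH1: "crossing1 (P c) (P c')"
    and IH2: "\<And>d. d \<in> S \<Longrightarrow> fst d < fst c \<Longrightarrow> d < c \<Longrightarrow> crossing2 (P d) (P c)"
  shows "crossing3 (P c) (P c')"
proof -
  define p where "p = P c"
  define x where "x = P c'"
  note p = least_familyD(1)[OF L c, folded p_def] and x = least_familyD(1)[OF L c', folded x_def]
  have jj: "snd c < snd c'" using cc by (auto simp: less_prod_def')
  have ge: "p k \<le> x k" for k
  proof (rule ccontr)
    assume a: "\<not> p k \<le> x k"
    have "k \<le> m" using a vpath_end[OF p, of k] vpath_end[OF x, of k] jj by (cases "k \<le> m") auto
    have "\<not> x m < p m" using vpath_end[OF p, of m] vpath_end[OF x, of m] jj by simp
    then obtain h where h: "k \<le> h" "h < m" "\<not> x (Suc h) < p (Suc h)" "x h < p h"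
      using run_end[of "\<lambda>l. x l < p l" k m] a \<open>k \<le> m\<close> by (metis leI order.refl)
    then have "x h < p (Suc h)" using IH1 unfolding crossing1_def p_def x_def by blast
    then show False using h(3) vpath_Suc[OF x, of h] by simp
  qed
  have "p k < x (Suc k)" if k: "k < m" "p k < x k" for k
  proof (rule ccontr)
    assume "\<not> p k < x (Suc k)"
    then have xk: "x (Suc k) \<le> p k" by simp
    have kc: "fst c \<le> k" using k vpath_before[OF p, of k] vpath_le[OF x, of k] by (metis not_le)
    have z: "\<not> p 0 < x 0" using vpath_before[OF p, of 0] vpath_range[OF p] vpath_le[OF x, of 0] by simp
    obtain h where h: "0 < h" "h \<le> k" "\<not> p (h - 1) < x (h - 1)" "\<And>l. h \<le> l \<Longrightarrow> l \<le> k \<Longrightarrow> p l < x l"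
      using run_start[of "\<lambda>l. p l < x l" k] k z by blast
    have eq: "x (h - 1) = p (h - 1)" using ge[of "h - 1"] h by simp
    have hc: "fst c \<le> h" using h(4)[of h] h(2) vpath_before[OF p, of h] vpath_le[OF x, of h] by (metis not_le order.refl)
    define a where "a = (\<lambda>l. if h \<le> l \<and> l \<le> k then p l else x l)"
    have "vpath c' a" unfolding a_def
    proof (rule vpath_splice[OF x p h(1,2) k(1)])
      show "p l \<le> x l" for l by (rule ge)
      show "step h (x (h - 1)) (p h)" using vpath_step[OF p, of "h - 1"] eq h k by simp
      show "step (Suc k) (p k) (x (Suc k))"
      proof (rule vpath_swap[OF p x k(1) xk])
        show "p (Suc k) \<le> x k" using k(2) vpath_Suc[OF p, of k] by simp
        show "(Suc k, p k) \<le> rs" if "x k = Suc n" using that vpath_eq_Suc_iff[OF x] kc cc by simp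
      qed
      show "p l = Suc n" if "h \<le> l" "l < fst c'" for l using that hc cc by simp
    qed
    moreover have "a k < x k" using k h by (auto simp: a_def)
    ultimately obtain d where d: "d \<in> S" "nw d c'" "\<not> prec (P d) a"
      using least_familyD(3)[OF L c'] unfolding x_def by blast
    define y where "y = P d"
    note y = least_familyD(1)[OF L d(1), folded y_def]
    have yx: "prec y x" using least_familyD(2)[OF L d(1) c' d(2)] by (simp add: y_def x_def)
    obtain l where l: "l < m" "a (Suc l) \<le> y l" "a (Suc l) \<noteq> Suc n"
      using d(3) unfolding prec_def y_def[symmetric] by force
    have lk: "h \<le> Suc l" "Suc l \<le> k"
      using yx l unfolding prec_def a_def by (auto split: if_splits)
    have pl: "p (Suc l) \<le> y l" using l lk by (auto simp: a_def)
    have pn: "p l' \<le> n" if "Suc l \<le> l'" for l'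
      using vpath_le_iff[OF p] that lk hc by simp
    have dc: "fst d < fst c" using d(2) cc by (auto simp: nw_def)
    have yn: "y l' \<le> n" if "l \<le> l'" for l'
      using vpath_le_iff[OF y] that lk hc dc by simp
    have "\<not> nw d c"
    proof
      assume "nw d c"
      then have "prec y p" using least_familyD(2)[OF L d(1) c] by (simp add: y_def p_def)
      then show False using pl l(1) pn[of "Suc l"] unfolding prec_def by force
    qed
    then have "crossing2 y p" unfolding y_def p_def using IH2[OF d(1)] dc by (auto simp: less_prod_def)
    moreover have "p (Suc l) \<le> y (Suc l)"
      using \<open>crossing2 y p\<close> l(1) pl yn[of l] pn[of "Suc l"] unfolding crossing2_def by (meson leD leI order.refl)
    moreover have "x (Suc k) \<le> n" using vpath_le_iff[OF x, of "Suc k"] kc cc by simp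
    moreover have "y k < p k" using yx k(1) xk \<open>x (Suc k) \<le> n\<close> unfolding prec_def by force
    ultimately show False
      using crossing2_le[OF _ p y yn[of "Suc l"] lk(2)] k(1) pn[of k] pn[of "Suc l"] lk by simp
  qed
  then show ?thesis using ge unfolding crossing3_def p_def x_def by blast
qed

text \<open>The three patterns rely on each other, but each appeal lowers the sum of the two
  starting rows, except that \<open>crossing3\<close> uses \<open>crossing1\<close> for the same
  pair.\<close>

lemma least_crossing:
  assumes L: "least_family S P"
  shows "c \<in> S \<Longrightarrow> c' \<in> S \<Longrightarrow> c < c' \<Longrightarrow> crossing1 (P c) (P c') \<and>
    (if fst c < fst c' then crossing2 (P c) (P c') else crossing3 (P c) (P c'))"
proof (induction "fst c + fst c'" arbitrary: c c' rule: less_induct)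
  case less
  have cc: "fst c \<le> fst c'" using less.prems by (auto simp: less_prod_def)
  have IH2: "crossing2 (P d) (P e)" if "d \<in> S" "e \<in> S" "fst d < fst c" "d < e" "fst d < fst e" "fst e \<le> fst c'" for d e
    using less.hyps[of d e] that by auto
  have 1: "crossing1 (P c) (P c')"
    by (rule least_crossing1[OF L less.prems], rule IH2) (use cc less.prems in auto)
  show ?case
  proof (cases "fst c < fst c'")
    case True
    have "crossing2 (P c) (P c')"
    proof (rule least_crossing2[OF L less.prems(1,2) True])
      show "crossing1 (P c) (P d)" if "d \<in> S" "fst d < fst c'" "c < d" for d
        using less.hyps[of c d] that less.prems by simp
      show "crossing3 (P d) (P c)" if "d \<in> S" "fst d = fst c" "d < c" for d
        using less.hyps[of d c] that less.prems True by simp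
    qed
    then show ?thesis using 1 True by simp
  next
    case False
    then have "crossing3 (P c) (P c')"
      using least_crossing3[OF L less.prems(1,2) _ less.prems(3) 1] IH2[OF _ less.prems(1)] cc by auto
    then show ?thesis using 1 False by simp
  qed
qed

end

section \<open>Recovering a least family from the columns in which it leaves the rows\<close>

lemma size_filter_split:
  "size (filter_mset Q M) = size (filter_mset (\<lambda>z. Q z \<and> R z) M) + size (filter_mset (\<lambda>z. Q z \<and> \<not> R z) M)"
  by (induction M) auto

lemma size_filter_image:
  "size (filter_mset (\<lambda>z. R (f z)) M) = size (filter_mset R (image_mset f M))"
  by (induction M) auto

lemma size_filter_mono:
  "(\<And>z. z \<in># M \<Longrightarrow> Q z \<Longrightarrow> R z) \<Longrightarrow> size (filter_mset Q M) \<le> size (filter_mset R M)"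
  by (induction M) auto

context cauchon_grid
begin

text \<open>
  If the paths of \<open>X\<close> belong to a least family and \<open>X\<close>, \<open>Y\<close> leave every row in the same columns,
  then at least as many paths of \<open>Y\<close> as of \<open>X\<close> follow the first path of \<open>X\<close> down to row \<open>k\<close>: a path
  of \<open>Y\<close> leaving it can neither go left, as no path of \<open>X\<close> does, nor go right more often than the
  paths of \<open>X\<close> do.
\<close>

lemma least_family_first_path:
  fixes X Y :: "((nat \<times> nat) \<times> (nat \<Rightarrow> nat)) multiset"
  assumes L: "least_family S P"
    and X: "\<And>z. z \<in># X \<Longrightarrow> fst z \<in> S \<and> snd z = P (fst z)"
    and Y: "\<And>z. z \<in># Y \<Longrightarrow> vpath (fst z) (snd z)"
    and lev: "\<And>k. k \<le> m \<Longrightarrow> image_mset (\<lambda>z. snd z k) X = image_mset (\<lambda>z. snd z k) Y"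
    and min: "\<And>z. z \<in># X + Y \<Longrightarrow> c \<le> fst z"
    and c: "(c, P c) \<in># X"
  shows "(c, P c) \<in># Y"
proof -
  define p where "p = P c"
  have cS: "c \<in> S" using X[OF c] by simp
  note p = least_familyD(1)[OF L cS, folded p_def]
  have Xp: "vpath (fst z) (snd z)" if "z \<in># X" for z using X[OF that] least_familyD(1)[OF L] by simp
  have Xc: "crossing1 p (snd z) \<and> (if fst c < fst (fst z) then crossing2 p (snd z) else crossing3 p (snd z))"
    if "z \<in># X" "fst z \<noteq> c" for z
    using least_crossing[OF L cS, of "fst z"] X[OF that(1)] min[of z] that unfolding p_def by auto
  have row: "fst c \<le> fst (fst z)" if "z \<in># X + Y" for z using min[OF that] by (auto simp: less_eq_prod_def)
  have levs: "size (filter_mset (\<lambda>z. R (snd z k)) X) = size (filter_mset (\<lambda>z. R (snd z k)) Y)" if "k \<le> m" for R k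
    by (simp only: size_filter_image[of R "\<lambda>z. snd z k"] lev[OF that])
  have ex: "(\<exists>z. z \<in># X \<and> R (snd z k)) \<longleftrightarrow> (\<exists>z. z \<in># Y \<and> R (snd z k))" if "k \<le> m" for R k
  proof -
    have "(\<exists>z. z \<in># M \<and> R (snd z k)) \<longleftrightarrow> 0 < size (filter_mset (\<lambda>z. R (snd z k)) M)" for M :: "((nat \<times> nat) \<times> (nat \<Rightarrow> nat)) multiset"
      by (auto simp: nonempty_has_size[symmetric] filter_mset_eq_mempty_iff)
    from this[of X] this[of Y] show ?thesis by (simp only: levs[OF that])
  qed
  \<comment> \<open>A path of \<open>Y\<close> can leave row \<open>k\<close> in a column from
    \<open>p (Suc k)\<close> up to but excluding \<open>p k\<close> only if some path of
    \<open>X\<close> does, and \<open>crossing1\<close> excludes that.\<close>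
  have left: "snd z k < p (Suc k)" if z: "z \<in># Y" "k < m" "snd z k < p k" for z k
  proof (rule ccontr)
    assume "\<not> snd z k < p (Suc k)"
    then obtain z' where z': "z' \<in># X" "snd z' k < p k" "\<not> snd z' k < p (Suc k)"
      using ex[OF less_imp_le[OF z(2)], of "\<lambda>v. v < p k \<and> \<not> v < p (Suc k)"] z(1,3) \<open>\<not> snd z k < p (Suc k)\<close> by blast
    then have "fst z' \<noteq> c" using X[OF z'(1)] by (auto simp: p_def)
    then show False using Xc[OF z'(1)] z' z(2) unfolding crossing1_def by blast
  qed
  \<comment> \<open>Once left of \<open>p\<close>, the path would stay there by \<open>left\<close>
    and end left of \<open>snd c\<close>, so its coordinate would be smaller than
    \<open>c\<close>.\<close>
  have right: "p k \<le> snd z k" if z: "z \<in># Y" "fst (fst z) = fst c" "k \<le> m" for z k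
  proof (rule ccontr)
    assume "\<not> p k \<le> snd z k"
    then have "snd z k < p k" by simp
    have "snd z l < p l" if "k \<le> l" "l \<le> m" for l
      using that
    proof (induction l rule: dec_induct)
      case (step l)
      then show ?case using left[OF z(1), of l] vpath_Suc[OF Y[OF z(1)], of l] by simp
    qed (use \<open>snd z k < p k\<close> in simp)
    then have "snd (fst z) < snd c" using z(3) vpath_end[OF p, of m] vpath_end[OF Y[OF z(1)], of m] by force
    then show False using min[of z] z by (auto simp: less_eq_prod_def)
  qed
  define on where "on k z \<longleftrightarrow> (\<forall>l\<le>k. snd z l = p l)" for k and z :: "(nat \<times> nat) \<times> (nat \<Rightarrow> nat)"
  have on_row: "on k z \<Longrightarrow> fst c \<le> k \<Longrightarrow> z \<in># X + Y \<Longrightarrow> fst (fst z) = fst c" for k z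
  proof -
    assume o: "on k z" "fst c \<le> k" "z \<in># X + Y"
    then have "snd z (fst c) \<le> n" using vpath_after[OF p, of "fst c"] by (simp add: on_def)
    moreover have "vpath (fst z) (snd z)" using o(3) Xp[of z] Y[of z] by (simp only: union_iff) blast
    ultimately show "fst (fst z) = fst c" using vpath_le_iff[of "fst z" "snd z" "fst c"] row[OF o(3)] by simp
  qed
  have on_base: "size (filter_mset (on (fst c)) M) = size (filter_mset (\<lambda>z. snd z (fst c) = p (fst c)) M)"
    if M: "M = X \<or> M = Y" for M
  proof -
    have "on (fst c) z \<longleftrightarrow> snd z (fst c) = p (fst c)" if z: "z \<in># M" for z
    proof -
      have "vpath (fst z) (snd z)" "fst c \<le> fst (fst z)" using M z Xp[of z] Y[of z] row[of z] by auto
      then have "snd z l = p l" if "l < fst c" for l using that by (simp add: vpath_before vpath_before[OF p])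
      then show ?thesis unfolding on_def by (metis le_neq_implies_less order_refl)
    qed
    then show ?thesis by (intro arg_cong[of _ _ size] filter_mset_cong) auto
  qed
  have "size (filter_mset (on k) X) \<le> size (filter_mset (on k) Y)" if "fst c \<le> k" "k \<le> m" for k
    using that
  proof (induction k rule: dec_induct)
    case base
    then show ?case using on_base levs[of "fst c" "\<lambda>v. v = p (fst c)"] vpath_range[OF p] by simp
  next
    case (step k)
    \<comment> \<open>\<open>?D\<close> detects a departure from \<open>p\<close> in row
      \<open>Suc k\<close> by the column alone, so its count carries over from \<open>Y\<close> to
      \<open>X\<close>. In \<open>X\<close> only paths that have followed \<open>p\<close> up to row
      \<open>k\<close> satisfy it.\<close>
    let ?D = "\<lambda>z. p (Suc k) < snd z (Suc k) \<and> snd z (Suc k) \<le> p k"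
    have on_Suc: "on k z \<and> snd z (Suc k) = p (Suc k) \<longleftrightarrow> on (Suc k) z" for z
      by (auto simp: on_def le_Suc_eq)
    have pk: "p k \<le> n" using vpath_after[OF p] step by simp
    have split: "size (filter_mset (on k) M) = size (filter_mset (on (Suc k)) M)
        + size (filter_mset (\<lambda>z. on k z \<and> snd z (Suc k) \<noteq> p (Suc k)) M)" for M
      using size_filter_split[of "on k" M "\<lambda>z. snd z (Suc k) = p (Suc k)"] by (simp add: on_Suc)
    have "size (filter_mset (\<lambda>z. on k z \<and> snd z (Suc k) \<noteq> p (Suc k)) Y) \<le> size (filter_mset ?D Y)"
    proof (rule size_filter_mono)
      fix z assume z: "z \<in># Y" "on k z \<and> snd z (Suc k) \<noteq> p (Suc k)"
      then have "p (Suc k) \<le> snd z (Suc k)" using right[OF z(1) on_row] step by auto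
      moreover have "snd z (Suc k) \<le> p k" using vpath_Suc[OF Y[OF z(1)], of k] z by (simp add: on_def)
      ultimately show "?D z" using z by simp
    qed
    also have "\<dots> = size (filter_mset ?D X)"
      using levs[of "Suc k" "\<lambda>v. p (Suc k) < v \<and> v \<le> p k"] step by simp
    also have "\<dots> \<le> size (filter_mset (\<lambda>z. on k z \<and> snd z (Suc k) \<noteq> p (Suc k)) X)"
    proof (rule size_filter_mono)
      fix z assume z: "z \<in># X" "?D z"
      have ne: "fst z \<noteq> c" using X[OF z(1)] z by (auto simp: p_def)
      have "\<not> crossing2 p (snd z)"
      proof
        assume "crossing2 p (snd z)"
        then show False using z pk step(4) by (auto simp: crossing2_def dest: spec[of _ k])
      qed
      then have C: "crossing3 p (snd z)" using Xc[OF z(1) ne] by (auto split: if_splits)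
      have "snd z l = p l" if "l \<le> k" for l
      proof (rule ccontr)
        assume "snd z l \<noteq> p l"
        then have l: "p l < snd z l" using C unfolding crossing3_def by (metis le_neq_implies_less)
        have "p l' < snd z l'" if "l \<le> l'" "l' \<le> k" for l'
          using that
        proof (induction l' rule: dec_induct)
          case (step l')
          then show ?case using C[unfolded crossing3_def, THEN conjunct2, rule_format, of l'] \<open>Suc k \<le> m\<close>
              vpath_Suc[OF p, of l'] by simp
        qed (use l in simp)
        then show False using C[unfolded crossing3_def, THEN conjunct2, rule_format, of k] \<open>l \<le> k\<close> z step by simp
      qed
      then show "on k z \<and> snd z (Suc k) \<noteq> p (Suc k)" using z by (simp add: on_def)
    qed
    finally show ?case using step split[of X] split[of Y] by simp
  qed
  then have le: "size (filter_mset (on m) X) \<le> size (filter_mset (on m) Y)" using vpath_range[OF p] by simp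
  have "(c, P c) \<in># filter_mset (on m) X" using c by (simp add: on_def p_def)
  then have "filter_mset (on m) X \<noteq> {#}" by (metis empty_iff set_mset_empty)
  then have "0 < size (filter_mset (on m) Y)" using le unfolding nonempty_has_size by linarith
  then have "filter_mset (on m) Y \<noteq> {#}" by (simp only: nonempty_has_size)
  then obtain z where "z \<in># filter_mset (on m) Y" by (metis multiset_nonemptyE)
  then have z: "z \<in># Y" "on m z" by simp_all
  have "fst (fst z) = fst c" using on_row[OF z(2)] z(1) vpath_range[OF p] by simp
  moreover have "snd (fst z) = snd c"
    using z vpath_end[OF p, of m] vpath_end[OF Y[OF z(1)], of m] by (simp add: on_def)
  moreover have "snd z k = p k" for k
    using z(2) vpath_end[OF p, of k] vpath_end[OF Y[OF z(1)], of k] calculation by (cases "k \<le> m") (auto simp: on_def)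
  ultimately have "z = (c, P c)" by (auto simp: prod_eq_iff p_def)
  then show ?thesis using z by simp
qed

text \<open>Cancelling the common part leaves disjoint multisets with equal columns. Their least
  coordinate \<open>c\<close> cannot occur in the rest of \<open>X\<close>, since
  \<open>least_family_first_path\<close> would put \<open>(c, P c)\<close> in both rests; so it
  occurs in the rest of \<open>Y\<close> only.\<close>

lemma least_family_unique:
  fixes X Y :: "((nat \<times> nat) \<times> (nat \<Rightarrow> nat)) multiset"
  assumes L: "least_family S P"
    and X: "\<And>z. z \<in># X \<Longrightarrow> fst z \<in> S \<and> snd z = P (fst z)"
    and Y: "\<And>z. z \<in># Y \<Longrightarrow> vpath (fst z) (snd z)"
    and lev: "\<And>k. k \<le> m \<Longrightarrow> image_mset (\<lambda>z. snd z k) X = image_mset (\<lambda>z. snd z k) Y"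
  shows "X = Y \<or> (\<exists>c. count (image_mset fst X) c < count (image_mset fst Y) c \<and>
    (\<forall>d < c. count (image_mset fst X) d = count (image_mset fst Y) d))"
proof -
  define I where "I = X \<inter># Y"
  define X' where "X' = X - Y"
  define Y' where "Y' = Y - X"
  have XI: "X = X' + I" and YI: "Y = Y' + I"
    unfolding X'_def Y'_def I_def by (rule multiset_eqI, simp add: min_def)+
  have X'X: "z \<in># X' \<Longrightarrow> z \<in># X" and Y'Y: "z \<in># Y' \<Longrightarrow> z \<in># Y" for z
    unfolding X'_def Y'_def by (auto dest: in_diffD)
  have lev': "image_mset (\<lambda>z. snd z k) X' = image_mset (\<lambda>z. snd z k) Y'" if "k \<le> m" for k
    
  proof -
    have "image_mset (\<lambda>z. snd z k) (X' + I) = image_mset (\<lambda>z. snd z k) (Y' + I)"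
      using lev[OF that] by (simp only: XI[symmetric] YI[symmetric])
    then show ?thesis by simp
  qed
  show ?thesis
  proof (cases "X' = {#}")
    case True
    have "image_mset (\<lambda>z. snd z 0) Y' = {#}" using lev'[of 0] by (simp add: True)
    then have "Y' = {#}" by (simp only: image_mset_is_empty_iff)
    then have "X = Y" by (subst XI, subst YI) (simp add: True)
    then show ?thesis ..
  next
    case False
    define c where "c = Min (fst ` set_mset (X' + Y'))"
    have c: "c \<in> fst ` set_mset (X' + Y')" unfolding c_def using False by (intro Min_in) auto
    have min: "c \<le> fst z" if "z \<in># X' + Y'" for z unfolding c_def using that by (intro Min_le) auto
    have notX: "fst z \<noteq> c" if z: "z \<in># X'" for z
    proof
      assume "fst z = c"
      then have zc: "(c, P c) \<in># X'" using X[OF X'X[OF z]] z by (metis prod.collapse)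
      have "(c, P c) \<in># Y'"
        by (rule least_family_first_path[OF L X[OF X'X] Y[OF Y'Y] lev' min zc])
      then show False using zc unfolding X'_def Y'_def in_diff_count by simp
    qed
    then have "c \<in># image_mset fst Y'" using c by auto
    then have "count (image_mset fst Y') c > 0" by (simp only: count_greater_zero_iff)
    moreover have "count (image_mset fst X') c = 0" using notX by (auto simp: count_eq_zero_iff)
    moreover have "count (image_mset fst X') d = 0" "count (image_mset fst Y') d = 0" if "d < c" for d
      using min that by (fastforce simp: count_eq_zero_iff)+
    ultimately have "count (image_mset fst (X' + I)) c < count (image_mset fst (Y' + I)) c \<and>
      (\<forall>d < c. count (image_mset fst (X' + I)) d = count (image_mset fst (Y' + I)) d)" by auto
    then show ?thesis by (simp only: XI[symmetric] YI[symmetric]) blast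
  qed
qed

end

section \<open>Computing in the quantum torus\<close>

definition mon :: "torus_letter list \<Rightarrow> torus_letter word \<Rightarrow>\<^sub>0 'k::field" where
  "mon w = Poly_Mapping.single (Word w) 1"

lemma mon_mult: "mon u * mon v = mon (u @ v)"
  by (simp add: mon_def mult_single plus_word_def)

lemma mon_Nil: "mon [] = 1"
  unfolding mon_def zero_word_def[symmetric] by simp

lemma const_mult: "const c * const d = const (c * d)"
  by (simp add: const_def mult_single)

lemma const_add: "const c + const d = const (c + d)"
  by (simp add: const_def single_add)

lemma const_1 [simp]: "const 1 = 1" and const_0 [simp]: "const 0 = 0"
  by (simp_all add: const_def)

lemma const_uminus: "const (- c) = - const c"
  by (simp add: const_def single_uminus)

lemma poly_mapping_sum_single: "(\<Sum>w\<in>Poly_Mapping.keys f. Poly_Mapping.single w (Poly_Mapping.lookup f w)) = f"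
  by (rule poly_mapping_eqI) (simp add: lookup_sum lookup_single when_def in_keys_iff)

lemma const_central: "const c * f = f * const c"
proof -
  have "const c * Poly_Mapping.single w d = Poly_Mapping.single w d * const c" for w d
    by (simp add: const_def mult_single mult.commute)
  then show ?thesis
    by (subst (1 2) poly_mapping_sum_single[of f, symmetric]) (simp add: sum_distrib_left sum_distrib_right)
qed

definition proper :: "nat \<Rightarrow> nat \<Rightarrow> torus_letter word \<Rightarrow> bool" where
  "proper m n w \<longleftrightarrow> set (letters w) \<subseteq> Pos ` coords m n \<union> Neg ` coords m n"

lemma proper_plus: "proper m n (u + v) \<longleftrightarrow> proper m n u \<and> proper m n v"
  by (simp add: proper_def plus_word_def)

text \<open>
  Words containing a letter outside the grid are sent to zero; this makes the projection to the
  torus a ring homomorphism on the whole free algebra.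
\<close>

definition kill :: "nat \<Rightarrow> nat \<Rightarrow> (torus_letter word \<Rightarrow>\<^sub>0 'k::field) \<Rightarrow> torus_letter word \<Rightarrow>\<^sub>0 'k" where
  "kill m n f = Abs_poly_mapping (\<lambda>w. Poly_Mapping.lookup f w when proper m n w)"

lemma lookup_kill: "Poly_Mapping.lookup (kill m n f) w = (Poly_Mapping.lookup f w when proper m n w)"
proof -
  have "finite {w. (Poly_Mapping.lookup f w when proper m n w) \<noteq> 0}"
    by (rule finite_subset[of _ "Poly_Mapping.keys f"]) (auto simp: in_keys_iff)
  then show ?thesis unfolding kill_def by simp
qed

lemma kill_add: "kill m n (f + g) = kill m n f + kill m n g"
  by (rule poly_mapping_eqI) (simp add: lookup_kill lookup_add when_def)

lemma kill_0 [simp]: "kill m n 0 = 0"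
  by (rule poly_mapping_eqI) (simp add: lookup_kill)

lemma kill_mult: "kill m n (f * g) = kill m n f * kill m n g"
proof (rule poly_mapping_eqI)
  fix w
  let ?l = "Poly_Mapping.lookup"
  have "(?l f u * (\<Sum>v. ?l g v when w = u + v) when proper m n w)
      = (?l f u when proper m n u) * (\<Sum>v. (?l g v when proper m n v) when w = u + v)" for u
  proof (cases "proper m n w")
    case True
    show ?thesis
    proof (cases "proper m n u")
      case pu: True
      have "(?l g v when w = u + v) = ((?l g v when proper m n v) when w = u + v)" for v
        using True by (auto simp: when_def proper_plus)
      then show ?thesis using True pu by simp
    next
      case False
      then have "w \<noteq> u + v" for v using True by (auto simp: proper_plus)
      then show ?thesis by simp
    qed
  next
    case False
    then have "((?l g v when proper m n v) when w = u + v) = 0" if "proper m n u" for v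
      using that False by (cases "w = u + v") (auto simp: when_def proper_plus)
    then show ?thesis using False by (cases "proper m n u") simp_all
  qed
  then have "(\<Sum>u. ?l f u * (\<Sum>v. ?l g v when w = u + v) when proper m n w)
      = (\<Sum>u. (?l f u when proper m n u) * (\<Sum>v. (?l g v when proper m n v) when w = u + v))"
    by simp
  moreover have "(\<Sum>u. ?l f u * (\<Sum>v. ?l g v when w = u + v) when proper m n w)
      = ((\<Sum>u. ?l f u * (\<Sum>v. ?l g v when w = u + v)) when proper m n w)"
    by (cases "proper m n w") simp_all
  ultimately show "?l (kill m n (f * g)) w = ?l (kill m n f * kill m n g) w"
    by (simp add: lookup_kill lookup_mult)
qed

lemma kill_in_free_alg: "kill m n f \<in> carrier (free_alg m n)"
  by (auto simp: free_alg_def in_keys_iff lookup_kill proper_def)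

lemma kill_id: "f \<in> carrier (free_alg m n) \<Longrightarrow> kill m n f = f"
  by (rule poly_mapping_eqI)
    (auto simp: free_alg_def lookup_kill when_def proper_def in_keys_iff)

lemma kill_1 [simp]: "kill m n 1 = 1"
  using kill_id[of 1 m n] ring.ring_simprules(6)[OF ring_free_alg[of m n]] by (simp add: free_alg_def)

definition cls :: "nat \<Rightarrow> nat \<Rightarrow> 'k::field \<Rightarrow> (torus_letter word \<Rightarrow>\<^sub>0 'k) \<Rightarrow> (torus_letter word \<Rightarrow>\<^sub>0 'k) set" where
  "cls m n q f = torus_class m n q (kill m n f)"

locale quantum_torus =
  fixes m n :: nat and q :: "'k::field"
  assumes m2: "2 \<le> m" and n2: "2 \<le> n" and q0: "q \<noteq> 0"
begin

abbreviation T where "T \<equiv> torus m n q"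

sublocale T: ring "torus m n q" by (rule ring_torus)

lemma torus_class_hom: "torus_class m n q \<in> ring_hom (free_alg m n) T"
  using ideal.rcos_ring_hom[OF torus_ideal_is_ideal, of m n q]
  unfolding torus_class_def[abs_def] torus_def by simp

lemma cls_closed [simp, intro]: "cls m n q f \<in> carrier T"
  unfolding cls_def by (rule ring_hom_closed[OF torus_class_hom kill_in_free_alg])

lemma cls_mult: "cls m n q (f * g) = cls m n q f \<otimes>\<^bsub>T\<^esub> cls m n q g"
  using ring_hom_mult[OF torus_class_hom kill_in_free_alg kill_in_free_alg, of f g]
  by (simp add: cls_def kill_mult free_alg_def)

lemma cls_add: "cls m n q (f + g) = cls m n q f \<oplus>\<^bsub>T\<^esub> cls m n q g"
  using ring_hom_add[OF torus_class_hom kill_in_free_alg kill_in_free_alg, of f g]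
  by (simp add: cls_def kill_add free_alg_def)

lemma cls_1: "cls m n q 1 = \<one>\<^bsub>T\<^esub>"
  using ring_hom_one[OF torus_class_hom] by (simp add: cls_def free_alg_def)

lemma cls_0: "cls m n q 0 = \<zero>\<^bsub>T\<^esub>"
  using cls_add[of 0 0] by (metis T.add.r_cancel_one add_0 cls_closed)

lemma cls_sum: "finite A \<Longrightarrow> cls m n q (\<Sum>x\<in>A. f x) = (\<Oplus>\<^bsub>T\<^esub>x\<in>A. cls m n q (f x))"
  by (induction A rule: finite_induct) (simp_all add: cls_0 cls_add)

lemma cls_carrier: "f \<in> carrier (free_alg m n) \<Longrightarrow> cls m n q f = torus_class m n q f"
  by (simp add: cls_def kill_id)

lemma scalar_cls: "scalar m n q c = cls m n q (const c)"
  by (simp add: scalar_def cls_carrier const_in_free_alg)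

lemma tgen_cls: "c \<in> coords m n \<Longrightarrow> tgen m n q c = cls m n q (mon [Pos c])"
proof -
  assume c: "c \<in> coords m n"
  have "mon [Pos c] \<in> carrier (free_alg m n :: (torus_letter word \<Rightarrow>\<^sub>0 'k) ring)"
    using letter_in_free_alg[OF c] by (simp add: letter_def mon_def)
  from cls_carrier[OF this] show ?thesis by (simp add: tgen_def letter_def mon_def)
qed

lemma tinv_cls: "c \<in> coords m n \<Longrightarrow> tinv m n q c = cls m n q (mon [Neg c])"
proof -
  assume c: "c \<in> coords m n"
  have "mon [Neg c] \<in> carrier (free_alg m n :: (torus_letter word \<Rightarrow>\<^sub>0 'k) ring)"
    using letter_in_free_alg[OF c] by (simp add: letter_def mon_def)
  from cls_carrier[OF this] show ?thesis by (simp add: tinv_def letter_def mon_def)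
qed

text \<open>Calculations are carried out with representatives in the free algebra, where the ring
  operations are those of a type class; \<open>\<cong>\<^sub>t\<close> is equality in the
  torus.\<close>

definition eqv :: "(torus_letter word \<Rightarrow>\<^sub>0 'k) \<Rightarrow> (torus_letter word \<Rightarrow>\<^sub>0 'k) \<Rightarrow> bool" (infix \<open>\<cong>\<^sub>t\<close> 50) where
  "f \<cong>\<^sub>t g \<longleftrightarrow> cls m n q f = cls m n q g"

lemma eqv_refl [simp]: "f \<cong>\<^sub>t f" by (simp add: eqv_def)
lemma eqv_sym: "f \<cong>\<^sub>t g \<Longrightarrow> g \<cong>\<^sub>t f" by (simp add: eqv_def)
lemma eqv_trans [trans]: "f \<cong>\<^sub>t g \<Longrightarrow> g \<cong>\<^sub>t h \<Longrightarrow> f \<cong>\<^sub>t h" by (simp add: eqv_def)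
lemma eqv_mult: "f \<cong>\<^sub>t f' \<Longrightarrow> g \<cong>\<^sub>t g' \<Longrightarrow> f * g \<cong>\<^sub>t f' * g'" by (simp add: eqv_def cls_mult)
lemma eqv_add: "f \<cong>\<^sub>t f' \<Longrightarrow> g \<cong>\<^sub>t g' \<Longrightarrow> f + g \<cong>\<^sub>t f' + g'" by (simp add: eqv_def cls_add)

lemma eqv_eq_trans [trans]: "f \<cong>\<^sub>t g \<Longrightarrow> g = h \<Longrightarrow> f \<cong>\<^sub>t h" by simp
lemma eq_eqv_trans [trans]: "f = g \<Longrightarrow> g \<cong>\<^sub>t h \<Longrightarrow> f \<cong>\<^sub>t h" by simp

lemma eqv_sum: "(\<And>x. x \<in> A \<Longrightarrow> f x \<cong>\<^sub>t g x) \<Longrightarrow> (\<Sum>x\<in>A. f x) \<cong>\<^sub>t (\<Sum>x\<in>A. g x)"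
  by (induction A rule: infinite_finite_induct) (auto intro: eqv_add)

lemma relator_eqv:
  assumes "f - g \<in> torus_relators m n q"
  shows "f \<cong>\<^sub>t g"
proof -
  interpret R: ring "free_alg m n :: (torus_letter word \<Rightarrow>\<^sub>0 'k) ring" by (rule ring_free_alg)
  interpret I: ideal "torus_ideal m n q" "free_alg m n :: (torus_letter word \<Rightarrow>\<^sub>0 'k) ring"
    by (rule torus_ideal_is_ideal)
  have "f - g \<in> torus_ideal m n q"
    unfolding torus_ideal_def using R.genideal_self[OF torus_relators_in_free_alg] assms by blast
  then have "torus_class m n q (f - g) = \<zero>\<^bsub>T\<^esub>"
    unfolding torus_class_def torus_def by (simp add: FactRing_def I.a_rcos_const)
  moreover have "f - g \<in> carrier (free_alg m n)" using assms torus_relators_in_free_alg by blast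
  ultimately have z: "cls m n q (f - g) = \<zero>\<^bsub>T\<^esub>" by (simp add: cls_carrier)
  have "cls m n q f = cls m n q ((f - g) + g)" by simp
  also have "\<dots> = cls m n q g"
    unfolding cls_add z using T.l_zero by simp
  finally show ?thesis by (simp add: eqv_def)
qed

lemma eqv_inverse:
  assumes "c \<in> coords m n"
  shows "mon [Pos c] * mon [Neg c] \<cong>\<^sub>t 1" "mon [Neg c] * mon [Pos c] \<cong>\<^sub>t 1"
  using assms by (auto intro!: relator_eqv simp: torus_relators_def mon_def letter_def)

lemma mon_improper: "\<not> proper m n (Word w) \<Longrightarrow> mon w \<cong>\<^sub>t 0"
proof -
  assume "\<not> proper m n (Word w)"
  then have "kill m n (mon w :: torus_letter word \<Rightarrow>\<^sub>0 'k) = kill m n 0"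
    by (intro poly_mapping_eqI) (auto simp: lookup_kill mon_def lookup_single when_def)
  then show ?thesis by (simp add: eqv_def cls_def)
qed

definition sc :: "int \<Rightarrow> torus_letter word \<Rightarrow>\<^sub>0 'k" where
  "sc k = const (q powi k)"

lemma sc_add: "sc a * sc b = sc (a + b)"
  using q0 by (simp add: sc_def const_mult power_int_add)

lemma sc_0 [simp]: "sc 0 = 1" by (simp add: sc_def)

lemma sc_central: "f * sc k = sc k * f"
  by (simp add: sc_def const_central)

lemma sc_pull: "f * (sc b * g) = sc b * (f * g)"
  unfolding mult.assoc[symmetric] sc_central[of f] ..

lemma sc_add_left: "sc a * (sc b * f) = sc (a + b) * f"
  by (simp add: mult.assoc[symmetric] sc_add)

lemma sc_shuffle: "(sc a * f) * (sc b * g) = sc (a + b) * (f * g)"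
  unfolding mult.assoc sc_pull[of f] sc_add[symmetric] ..

end

text \<open>\<open>t\<^sub>c t\<^sub>d = q ^ coord_form c d t\<^sub>d t\<^sub>c\<close>, extended bilinearly to words.\<close>

definition coord_form :: "nat \<times> nat \<Rightarrow> nat \<times> nat \<Rightarrow> int" where
  "coord_form c d = (if fst c = fst d then sgn (int (snd d) - int (snd c))
    else if snd c = snd d then sgn (int (fst d) - int (fst c)) else 0)"

fun letter_sign :: "torus_letter \<Rightarrow> int" where
  "letter_sign (Pos c) = 1" | "letter_sign (Neg c) = -1"

fun letter_coord :: "torus_letter \<Rightarrow> nat \<times> nat" where
  "letter_coord (Pos c) = c" | "letter_coord (Neg c) = c"

definition letter_form :: "torus_letter \<Rightarrow> torus_letter \<Rightarrow> int" where
  "letter_form x y = letter_sign x * letter_sign y * coord_form (letter_coord x) (letter_coord y)"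

definition form :: "torus_letter list \<Rightarrow> torus_letter list \<Rightarrow> int" where
  "form u v = (\<Sum>x\<leftarrow>u. \<Sum>y\<leftarrow>v. letter_form x y)"

lemma coord_form_anti: "coord_form d c = - coord_form c d"
  by (auto simp: coord_form_def sgn_if)

lemma letter_form_anti: "letter_form y x = - letter_form x y"
  by (simp add: letter_form_def coord_form_anti[of "letter_coord y" "letter_coord x"])

lemma form_Nil [simp]: "form [] v = 0" "form u [] = 0"
  by (simp_all add: form_def)

lemma form_append: "form (u @ u') v = form u v + form u' v" "form u (v @ v') = form u v + form u v'"
  by (simp_all add: form_def sum_list_addf)

lemma form_anti: "form v u = - form u v"
proof -
  have 1: "form [y] u = - form u [y]" for y
    by (induction u) (simp_all add: form_def letter_form_anti[of y])
  show ?thesis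
  proof (induction v)
    case (Cons y v)
    then show ?case using 1[of y] form_append(1)[of "[y]" v u] form_append(2)[of u "[y]" v] by simp
  qed simp
qed

context quantum_torus
begin

lemma submatrix_eqv:
  assumes "1 \<le> i" "i < i'" "i' \<le> m" "1 \<le> j" "j < j'" "j' \<le> n"
    and "f - g \<in> submatrix_relators q (i, j) (i, j') (i', j) (i', j')"
  shows "f \<cong>\<^sub>t g"
  using assms by (intro relator_eqv) (unfold torus_relators_def, blast)

lemma pos_commute_less:
  assumes c: "c \<in> coords m n" and d: "d \<in> coords m n" and "c < d"
  shows "mon [Pos c] * mon [Pos d] \<cong>\<^sub>t sc (coord_form c d) * (mon [Pos d] * mon [Pos c])"
proof -
  obtain i j where c': "c = (i, j)" by (cases c)
  obtain k l where d': "d = (k, l)" by (cases d)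
  have r: "1 \<le> i" "i \<le> m" "1 \<le> j" "j \<le> n" "1 \<le> k" "k \<le> m" "1 \<le> l" "l \<le> n"
    using c d by (auto simp: c' d' coords_def)
  note unf = submatrix_relators_def Let_def mon_def letter_def[symmetric] sc_def coord_form_def mult.assoc[symmetric]
  consider "i = k" "j < l" | "i < k" "j = l" | "i < k" "j < l" | "i < k" "l < j"
    using \<open>c < d\<close> unfolding c' d' by force
  then show ?thesis
  proof cases
    case 1
    \<comment> \<open>Entries of one row are related only inside a \<open>2 \<times> 2\<close>
      submatrix, so a second row has to be supplied.\<close>
    obtain i' where "i' \<noteq> i" "1 \<le> i'" "i' \<le> m" using m2 r by (metis one_le_numeral order_trans numeral_One one_eq_numeral_iff semiring_norm(85) le_refl)
    then consider "i < i'" | "i' < i" by linarith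
    then show ?thesis
    proof cases
      case a: 1
      show ?thesis unfolding c' d'
        by (rule submatrix_eqv[of i i' j l]) (use a 1 r \<open>1 \<le> i'\<close> \<open>i' \<le> m\<close> in \<open>auto simp: unf\<close>)
    next
      case a: 2
      show ?thesis unfolding c' d'
        by (rule submatrix_eqv[of i' i j l]) (use a 1 r \<open>1 \<le> i'\<close> \<open>i' \<le> m\<close> in \<open>auto simp: unf\<close>)
    qed
  next
    case 2
    obtain j' where "j' \<noteq> j" "1 \<le> j'" "j' \<le> n" using n2 r by (metis one_le_numeral order_trans numeral_One one_eq_numeral_iff semiring_norm(85) le_refl)
    then consider "j < j'" | "j' < j" by linarith
    then show ?thesis
    proof cases
      case a: 1
      show ?thesis unfolding c' d'
        by (rule submatrix_eqv[of i k j j']) (use a 2 r \<open>1 \<le> j'\<close> \<open>j' \<le> n\<close> in \<open>auto simp: unf\<close>)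
    next
      case a: 2
      show ?thesis unfolding c' d'
        by (rule submatrix_eqv[of i k j' j]) (use a 2 r \<open>1 \<le> j'\<close> \<open>j' \<le> n\<close> in \<open>auto simp: unf\<close>)
    qed
  next
    case 3
    show ?thesis unfolding c' d'
      by (rule submatrix_eqv[of i k j l]) (use 3 r in \<open>auto simp: unf\<close>)
  next
    case 4
    show ?thesis unfolding c' d'
      by (rule submatrix_eqv[of i k l j]) (use 4 r in \<open>auto simp: unf\<close>)
  qed
qed

lemma eqv_scalar_swap: "f \<cong>\<^sub>t sc k * g \<Longrightarrow> g \<cong>\<^sub>t sc (- k) * f"
proof -
  assume "f \<cong>\<^sub>t sc k * g"
  then have "sc (- k) * f \<cong>\<^sub>t sc (- k) * (sc k * g)" by (intro eqv_mult) simp_all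
  also have "sc (- k) * (sc k * g) = g" by (simp add: mult.assoc[symmetric] sc_add)
  finally show ?thesis by (rule eqv_sym)
qed

lemma pos_commute:
  assumes "c \<in> coords m n" "d \<in> coords m n"
  shows "mon [Pos c] * mon [Pos d] \<cong>\<^sub>t sc (coord_form c d) * (mon [Pos d] * mon [Pos c])"
proof -
  consider "c < d" | "c = d" | "d < c" by fastforce
  then show ?thesis
  proof cases
    case 2
    then show ?thesis by (simp add: coord_form_def)
  next
    case 3
    then show ?thesis using eqv_scalar_swap[OF pos_commute_less[OF assms(2,1) 3]] coord_form_anti[of c d] by simp
  qed (rule pos_commute_less[OF assms])
qed

lemma inverse_commute:
  assumes x: "x * y \<cong>\<^sub>t 1" "y * x \<cong>\<^sub>t 1" and z: "x * z \<cong>\<^sub>t sc k * (z * x)"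
  shows "y * z \<cong>\<^sub>t sc (- k) * (z * y)"
proof (rule eqv_scalar_swap)
  have "z * y = 1 * (z * y)" by simp
  also have "\<dots> \<cong>\<^sub>t (y * x) * (z * y)" by (intro eqv_mult eqv_sym[OF x(2)] eqv_refl)
  also have "\<dots> = y * (x * z) * y" by (simp add: mult.assoc)
  also have "\<dots> \<cong>\<^sub>t y * (sc k * (z * x)) * y" by (intro eqv_mult z eqv_refl)
  also have "\<dots> = (sc k * (y * z)) * (x * y)" by (metis mult.assoc sc_central)
  also have "\<dots> \<cong>\<^sub>t (sc k * (y * z)) * 1" by (intro eqv_mult x(1) eqv_refl)
  finally show "z * y \<cong>\<^sub>t sc k * (y * z)" by simp
qed

lemma letter_commute:
  assumes "proper m n (Word [x])" "proper m n (Word [y])"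
  shows "mon [x] * mon [y] \<cong>\<^sub>t sc (letter_form x y) * (mon [y] * mon [x])"
proof -
  have A: "mon [x] * mon [Pos d] \<cong>\<^sub>t sc (letter_form x (Pos d)) * (mon [Pos d] * mon [x])"
    if d: "d \<in> coords m n" for d
  proof (cases x)
    case (Pos c)
    then show ?thesis using assms(1) pos_commute[OF _ d] by (auto simp: letter_form_def proper_def)
  next
    case (Neg c)
    then have "c \<in> coords m n" using assms(1) by (auto simp: proper_def)
    then show ?thesis using inverse_commute[OF eqv_inverse pos_commute[OF _ d]] Neg by (auto simp: letter_form_def)
  qed
  show ?thesis
  proof (cases y)
    case (Pos d)
    then show ?thesis using A assms(2) by (auto simp: proper_def)
  next
    case (Neg d)
    then have d: "d \<in> coords m n" using assms(2) by (auto simp: proper_def)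
    have "mon [Neg d] * mon [x] \<cong>\<^sub>t sc (- (- letter_form x (Pos d))) * (mon [x] * mon [Neg d])"
      by (rule inverse_commute[OF eqv_inverse[OF d] eqv_scalar_swap[OF A[OF d]]])
    from eqv_scalar_swap[OF this] show ?thesis using Neg by (simp add: letter_form_def)
  qed
qed

lemma mon_commute: "mon u * mon v \<cong>\<^sub>t sc (form u v) * (mon v * mon u)"
proof (cases "proper m n (Word (u @ v))")
  case False
  then have "mon (u @ v) \<cong>\<^sub>t 0" "mon (v @ u) \<cong>\<^sub>t 0"
    by (auto intro!: mon_improper simp: proper_def)
  then show ?thesis
    unfolding mon_mult by (metis eqv_mult eqv_refl eqv_sym eqv_trans mult_zero_right)
next
  case True
  have single: "mon [x] * mon v \<cong>\<^sub>t sc (form [x] v) * (mon v * mon [x])"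
    if "proper m n (Word (x # v))" for x v
    using that
  proof (induction v)
    case (Cons y v)
    have "mon [x] * mon (y # v) = (mon [x] * mon [y]) * mon v" by (simp add: mon_mult)
    also have "\<dots> \<cong>\<^sub>t (sc (letter_form x y) * (mon [y] * mon [x])) * mon v"
      by (intro eqv_mult letter_commute) (use Cons.prems in \<open>auto simp: proper_def\<close>)
    also have "\<dots> = (sc (letter_form x y) * mon [y]) * (mon [x] * mon v)" by (simp add: mult.assoc)
    also have "\<dots> \<cong>\<^sub>t (sc (letter_form x y) * mon [y]) * (sc (form [x] v) * (mon v * mon [x]))"
      by (intro eqv_mult Cons.IH eqv_refl) (use Cons.prems in \<open>auto simp: proper_def\<close>)
    also have "\<dots> = sc (form [x] (y # v)) * (mon (y # v) * mon [x])"
      by (simp only: sc_shuffle) (simp add: mon_mult form_def)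
    finally show ?case .
  qed (simp add: mon_Nil)
  show ?thesis using True
  proof (induction u)
    case (Cons x u)
    have "mon (x # u) * mon v = mon [x] * (mon u * mon v)" by (simp add: mon_mult)
    also have "\<dots> \<cong>\<^sub>t mon [x] * (sc (form u v) * (mon v * mon u))"
      by (intro eqv_mult Cons.IH eqv_refl) (use Cons.prems in \<open>auto simp: proper_def\<close>)
    also have "\<dots> = sc (form u v) * ((mon [x] * mon v) * mon u)"
      unfolding sc_pull mult.assoc ..
    also have "\<dots> \<cong>\<^sub>t sc (form u v) * ((sc (form [x] v) * (mon v * mon [x])) * mon u)"
      by (intro eqv_mult single eqv_refl) (use Cons.prems in \<open>auto simp: proper_def\<close>)
    also have "\<dots> = (sc (form u v) * sc (form [x] v)) * (mon v * (mon [x] * mon u))"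
      by (simp add: mult.assoc)
    also have "\<dots> = sc (form (x # u) v) * (mon v * mon (x # u))"
      using form_append(1)[of "[x]" u v] by (simp add: sc_add mon_mult add.commute)
    finally show ?case .
  qed (simp add: mon_Nil)
qed

end

section \<open>Weights of paths and their swaps\<close>

locale cauchon_torus = cauchon_grid m n B rs + quantum_torus m n q
  for m n :: nat and B :: "(nat \<times> nat) set" and rs :: "nat \<times> nat" and q :: "'k::field"
begin

text \<open>The weight of a path telescopes to the product of the \<open>t\<^sub>k\<^sub>,\<^sub>c t\<^sub>k\<^sub>+\<^sub>1\<^sub>,\<^sub>c\<inverse>\<close>, \<open>c\<close> being the column in
  which it leaves row \<open>k\<close>; the second factor is absent for \<open>k = m\<close>.\<close>

definition lab :: "nat \<Rightarrow> nat \<Rightarrow> torus_letter list" where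
  "lab k c = (if c \<le> n then Pos (k, c) # (if k < m then [Neg (Suc k, c)] else []) else [])"

definition seg :: "(nat \<Rightarrow> nat) \<Rightarrow> nat \<Rightarrow> nat \<Rightarrow> torus_letter list" where
  "seg a u v = concat (map (\<lambda>k. lab k (a k)) [u..<v])"

definition wt :: "(nat \<Rightarrow> nat) \<Rightarrow> torus_letter word \<Rightarrow>\<^sub>0 'k" where
  "wt a = mon (seg a 0 (Suc m))"

lemma lab_out [simp]: "lab k (Suc n) = []" by (simp add: lab_def)

lemma seg_Nil [simp]: "v \<le> u \<Longrightarrow> seg a u v = []" by (simp add: seg_def)

lemma seg_append: "u \<le> v \<Longrightarrow> v \<le> w \<Longrightarrow> seg a u v @ seg a v w = seg a u w"
  unfolding seg_def map_append[symmetric] concat_append[symmetric]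
  using upt_add_eq_append[of u v "w - v"] by simp

lemma seg_Cons: "u < v \<Longrightarrow> seg a u v = lab u (a u) @ seg a (Suc u) v"
  unfolding seg_def by (simp add: upt_conv_Cons)

lemma seg_snoc: "u \<le> v \<Longrightarrow> seg a u (Suc v) = seg a u v @ lab v (a v)"
  unfolding seg_def by simp

lemma seg_cong: "(\<And>k. u \<le> k \<Longrightarrow> k < v \<Longrightarrow> a k = b k) \<Longrightarrow> seg a u v = seg b u v"
  unfolding seg_def by (intro arg_cong[of _ _ concat] map_cong) auto

lemma form_lab_same:
  assumes "c < d" "d \<le> n" "k \<le> m"
  shows "form (lab k c) (lab k d) = (if k < m then 2 else 1)"
  using assms by (auto simp: form_def lab_def letter_form_def coord_form_def)

lemma form_lab_next:
  assumes "c \<le> n" "d \<le> n" "k < m"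
  shows "form (lab k c) (lab (Suc k) d) = (if d \<le> c then 1 else -1)"
  using assms by (auto simp: form_def lab_def letter_form_def coord_form_def)

text \<open>The two letters of \<open>lab k c\<close> both lie above row \<open>l\<close> and have
  opposite signs, so their contributions cancel. Hence the form of two paths only involves equal and
  adjacent rows.\<close>

lemma form_lab_far:
  assumes "Suc k < l" "l \<le> m"
  shows "form (lab k c) (lab l d) = 0"
  using assms by (auto simp: form_def lab_def letter_form_def coord_form_def)

lemma form_lab_seg_far:
  assumes "Suc k < u" "v \<le> Suc m"
  shows "form (lab k c) (seg b u v) = 0"
proof (cases "u \<le> v")
  case True
  then show ?thesis using assms(2)
  proof (induction v rule: dec_induct)
    case (step v)
    then show ?case using form_lab_far[of k v c "b v"] assms(1) by (simp add: seg_snoc form_append)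
  qed simp
qed simp

lemma form_lab_seg:
  assumes "k < v" "v \<le> m"
  shows "form (lab k c) (seg b (Suc k) (Suc v)) = form (lab k c) (lab (Suc k) (b (Suc k)))"
proof -
  have "seg b (Suc k) (Suc v) = lab (Suc k) (b (Suc k)) @ seg b (Suc (Suc k)) (Suc v)"
    using assms by (intro seg_Cons) simp
  then show ?thesis using form_lab_seg_far[of k "Suc (Suc k)" "Suc v"] assms by (simp add: form_append)
qed

lemma form_seg_lab:
  assumes "0 < v" "v \<le> m"
  shows "form (seg a 0 v) (lab v d) = form (lab (v - 1) (a (v - 1))) (lab v d)"
proof -
  have far: "form (seg a 0 u) (lab v d) = 0" if "u < v" for u
    using that
  proof (induction u)
    case (Suc u)
    then show ?case using form_lab_far[of u v "a u" d] assms by (simp add: seg_snoc form_append)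
  qed simp
  show ?thesis using seg_snoc[of 0 "v - 1" a] far[of "v - 1"] assms by (simp add: form_append)
qed

lemma form_seg_seg:
  assumes "0 < v" "v \<le> m"
  shows "form (seg a 0 v) (seg b v (Suc m)) = form (lab (v - 1) (a (v - 1))) (lab v (b v))"
proof -
  have "form (seg a 0 u) (seg b (Suc v) (Suc m)) = 0" if "u \<le> v" for u
    using that
  proof (induction u)
    case (Suc u)
    then show ?case using form_lab_seg_far[of u "Suc v" "Suc m"] by (simp add: seg_snoc form_append)
  qed simp
  then show ?thesis using seg_Cons[of v "Suc m" b] form_seg_lab[OF assms] assms by (simp add: form_append)
qed

text \<open>Row \<open>m\<close> contributes 1, since its label has no inverse letter. Each row
  above contributes 2 with itself and -1 with the next row in either direction.\<close>

lemma form_tails: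
  assumes a: "vpath c a" and b: "vpath d b" and R: "R \<le> m" "fst c \<le> R" "fst d \<le> R"
    and lt: "\<And>k. R \<le> k \<Longrightarrow> k < m \<Longrightarrow> a k < b (Suc k)" and lt_end: "a m < b m"
  shows "form (seg a R (Suc m)) (seg b R (Suc m)) = 1"
proof -
  have an: "a k \<le> n" and bn: "b k \<le> n" if "R \<le> k" for k
    using that R vpath_after[OF a, of k] vpath_after[OF b, of k] by simp_all
  show ?thesis using R(1) order_refl[of R]
  proof (induction rule: inc_induct)
    case base
    then show ?case using form_lab_same[OF lt_end bn[of m]] R lt_end by (simp add: seg_def)
  next
    case (step k)
    have ab: "a k < b k" using lt[of k] vpath_Suc[OF b, of k] step by simp
    have 1: "form (lab k (a k)) (seg b (Suc k) (Suc m)) = -1"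
      using form_lab_seg[of k m "a k" b] form_lab_next[of "a k" "b (Suc k)" k] an[of k] bn[of "Suc k"] lt[of k] step by simp
    have "form (lab k (b k)) (seg a (Suc k) (Suc m)) = 1"
      using form_lab_seg[of k m "b k" a] form_lab_next[of "b k" "a (Suc k)" k] bn[of k] an[of "Suc k"]
        vpath_Suc[OF a, of k] ab step by simp
    then have 2: "form (seg a (Suc k) (Suc m)) (lab k (b k)) = -1" by (subst form_anti) simp
    show ?case
      using step 1 2 form_lab_same[OF ab bn[of k]] seg_Cons[of k "Suc m" a] seg_Cons[of k "Suc m" b]
      by (simp add: form_append)
  qed
qed

lemma form_heads_row:
  assumes a: "vpath c a" and b: "vpath d b" and v: "fst d \<le> v" "v \<le> m" and lt: "a (v - 1) < b v"
  shows "form (seg a 0 v) (lab v (b v)) + form (lab v (a v)) (seg b 0 v) = (if fst d < v then -2 else -1)"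
proof -
  have v0: "0 < v" using v vpath_range[OF b] by simp
  have bn: "b v \<le> n" using vpath_after[OF b v(1)] .
  have ab: "a v < b v" using lt vpath_Suc[OF a, of "v - 1"] v0 by simp
  have 1: "form (seg a 0 v) (lab v (b v)) = -1"
    using form_seg_lab[of v a "b v"] form_lab_next[of "a (v - 1)" "b v" "v - 1"] lt bn v v0 by simp
  have "form (seg b 0 v) (lab v (a v)) = (if fst d < v then 1 else 0)"
  proof (cases "fst d < v")
    case True
    then have "b (v - 1) \<le> n" "a v \<le> b (v - 1)"
      using vpath_after[OF b, of "v - 1"] ab vpath_Suc[OF b, of "v - 1"] v by auto
    then show ?thesis
      using form_seg_lab[of v b "a v"] form_lab_next[of "b (v - 1)" "a v" "v - 1"] ab bn v v0 True by simp
  next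
    case False
    then show ?thesis using form_seg_lab[of v b "a v"] vpath_before[OF b, of "v - 1"] v v0 by simp
  qed
  then have "form (lab v (a v)) (seg b 0 v) = (if fst d < v then -1 else 0)" by (subst form_anti) simp
  then show ?thesis using 1 by simp
qed

text \<open>A new row interacts with the rows above by -2, or by -1 if \<open>b\<close> starts in
  it, and with itself by 2. So the value becomes 1 when \<open>b\<close> starts and then stays
  1.\<close>

lemma form_heads:
  assumes a: "vpath c a" and b: "vpath d b" and cd: "fst c < fst d" and "v \<le> m"
    and lt: "\<And>k. Suc k < v \<Longrightarrow> a k < b (Suc k) \<or> b (Suc k) = Suc n"
  shows "form (seg a 0 v) (seg b 0 v) = (if fst d < v then 1 else 0)"
  using assms(4,5)
proof (induction v)
  case (Suc v)
  have IH: "form (seg a 0 v) (seg b 0 v) = (if fst d < v then 1 else 0)" using Suc by simp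
  show ?case
  proof (cases "v = 0 \<or> v < fst d")
    case True
    then have "b v = Suc n" using vpath_before[OF b, of v] vpath_range[OF b] by auto
    have "form (seg b 0 v) (lab v (a v)) = 0"
      using True form_seg_lab[of v b "a v"] Suc.prems(1) vpath_before[OF b, of "v - 1"] by (cases "v = 0") auto
    then have "form (lab v (a v)) (seg b 0 v) = 0" by (subst form_anti) simp
    then show ?thesis using True IH \<open>b v = Suc n\<close> vpath_range[OF b] by (auto simp: seg_snoc form_append)
  next
    case False
    then have v: "fst d \<le> v" "v < m" using Suc.prems by auto
    have bn: "b v \<le> n" using vpath_after[OF b v(1)] .
    have lt': "a (v - 1) < b v" using Suc.prems(2)[of "v - 1"] False bn by auto
    then have "a v < b v" using vpath_Suc[OF a, of "v - 1"] False by simp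
    then show ?thesis
      using IH form_heads_row[OF a b v(1) less_imp_le[OF v(2)] lt'] form_lab_same[OF _ bn, of "a v" v] v
      by (auto simp: seg_snoc form_append)
  qed
qed simp

lemma wt_split: "R \<le> m \<Longrightarrow> wt a = mon (seg a 0 R) * mon (seg a R (Suc m))"
  by (simp add: wt_def mon_mult seg_append)

text \<open>In row \<open>m\<close> the labels interact by 1 instead of 2, which brings the value of
  \<open>form_heads\<close> down to 0.\<close>

lemma wt_commute_prec:
  assumes a: "vpath c a" and b: "vpath d b" and cd: "fst c < fst d" and "prec a b"
  shows "wt a * wt b \<cong>\<^sub>t wt b * wt a"
proof -
  have lt: "a k < b (Suc k) \<or> b (Suc k) = Suc n" if "k < m" for k
    using that assms(4) by (simp add: prec_def)
  have m: "0 < m" "fst d \<le> m" using m2 vpath_range[OF b] by auto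
  have H: "form (seg a 0 m) (seg b 0 m) = (if fst d < m then 1 else 0)"
    by (rule form_heads[OF a b cd order_refl]) (use lt in auto)
  have bn: "b m \<le> n" by (rule vpath_after[OF b m(2)])
  have lt': "a (m - 1) < b m" using lt[of "m - 1"] bn m by simp
  then have ab: "a m < b m" using vpath_Suc[OF a, of "m - 1"] m by simp
  then have "form (seg a 0 (Suc m)) (seg b 0 (Suc m)) = 0"
    using H form_heads_row[OF a b m(2) order_refl lt'] form_lab_same[OF ab bn, of m]
    by (auto simp: seg_snoc form_append split: if_splits)
  then show ?thesis using mon_commute[of "seg a 0 (Suc m)" "seg b 0 (Suc m)"] by (simp add: wt_def)
qed

text \<open>A meeting in row \<open>R\<close>: both paths have started and their column intervals in
  this row intersect. The condition is symmetric in the two paths.\<close>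

definition ovl :: "(nat \<Rightarrow> nat) \<Rightarrow> (nat \<Rightarrow> nat) \<Rightarrow> nat \<Rightarrow> bool" where
  "ovl a b R \<longleftrightarrow> 0 < R \<and> R \<le> m \<and> a R \<le> b (R - 1) \<and> b R \<le> a (R - 1) \<and> a R \<le> n \<and> b R \<le> n"

definition swap :: "nat \<Rightarrow> (nat \<Rightarrow> nat) \<Rightarrow> (nat \<Rightarrow> nat) \<Rightarrow> nat \<Rightarrow> nat" where
  "swap R a b = (\<lambda>k. if k < R then a k else b k)"

lemma swap_swap [simp]: "swap R (swap R a b) (swap R b a) = a"
  by (auto simp: swap_def)

text \<open>In row \<open>R\<close> the exchanged conditions compare each path with itself and hold
  by monotonicity. Since all meeting rows persist, a row selected from their set is selected again
  after the exchange.\<close>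

lemma ovl_swap:
  assumes "vpath c a" "vpath d b" "ovl a b R"
  shows "ovl (swap R a b) (swap R b a) k \<longleftrightarrow> ovl a b k"
proof (cases k R rule: linorder_cases)
  case equal
  then show ?thesis
    using assms(3) vpath_Suc[OF assms(1), of "k - 1"] vpath_Suc[OF assms(2), of "k - 1"]
    by (auto simp: ovl_def swap_def)
qed (auto simp: ovl_def swap_def)

lemma wt_swap:
  assumes "R \<le> m"
  shows "wt (swap R a b) = mon (seg a 0 R) * mon (seg b R (Suc m))"
proof -
  have "seg (swap R a b) 0 R = seg a 0 R" "seg (swap R a b) R (Suc m) = seg b R (Suc m)"
    by (auto intro!: seg_cong simp: swap_def)
  then show ?thesis using wt_split[OF assms, of "swap R a b"] by simp
qed

text \<open>The only new turn that needs care arises where \<open>b\<close> enters row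
  \<open>R\<close> from its row vertex and \<open>a\<close> comes from above. If \<open>a\<close>
  turns left further down, \<open>vpath_turn_le\<close> bounds it; if \<open>a\<close> already runs
  in its final column, the new turn is at \<open>(fst d, snd c)\<close> and the last premise is
  required.\<close>

lemma vpath_swap_tails:
  assumes a: "vpath c a" and b: "vpath d b" and o: "ovl a b R" and cd: "fst c \<le> fst d"
    and st: "fst c = fst d \<or> snd c = snd d \<or> (fst d, max (snd c) (snd d)) \<le> rs"
  shows "vpath (fst c, snd d) (swap R a b)" "vpath (fst d, snd c) (swap R b a)"
proof -
  have R: "0 < R" "R \<le> m" "Suc (R - 1) = R" "R - 1 < m" "fst c \<le> R" "fst d \<le> R"
    using o vpath_le_iff[OF a, of R] vpath_le_iff[OF b, of R] by (auto simp: ovl_def)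
  have le: "b (Suc (R - 1)) \<le> a (R - 1)" "a (Suc (R - 1)) \<le> b (R - 1)"
    using o R by (auto simp: ovl_def)
  have s1: "step (Suc (R - 1)) (a (R - 1)) (b (Suc (R - 1)))"
  proof (rule vpath_swap[OF a b R(4) le])
    assume n: "b (R - 1) = Suc n" "a (R - 1) \<le> n" "b (Suc (R - 1)) < a (R - 1)"
    then have "R - 1 < fst d" "fst c \<le> R - 1" using vpath_eq_Suc_iff[OF b] vpath_le_iff[OF a] by auto
    then have Rd: "R = fst d" "fst c \<noteq> fst d" using R by auto
    show "(Suc (R - 1), a (R - 1)) \<le> rs"
    proof (cases "a (R - 1) = snd c")
      case True
      have "snd d \<noteq> snd c" using n(3) True vpath_ge[OF b, of R] R by simp
      then have "(fst d, max (snd c) (snd d)) \<le> rs" using st Rd by simp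
      moreover have "(R, a (R - 1)) \<le> (fst d, max (snd c) (snd d))" using True Rd by (simp add: less_eq_prod_def)
      ultimately have "(R, a (R - 1)) \<le> rs" by (rule order_trans[rotated])
      then show ?thesis by (simp only: R(3))
    next
      case False
      then have "a m < a (R - 1)" using vpath_end[OF a, of m] vpath_ge[OF a, of "R - 1"] by simp
      then show ?thesis using vpath_turn_le[OF a _ R(4) n(2)] by blast
    qed
  qed
  have s2: "step (Suc (R - 1)) (b (R - 1)) (a (Suc (R - 1)))"
  proof (rule vpath_swap[OF b a R(4) le(2,1)])
    assume "a (R - 1) = Suc n" "b (R - 1) \<le> n"
    then have "R - 1 < fst c" "fst d \<le> R - 1" using vpath_eq_Suc_iff[OF a] vpath_le_iff[OF b] by auto
    then show "(Suc (R - 1), b (R - 1)) \<le> rs" using cd by simp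
  qed
  have gen: "vpath (fst c', snd d') (swap R a' b')"
    if a': "vpath c' a'" and b': "vpath d' b'" and s: "step (Suc (R - 1)) (a' (R - 1)) (b' (Suc (R - 1)))"
      and r: "fst c' \<le> R" "fst d' \<le> R" for a' b' c' d'
  proof -
    have "step (Suc k) (swap R a' b' k) (swap R a' b' (Suc k))" if "k < m" for k
    proof -
      consider "Suc k < R" | "k = R - 1" "Suc k = R" | "R \<le> k" using R by linarith
      then show ?thesis
        using vpath_step[OF a' that] vpath_step[OF b' that] s R by cases (auto simp: swap_def)
    qed
    moreover have "swap R a' b' (fst c') \<le> n"
      using vpath_after[OF a', of "fst c'"] vpath_after[OF b', of "fst c'"] r by (auto simp: swap_def)
    moreover have "swap R a' b' k = Suc n" if "k < fst c'" for k
      using that r vpath_before[OF a'] by (simp add: swap_def)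
    moreover have "swap R a' b' k = snd d'" if "m \<le> k" for k
      using that R vpath_end[OF b'] by (simp add: swap_def)
    ultimately show ?thesis
      using vpath_range[OF a'] vpath_range[OF b'] unfolding vpath_def by (auto simp: coords_def)
  qed
  show "vpath (fst c, snd d) (swap R a b)" "vpath (fst d, snd c) (swap R b a)"
    using gen[OF a b s1] gen[OF b a s2] R by auto
qed

lemma form_step:
  assumes a: "vpath c a" and R: "0 < R" "R \<le> m" "v \<le> a (R - 1)" "v \<le> n"
  shows "form (lab (R - 1) (a (R - 1))) (lab R v) = (if fst c < R then 1 else 0)"
proof (cases "fst c < R")
  case True
  then have "a (R - 1) \<le> n" using vpath_after[OF a, of "R - 1"] by simp
  then show ?thesis using form_lab_next[of "a (R - 1)" v "R - 1"] True R by simp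
next
  case False
  then have "a (R - 1) = Suc n" using vpath_before[OF a, of "R - 1"] R by simp
  then show ?thesis using False by simp
qed

text \<open>After the last meeting the tail of \<open>a\<close> runs strictly left of that of
  \<open>b\<close>, so moving it past that tail costs \<open>q\<close> by \<open>form_tails\<close>.
  Both tails interact equally with the head of \<open>b\<close> and cross it in opposite directions,
  so these powers cancel.\<close>

lemma tail_swap_less:
  assumes a: "vpath c a" and b: "vpath d b" and o: "ovl a b R"
    and last: "\<And>k. R < k \<Longrightarrow> \<not> ovl a b k" and less: "snd c < snd d"
  shows "wt a * wt b \<cong>\<^sub>t sc 1 * (wt (swap R a b) * wt (swap R b a))"
proof -
  have R: "0 < R" "R \<le> m" "a R \<le> n" "b R \<le> n" "b R \<le> a (R - 1)" "a R \<le> b (R - 1)" using o by (auto simp: ovl_def)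
  have cR: "fst c \<le> R" "fst d \<le> R" using R vpath_le_iff[OF a, of R] vpath_le_iff[OF b, of R] by simp_all
  have end_less: "a m < b m" using less vpath_end[OF a, of m] vpath_end[OF b, of m] by simp
  have lt: "a k < b (Suc k)" if k: "R \<le> k" "k < m" for k
  proof -
    have down: "a l < b (Suc l)" if "R \<le> l" "l < m" "a (Suc l) < b (Suc l)" for l
    proof -
      have "a (Suc l) \<le> n" "b (Suc l) \<le> n" "a (Suc l) \<le> b l"
        using that cR vpath_after[OF a] vpath_after[OF b] vpath_Suc[OF b, of l] by auto
      then show ?thesis using last[of "Suc l"] that by (auto simp: ovl_def)
    qed
    have "a l < b l" if "R \<le> l" "l \<le> m" for l
      using that(2,1)
    proof (induction rule: inc_induct)
      case (step l)
      then show ?case using down[of l] vpath_Suc[OF b, of l] by simp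
    qed (rule end_less)
    then show ?thesis using down k by simp
  qed
  let ?ha = "seg a 0 R" and ?ta = "seg a R (Suc m)" and ?hb = "seg b 0 R" and ?tb = "seg b R (Suc m)"
  have tt: "form ?ta ?tb = 1" by (rule form_tails[OF a b R(2) cR lt end_less])
  have "form ?hb ?ta = (if fst d < R then 1 else 0)" "form ?hb ?tb = (if fst d < R then 1 else 0)"
    using form_seg_seg[OF R(1,2), of b a] form_step[OF b R(1,2,6,3)]
      form_seg_seg[OF R(1,2), of b b] form_step[OF b R(1,2) _ R(4)] vpath_Suc[OF b, of "R - 1"] R(1) by simp_all
  then have ht: "form ?ta ?hb + form ?hb ?tb = 0" by (subst form_anti) simp
  have "wt a * wt b = mon ?ha * (mon ?ta * mon (?hb @ ?tb))"
    using wt_split[OF R(2), of a] R(2) by (simp add: wt_def seg_append mult.assoc)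
  also have "\<dots> \<cong>\<^sub>t mon ?ha * (sc (form ?ta (?hb @ ?tb)) * (mon (?hb @ ?tb) * mon ?ta))"
    by (intro eqv_mult mon_commute eqv_refl)
  also have "\<dots> = sc (form ?ta (?hb @ ?tb)) * (mon ?ha * ((mon ?hb * mon ?tb) * mon ?ta))"
    by (simp add: sc_pull mon_mult)
  also have "\<dots> \<cong>\<^sub>t sc (form ?ta (?hb @ ?tb)) * (mon ?ha * ((sc (form ?hb ?tb) * (mon ?tb * mon ?hb)) * mon ?ta))"
    by (intro eqv_mult mon_commute eqv_refl)
  also have "mon ?ha * ((sc (form ?hb ?tb) * (mon ?tb * mon ?hb)) * mon ?ta)
      = sc (form ?hb ?tb) * (wt (swap R a b) * wt (swap R b a))"
    unfolding wt_swap[OF R(2)] mult.assoc by (rule sc_pull)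
  finally have "wt a * wt b \<cong>\<^sub>t
      sc (form ?ta (?hb @ ?tb)) * (sc (form ?hb ?tb) * (wt (swap R a b) * wt (swap R b a)))" .
  moreover have "form ?ta (?hb @ ?tb) + form ?hb ?tb = 1" using tt ht by (simp add: form_append)
  ultimately show ?thesis by (simp only: sc_add_left)
qed

text \<open>When \<open>b\<close> comes in from the right border, \<open>a\<close> is already under
  way and thus on its left; losing this position would be a meeting.\<close>

lemma no_ovl_lt:
  assumes a: "vpath c a" and b: "vpath d b" and cd: "fst c < fst d"
    and no: "\<And>k. k < v \<Longrightarrow> \<not> ovl a b k" and v: "Suc k < v" "v \<le> Suc m"
  shows "a k < b (Suc k) \<or> b (Suc k) = Suc n"
  using v(1)
proof (induction k)
  case 0
  then show ?case using vpath_eq_Suc_iff[OF b, of 1] vpath_range[OF a] cd by simp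
next
  case (Suc k)
  show ?case
  proof (rule ccontr)
    assume neg: "\<not> ?thesis"
    then have bn: "b (Suc (Suc k)) \<le> n" using vpath_le[OF b, of "Suc (Suc k)"] by simp
    then have an: "a (Suc (Suc k)) \<le> n" using vpath_le_iff[OF a] vpath_le_iff[OF b] cd by simp
    have "a (Suc (Suc k)) \<le> b (Suc k)"
      using Suc vpath_le[OF a, of "Suc (Suc k)"] vpath_Suc[OF a, of k] vpath_Suc[OF a, of "Suc k"] by auto
    then have "ovl a b (Suc (Suc k))" using neg an bn Suc.prems v(2) by (simp add: ovl_def)
    then show False using no Suc.prems by blast
  qed
qed

text \<open>Above the first meeting \<open>form_heads\<close> applies, and it cancels the
  interaction of the tail of \<open>a\<close> with the head of \<open>b\<close>. The factor
  \<open>q\<close> comes from moving the tail of \<open>a\<close> past its own head.\<close>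

lemma head_swap:
  assumes a: "vpath c a" and b: "vpath d b" and o: "ovl a b R"
    and first: "\<And>k. k < R \<Longrightarrow> \<not> ovl a b k" and cd: "fst c < fst d"
  shows "wt a * wt b \<cong>\<^sub>t sc 1 * (wt (swap R b a) * wt (swap R a b))"
proof -
  have R: "0 < R" "R \<le> m" "a R \<le> n" "b R \<le> n" "b R \<le> a (R - 1)" "a R \<le> b (R - 1)" using o by (auto simp: ovl_def)
  have cR: "fst c < R" "fst d \<le> R" using R vpath_le_iff[OF b, of R] cd by simp_all
  have lt: "a k < b (Suc k) \<or> b (Suc k) = Suc n" if "Suc k < R" for k
    using no_ovl_lt[OF a b cd first that] R by simp
  let ?ha = "seg a 0 R" and ?ta = "seg a R (Suc m)" and ?hb = "seg b 0 R" and ?tb = "seg b R (Suc m)"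
  have hh: "form ?ha ?hb = (if fst d < R then 1 else 0)" by (rule form_heads[OF a b cd R(2) lt])
  have hat: "form ?ha ?ta = 1"
    using form_seg_seg[OF R(1,2), of a a] form_step[OF a R(1,2) _ R(3)] vpath_Suc[OF a, of "R - 1"] R(1) cR by simp
  have "form ?hb ?ta = (if fst d < R then 1 else 0)"
    using form_seg_seg[OF R(1,2), of b a] form_step[OF b R(1,2,6,3)] by simp
  then have z: "form (?ha @ ?ta) ?hb = 0" using hh by (simp add: form_append form_anti[of ?ta ?hb])
  have "wt a * wt b = (mon (?ha @ ?ta) * mon ?hb) * mon ?tb"
    using wt_split[OF R(2), of b] R(2) by (simp add: wt_def seg_append mult.assoc)
  also have "\<dots> \<cong>\<^sub>t (sc 0 * (mon ?hb * mon (?ha @ ?ta))) * mon ?tb"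
    by (rule eqv_mult[OF mon_commute[of "?ha @ ?ta" ?hb, unfolded z] eqv_refl])
  also have "\<dots> = mon ?hb * ((mon ?ha * mon ?ta) * mon ?tb)"
    by (simp add: mon_mult mult.assoc)
  also have "\<dots> \<cong>\<^sub>t mon ?hb * ((sc 1 * (mon ?ta * mon ?ha)) * mon ?tb)"
    by (rule eqv_mult[OF eqv_refl eqv_mult[OF mon_commute[of ?ha ?ta, unfolded hat] eqv_refl]])
  also have "\<dots> = sc 1 * (wt (swap R b a) * wt (swap R a b))"
    unfolding wt_swap[OF R(2)] mult.assoc by (rule sc_pull)
  finally show ?thesis .
qed

end

section \<open>Commutation relations\<close>

lemma prod_list_sum_distrib:
  fixes f :: "nat \<Rightarrow> 'b \<Rightarrow> 'r::ring_1"
  assumes "\<And>l. l < K \<Longrightarrow> finite (A l)"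
  shows "prod_list (map (\<lambda>l. \<Sum>a\<in>A l. f l a) [0..<K]) =
    (\<Sum>F\<in>PiE {..<K} A. prod_list (map (\<lambda>l. f l (F l)) [0..<K]))"
  using assms
proof (induction K)
  case (Suc K)
  let ?g = "\<lambda>(a, F). F(K := a)"
  have bij: "bij_betw ?g (A K \<times> PiE {..<K} A) (PiE {..<Suc K} A)"
  proof (rule bij_betw_byWitness[where f' = "\<lambda>F. (F K, F(K := undefined))"])
    show "\<forall>x\<in>A K \<times> PiE {..<K} A. (?g x K, (?g x)(K := undefined)) = x"
    proof
      fix x assume "x \<in> A K \<times> PiE {..<K} A"
      then obtain a F where x: "x = (a, F)" and F: "F \<in> PiE {..<K} A" by blast
      have "F(K := undefined) = F" using PiE_arb[OF F, of K] by (intro fun_upd_idem) simp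
      then show "(?g x K, (?g x)(K := undefined)) = x" by (simp add: x)
    qed
    show "?g ` (A K \<times> PiE {..<K} A) \<subseteq> PiE {..<Suc K} A"
    proof (rule image_subsetI)
      fix x assume "x \<in> A K \<times> PiE {..<K} A"
      then obtain a F where x: "x = (a, F)" "a \<in> A K" "F \<in> PiE {..<K} A" by blast
      then show "?g x \<in> PiE {..<Suc K} A" unfolding lessThan_Suc x(1) split by (intro PiE_fun_upd)
    qed
    show "(\<lambda>F. (F K, F(K := undefined))) ` PiE {..<Suc K} A \<subseteq> A K \<times> PiE {..<K} A"
    proof (rule image_subsetI)
      fix F assume F: "F \<in> PiE {..<Suc K} A"
      then have "F l \<in> A l" if "l < Suc K" for l using that by (simp add: PiE_iff)
      moreover have "F l = undefined" if "\<not> l < Suc K" for l using that F by (simp add: PiE_iff extensional_def)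
      ultimately show "(F K, F(K := undefined)) \<in> A K \<times> PiE {..<K} A"
        by (simp add: PiE_iff extensional_def)
    qed
  qed simp
  have "prod_list (map (\<lambda>l. \<Sum>a\<in>A l. f l a) [0..<Suc K])
      = (\<Sum>F\<in>PiE {..<K} A. prod_list (map (\<lambda>l. f l (F l)) [0..<K])) * (\<Sum>a\<in>A K. f K a)"
    using Suc by simp
  also have "\<dots> = (\<Sum>(a, F)\<in>A K \<times> PiE {..<K} A. prod_list (map (\<lambda>l. f l (F l)) [0..<K]) * f K a)"
    by (simp add: sum_distrib_left sum_distrib_right sum.cartesian_product)
  also have "\<dots> = (\<Sum>x\<in>A K \<times> PiE {..<K} A. prod_list (map (\<lambda>l. f l (?g x l)) [0..<Suc K]))"
  proof (intro sum.cong refl)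
    fix x assume "x \<in> A K \<times> PiE {..<K} A"
    obtain a F where x: "x = (a, F)" by (cases x)
    have "(\<Prod>l\<leftarrow>[0..<K]. f l (if l = K then a else F l)) = (\<Prod>l\<leftarrow>[0..<K]. f l (F l))"
      by (intro arg_cong[where f = prod_list] map_cong) auto
    then show "(case x of (a, F) \<Rightarrow> prod_list (map (\<lambda>l. f l (F l)) [0..<K]) * f K a)
        = prod_list (map (\<lambda>l. f l (?g x l)) [0..<Suc K])" by (simp add: x)
  qed
  also have "\<dots> = (\<Sum>F\<in>PiE {..<Suc K} A. prod_list (map (\<lambda>l. f l (F l)) [0..<Suc K]))"
    by (rule sum.reindex_bij_betw[OF bij])
  finally show ?case .
qed (simp add: PiE_empty_domain)

context cauchon_grid
begin

lemma finite_vpaths: "finite {a. vpath c a}"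
proof (rule inj_on_finite)
  show "inj_on (\<lambda>a. restrict a {..m}) {a. vpath c a}"
  proof (rule inj_onI, rule ext)
    fix a b k assume ab: "a \<in> {a. vpath c a}" "b \<in> {a. vpath c a}" "restrict a {..m} = restrict b {..m}"
    show "a k = b k"
    proof (cases "k \<le> m")
      case True
      then show ?thesis using fun_cong[OF ab(3), of k] by simp
    next
      case False
      then show ?thesis using ab vpath_end[of c a k] vpath_end[of c b k] by simp
    qed
  qed
  show "(\<lambda>a. restrict a {..m}) ` {a. vpath c a} \<subseteq> PiE {..m} (\<lambda>_. {..Suc n})"
    by (intro image_subsetI PiE_I) (auto simp: vpath_le)
qed (auto intro: finite_PiE)

end

context cauchon_torus
begin

definition X :: "nat \<times> nat \<Rightarrow> torus_letter word \<Rightarrow>\<^sub>0 'k" where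
  "X c = (\<Sum>a\<in>{a. vpath c a}. wt a)"

definition pairs :: "nat \<times> nat \<Rightarrow> nat \<times> nat \<Rightarrow> ((nat \<Rightarrow> nat) \<times> (nat \<Rightarrow> nat)) set" where
  "pairs c d = {a. vpath c a} \<times> {b. vpath d b}"

definition opairs :: "nat \<times> nat \<Rightarrow> nat \<times> nat \<Rightarrow> ((nat \<Rightarrow> nat) \<times> (nat \<Rightarrow> nat)) set" where
  "opairs c d = {(a, b) \<in> pairs c d. \<exists>R. ovl a b R}"

lemma finite_pairs [simp]: "finite (pairs c d)" "finite (opairs c d)"
proof -
  show "finite (pairs c d)" by (simp add: pairs_def finite_vpaths)
  then show "finite (opairs c d)" by (rule finite_subset[rotated]) (auto simp: opairs_def)
qed

lemma X_mult: "X c * X d = (\<Sum>(a, b)\<in>pairs c d. wt a * wt b)"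
  by (simp add: X_def pairs_def sum_product sum.cartesian_product)

lemma X_mult_rev: "X d * X c = (\<Sum>(a, b)\<in>pairs c d. wt b * wt a)"
  unfolding X_def pairs_def sum_product sum.cartesian_product[symmetric] by (rule sum.swap)

lemma finite_ovl: "finite {R. ovl a b R}"
  by (rule finite_subset[of _ "{..m}"]) (auto simp: ovl_def)

lemma ovl_swap_set:
  assumes "vpath c a" "vpath d b" "ovl a b R"
  shows "{k. ovl (swap R a b) (swap R b a) k} = {k. ovl a b k}"
  using ovl_swap[OF assms] by simp

definition swap_ok :: "nat \<times> nat \<Rightarrow> nat \<times> nat \<Rightarrow> bool" where
  "swap_ok c d \<longleftrightarrow> fst c \<le> fst d \<and>
    (fst c = fst d \<or> snd c = snd d \<or> (fst d, max (snd c) (snd d)) \<le> rs)"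

lemma swap_ok_swap: "swap_ok c d \<Longrightarrow> swap_ok (fst c, snd d) (fst d, snd c)"
  by (auto simp: swap_ok_def max.commute)

text \<open>Swapping the tails at a meeting row that depends only on the set of meeting rows is an involution.\<close>

lemma swap_sum:
  fixes sel :: "nat set \<Rightarrow> nat"
  assumes sel: "\<And>A. finite A \<Longrightarrow> A \<noteq> {} \<Longrightarrow> sel A \<in> A" and ok: "swap_ok c d"
    and w: "\<And>a b. vpath c a \<Longrightarrow> vpath d b \<Longrightarrow> ovl a b (sel {R. ovl a b R}) \<Longrightarrow>
      f a b \<cong>\<^sub>t g (swap (sel {R. ovl a b R}) a b) (swap (sel {R. ovl a b R}) b a)"
  shows "(\<Sum>(a, b)\<in>opairs c d. f a b) \<cong>\<^sub>t (\<Sum>(a, b)\<in>opairs (fst c, snd d) (fst d, snd c). g a b)"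
proof -
  define \<tau> where "\<tau> = (\<lambda>(a, b). (swap (sel {R. ovl a b R}) a b, swap (sel {R. ovl a b R}) b a))"
  have selo: "ovl a b (sel {R. ovl a b R})" if "(a, b) \<in> opairs c d" for a b c d
    using sel[OF finite_ovl, of a b] that by (auto simp: opairs_def)
  have tau: "\<tau> x \<in> opairs (fst c, snd d) (fst d, snd c) \<and> \<tau> (\<tau> x) = x"
    if x: "x \<in> opairs c d" and ok: "swap_ok c d" for x c d
  proof -
    obtain a b where ab: "x = (a, b)" by (cases x)
    note o = selo[OF x[unfolded ab]]
    have v: "vpath c a" "vpath d b" using x by (auto simp: ab opairs_def pairs_def)
    note same = ovl_swap_set[OF v o]
    have "vpath (fst c, snd d) (swap (sel {R. ovl a b R}) a b)" "vpath (fst d, snd c) (swap (sel {R. ovl a b R}) b a)"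
      using vpath_swap_tails[OF v o] ok by (auto simp: swap_ok_def)
    moreover have "ovl (swap (sel {R. ovl a b R}) a b) (swap (sel {R. ovl a b R}) b a) (sel {R. ovl a b R})"
      using same o by blast
    ultimately show ?thesis by (auto simp: ab \<tau>_def opairs_def pairs_def same)
  qed
  have "(\<Sum>(a, b)\<in>opairs c d. f a b) \<cong>\<^sub>t (\<Sum>(a, b)\<in>opairs c d. case \<tau> (a, b) of (a', b') \<Rightarrow> g a' b')"
  proof (rule eqv_sum)
    fix x assume x: "x \<in> opairs c d"
    obtain a b where ab: "x = (a, b)" by (cases x)
    have v: "vpath c a" "vpath d b" using x by (auto simp: ab opairs_def pairs_def)
    show "(case x of (a, b) \<Rightarrow> f a b) \<cong>\<^sub>t (case x of (a, b) \<Rightarrow> case \<tau> (a, b) of (a', b') \<Rightarrow> g a' b')"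
      using w[OF v selo[OF x[unfolded ab]]] by (simp add: ab \<tau>_def)
  qed
  also have "(\<Sum>(a, b)\<in>opairs c d. case \<tau> (a, b) of (a', b') \<Rightarrow> g a' b')
      = (\<Sum>(a, b)\<in>opairs (fst c, snd d) (fst d, snd c). g a b)"
  proof (rule sum.reindex_bij_witness[of _ \<tau> \<tau>])
    fix x assume x: "x \<in> opairs c d"
    show "\<tau> (\<tau> x) = x" "\<tau> x \<in> opairs (fst c, snd d) (fst d, snd c)" using tau[OF x ok] by auto
    show "(case \<tau> x of (a, b) \<Rightarrow> g a b) = (case x of (a, b) \<Rightarrow> case \<tau> (a, b) of (a', b') \<Rightarrow> g a' b')"
      by (cases x) simp
  next
    fix x assume x: "x \<in> opairs (fst c, snd d) (fst d, snd c)"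
    show "\<tau> (\<tau> x) = x" "\<tau> x \<in> opairs c d" using tau[OF x swap_ok_swap[OF ok]] by auto
  qed
  finally show ?thesis .
qed

lemma sum_sc: "(\<Sum>(a, b)\<in>A. sc k * g a b) = sc k * (\<Sum>(a, b)\<in>A. g a b)"
  by (simp add: sum_distrib_left split_beta)

lemma tail_swap_sum:
  assumes "swap_ok c d" "snd c < snd d"
  shows "(\<Sum>(a, b)\<in>opairs c d. wt a * wt b)
    \<cong>\<^sub>t sc 1 * (\<Sum>(a, b)\<in>opairs (fst c, snd d) (fst d, snd c). wt a * wt b)"
  unfolding sum_sc[symmetric]
proof (rule swap_sum[of Max, OF Max_in assms(1)])
  fix a b assume v: "vpath c a" "vpath d b" "ovl a b (Max {R. ovl a b R})"
  show "wt a * wt b \<cong>\<^sub>t sc 1 * (wt (swap (Max {R. ovl a b R}) a b) * wt (swap (Max {R. ovl a b R}) b a))"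
    by (rule tail_swap_less[OF v _ assms(2)]) (use Max_ge[OF finite_ovl] in \<open>fastforce simp: not_le[symmetric]\<close>)
qed

lemma head_swap_sum:
  assumes "swap_ok c d" "fst c < fst d"
  shows "(\<Sum>(a, b)\<in>opairs c d. wt a * wt b)
    \<cong>\<^sub>t sc 1 * (\<Sum>(a, b)\<in>opairs (fst c, snd d) (fst d, snd c). wt b * wt a)"
  unfolding sum_sc[symmetric]
proof (rule swap_sum[of Min, OF Min_in assms(1)])
  fix a b assume v: "vpath c a" "vpath d b" "ovl a b (Min {R. ovl a b R})"
  show "wt a * wt b \<cong>\<^sub>t sc 1 * (wt (swap (Min {R. ovl a b R}) b a) * wt (swap (Min {R. ovl a b R}) a b))"
    by (rule head_swap[OF v _ assms(2)]) (use Min_le[OF finite_ovl] in \<open>fastforce simp: not_le[symmetric]\<close>)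
qed

lemma no_ovl_prec:
  assumes "vpath c a" "vpath d b" "fst c < fst d" "\<And>k. \<not> ovl a b k"
  shows "prec a b"
  unfolding prec_def using no_ovl_lt[OF assms(1-3), of "Suc m"] assms(4) by auto

lemma prec_no_ovl: "prec a b \<Longrightarrow> \<not> ovl a b k"
proof
  assume p: "prec a b" and o: "ovl a b k"
  have "a (k - 1) < b (Suc (k - 1)) \<or> b (Suc (k - 1)) = Suc n"
    using p o unfolding prec_def ovl_def by (metis Suc_pred' Suc_le_eq)
  then show False using o by (auto simp: ovl_def)
qed

lemma prec_end:
  assumes "vpath c a" "vpath d b" "prec a b"
  shows "snd c < snd d"
proof -
  have "a (m - 1) < b m" using assms(3) vpath_after[OF assms(2), of m] vpath_range[OF assms(2)] m2
    by (auto simp: prec_def dest!: spec[of _ "m - 1"])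
  then show ?thesis using vpath_ge[OF assms(1), of "m - 1"] vpath_end[OF assms(2), of m] by simp
qed

text \<open>Two paths entering the same row share its right end. For different rows, avoiding each
  other forces the ends to be in increasing order by \<open>prec_end\<close>.\<close>

lemma opairs_all:
  assumes "fst c = fst d \<or> fst c < fst d \<and> snd d \<le> snd c"
  shows "opairs c d = pairs c d"
proof -
  have "\<exists>R. ovl a b R" if a: "vpath c a" and b: "vpath d b" for a b
  proof (cases "fst c = fst d")
    case True
    then have "ovl a b (fst c)"
      using vpath_range[OF a] vpath_before[OF a, of "fst c - 1"] vpath_before[OF b, of "fst c - 1"]
        vpath_after[OF a, of "fst c"] vpath_after[OF b, of "fst c"] by (simp add: ovl_def)
    then show ?thesis ..
  next
    case False
    then have cd: "fst c < fst d" "snd d \<le> snd c" using assms by auto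
    show ?thesis
    proof (rule ccontr)
      assume "\<nexists>R. ovl a b R"
      then have "prec a b" using no_ovl_prec[OF a b cd(1)] by blast
      then show False using prec_end[OF a b] cd by simp
    qed
  qed
  then show ?thesis by (auto simp: opairs_def pairs_def)
qed

text \<open>All pairs meet, and exchanging tails interchanges the two coordinates.\<close>

lemma X_same_row:
  assumes "fst c = fst d" "snd c < snd d"
  shows "X c * X d \<cong>\<^sub>t sc 1 * (X d * X c)"
proof -
  have "swap_ok c d" using assms by (simp add: swap_ok_def)
  moreover have "(fst c, snd d) = d" "(fst d, snd c) = c" using assms by (auto simp: prod_eq_iff)
  moreover have "opairs c d = pairs c d" "opairs d c = pairs d c" using opairs_all assms by auto
  ultimately show ?thesis
    using tail_swap_sum[of c d] assms unfolding X_mult[of c d] X_mult[of d c] by metis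
qed

lemma X_same_col:
  assumes "fst c < fst d" "snd c = snd d"
  shows "X c * X d \<cong>\<^sub>t sc 1 * (X d * X c)"
proof -
  have "swap_ok c d" using assms by (simp add: swap_ok_def)
  moreover have "(fst c, snd d) = c" "(fst d, snd c) = d" using assms by (auto simp: prod_eq_iff)
  moreover have "opairs c d = pairs c d" using opairs_all assms by auto
  ultimately show ?thesis
    using head_swap_sum[of c d] assms unfolding X_mult[of c d] X_mult_rev[of d c] by metis
qed

text \<open>Both exchanges lead to the meeting pairs of the diagonal coordinates \<open>?c\<close>
  and \<open>?d\<close>: tails from \<open>X c * X d\<close>, heads from \<open>X d * X c\<close>,
  with the same factor.\<close>

lemma X_antidiagonal:
  assumes "fst c < fst d" "snd d < snd c" "(fst d, snd c) \<le> rs"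
  shows "X d * X c \<cong>\<^sub>t X c * X d"
proof -
  let ?c = "(fst c, snd d)" and ?d = "(fst d, snd c)"
  have ok: "swap_ok ?c ?d" using assms by (simp add: swap_ok_def max_def)
  have all: "opairs c d = pairs c d" using opairs_all assms by simp
  have "sc 1 * (X c * X d) = sc 1 * (\<Sum>(a, b)\<in>opairs c d. wt a * wt b)" by (simp add: X_mult all)
  also have "\<dots> \<cong>\<^sub>t (\<Sum>(a, b)\<in>opairs ?c ?d. wt a * wt b)"
    using eqv_sym[OF tail_swap_sum[OF ok]] assms by simp
  also have "\<dots> \<cong>\<^sub>t sc 1 * (\<Sum>(a, b)\<in>opairs c d. wt b * wt a)"
    using head_swap_sum[OF ok] assms by simp
  also have "\<dots> = sc 1 * (X d * X c)" by (simp add: X_mult_rev[of d c] all)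
  finally have "sc (-1) * (sc 1 * (X c * X d)) \<cong>\<^sub>t sc (-1) * (sc 1 * (X d * X c))"
    by (rule eqv_mult[OF eqv_refl])
  then have "X c * X d \<cong>\<^sub>t X d * X c" by (simp add: sc_add_left)
  then show ?thesis by (rule eqv_sym)
qed

text \<open>Pairs that do not meet commute. On meeting pairs, exchanging tails turns
  \<open>X c * X d\<close> into \<open>q\<close> times the antidiagonal product, while exchanging
  heads turns \<open>X d * X c\<close> into \<open>inverse q\<close> times it; the difference is the
  correction term.\<close>

lemma X_diagonal:
  assumes cd: "fst c < fst d" "snd c < snd d"
  shows "d \<le> rs \<Longrightarrow> X d * X c \<cong>\<^sub>t X c * X d + const (inverse q - q) * (X (fst c, snd d) * X (fst d, snd c))"
    and "(\<And>a b. vpath c a \<Longrightarrow> vpath d b \<Longrightarrow> prec a b) \<Longrightarrow> X d * X c \<cong>\<^sub>t X c * X d"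
proof -
  let ?c = "(fst c, snd d)" and ?d = "(fst d, snd c)"
  let ?N = "pairs c d - opairs c d"
  have sub: "opairs c d \<subseteq> pairs c d" by (auto simp: opairs_def)
  have com: "(\<Sum>(a, b)\<in>?N. wt a * wt b) \<cong>\<^sub>t (\<Sum>(a, b)\<in>?N. wt b * wt a)"
  proof (rule eqv_sum)
    fix x assume x: "x \<in> ?N"
    obtain a b where ab: "x = (a, b)" by (cases x)
    have v: "vpath c a" "vpath d b" and no: "\<And>R. \<not> ovl a b R" using x by (auto simp: ab opairs_def pairs_def)
    show "(case x of (a, b) \<Rightarrow> wt a * wt b) \<cong>\<^sub>t (case x of (a, b) \<Rightarrow> wt b * wt a)"
      using wt_commute_prec[OF v cd(1) no_ovl_prec[OF v cd(1) no]] by (simp add: ab)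
  qed
  have split: "X c * X d = (\<Sum>(a, b)\<in>?N. wt a * wt b) + (\<Sum>(a, b)\<in>opairs c d. wt a * wt b)"
    "X d * X c = (\<Sum>(a, b)\<in>?N. wt b * wt a) + (\<Sum>(a, b)\<in>opairs c d. wt b * wt a)"
    unfolding X_mult[of c d] X_mult_rev[of d c] by (rule sum.subset_diff[OF sub finite_pairs(1)])+
  show "X d * X c \<cong>\<^sub>t X c * X d" if "\<And>a b. vpath c a \<Longrightarrow> vpath d b \<Longrightarrow> prec a b"
  proof -
    have "opairs c d = {}" using that prec_no_ovl by (fastforce simp: opairs_def pairs_def)
    then show ?thesis using split eqv_sym[OF com] by simp
  qed
  assume "d \<le> rs"
  then have ok: "swap_ok c d" using cd by (simp add: swap_ok_def max_def)
  have all: "opairs ?c ?d = pairs ?c ?d" using opairs_all[of ?c ?d] cd by simp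
  let ?P = "X ?c * X ?d"
  have 1: "(\<Sum>(a, b)\<in>opairs c d. wt a * wt b) \<cong>\<^sub>t sc 1 * ?P"
    using tail_swap_sum[OF ok cd(2)] by (simp add: X_mult all)
  have "?P \<cong>\<^sub>t sc 1 * (\<Sum>(a, b)\<in>opairs c d. wt b * wt a)"
    using head_swap_sum[OF swap_ok_swap[OF ok]] cd by (simp add: X_mult all)
  then have 2: "(\<Sum>(a, b)\<in>opairs c d. wt b * wt a) \<cong>\<^sub>t sc (-1) * ?P" by (rule eqv_scalar_swap)
  have "X d * X c \<cong>\<^sub>t (\<Sum>(a, b)\<in>?N. wt a * wt b) + sc (-1) * ?P"
    unfolding split(2) by (intro eqv_add 2 eqv_sym[OF com])
  also have "\<dots> = ((\<Sum>(a, b)\<in>?N. wt a * wt b) + sc 1 * ?P) + const (inverse q - q) * ?P"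
  proof -
    have "sc (-1) = sc 1 + const (inverse q - q)" unfolding sc_def by (simp add: const_add)
    then show ?thesis by (simp add: distrib_right add.assoc)
  qed
  also have "\<dots> \<cong>\<^sub>t X c * X d + const (inverse q - q) * ?P"
    unfolding split(1) by (intro eqv_add eqv_refl eqv_sym[OF 1])
  finally show "X d * X c \<cong>\<^sub>t X c * X d + const (inverse q - q) * ?P" .
qed

lemma vpath_straight:
  assumes b: "vpath d b" and "fst d \<le> k" and "\<not> (Suc k, snd d) \<le> rs"
  shows "b k = snd d"
proof (rule ccontr)
  assume ne: "b k \<noteq> snd d"
  then have "k < m" using vpath_end[OF b, of k] by (cases "k < m") auto
  then have "(Suc k, b k) \<le> rs"
    using ne vpath_turn_le[OF b, of m k] vpath_ge[OF b, of k] vpath_end[OF b, of m] vpath_after[OF b assms(2)] by simp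
  moreover have "(Suc k, snd d) \<le> (Suc k, b k)" using vpath_ge[OF b, of k] by (simp add: less_eq_prod_def)
  ultimately show False using assms(3) order_trans by blast
qed

text \<open>Since \<open>a\<close> ends left of \<open>d\<close>, a meeting would require a turn of
  \<open>a\<close> at a coordinate \<open>\<ge> d\<close>, beyond \<open>rs\<close>.\<close>

lemma late_prec:
  assumes a: "vpath c a" and b: "vpath d b" and "nw c d" "\<not> d \<le> rs"
  shows "prec a b"
  unfolding prec_def
proof (intro allI impI, rule ccontr)
  fix k assume k: "k < m" "\<not> (a k < b (Suc k) \<or> b (Suc k) = Suc n)"
  then have kd: "fst d \<le> Suc k" "fst c \<le> k"
    using vpath_eq_Suc_iff[OF b, of "Suc k"] assms(3) by (auto simp: nw_def)
  have "snd d \<le> a k" using vpath_ge[OF b, of "Suc k"] k by simp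
  then have "a m < a k" using vpath_end[OF a, of m] assms(3) by (simp add: nw_def)
  then have "(Suc k, a k) \<le> rs" using vpath_turn_le[OF a _ k(1)] vpath_after[OF a kd(2)] by blast
  moreover have "d \<le> (Suc k, a k)" using kd \<open>snd d \<le> a k\<close> by (auto simp: less_eq_prod_def)
  ultimately show False using assms(4) order_trans by blast
qed

text \<open>Without turns \<open>b\<close> drops straight down its column, and its weight telescopes
  to the single letter \<open>Pos d\<close>. The path \<open>a\<close> crosses row
  \<open>fst d\<close> entirely to the right of \<open>d\<close>; entering the row contributes 1 to
  the form, leaving it -1.\<close>

lemma X_antidiagonal_late:
  assumes cd: "fst c < fst d" "snd d < snd c" and "\<not> (fst d, snd c) \<le> rs"
  shows "X d * X c \<cong>\<^sub>t X c * X d"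
  unfolding X_mult[of d c] X_mult_rev[of c d]
proof (rule eqv_sum)
  fix x assume "x \<in> pairs d c"
  then obtain a b where x: "x = (b, a)" and a: "vpath c a" and b: "vpath d b" by (auto simp: pairs_def)
  have st: "b k = snd d" if "fst d \<le> k" for k
  proof (rule vpath_straight[OF b that])
    have "(fst d, snd c) \<le> (Suc k, snd d)" using that by (simp add: less_eq_prod_def)
    then show "\<not> (Suc k, snd d) \<le> rs" using assms(3) order_trans by blast
  qed
  have an: "a k \<le> n" if "fst c \<le> k" for k by (rule vpath_after[OF a that])
  have dn: "fst d \<le> m" "snd d \<le> n" "1 \<le> fst d" using vpath_range[OF b] by auto
  have tel: "form u (seg b k (Suc m)) = form u [Pos (k, snd d)]" if "k \<le> m" "fst d \<le> k" for u k
    using that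
  proof (induction rule: inc_induct)
    case base
    then show ?case using st[of m] dn by (simp add: seg_def lab_def)
  next
    case (step k)
    have "form u [Neg (Suc k, snd d)] = - form u [Pos (Suc k, snd d)]"
      by (induction u) (simp_all add: form_def letter_form_def)
    moreover have "lab k (b k) = [Pos (k, snd d)] @ [Neg (Suc k, snd d)]"
      using st[of k] step dn by (simp add: lab_def)
    moreover from this have "form u (seg b k (Suc m))
        = form u [Pos (k, snd d)] + (form u [Neg (Suc k, snd d)] + form u (seg b (Suc k) (Suc m)))"
      using seg_Cons[of k "Suc m" b] step by (simp only: form_append append_assoc)
    ultimately show ?case using step by simp
  qed
  have "seg b 0 (fst d) = []" unfolding seg_def using vpath_before[OF b] by auto
  then have wb: "seg b 0 (Suc m) = seg b (fst d) (Suc m)" using seg_append[of 0 "fst d" "Suc m" b] dn by simp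
  have "form (seg a 0 v) [Pos d] = (if v = fst d then 1 else 0)" if "v \<le> Suc m" for v
    using that
  proof (induction v)
    case (Suc v)
    have "snd d < a v" using vpath_ge[OF a, of v] cd by simp
    then have "form (lab v (a v)) [Pos d] = (if a v \<le> n then (if v = fst d then -1 else 0) +
        (if v < m \<and> Suc v = fst d then 1 else 0) else 0)"
      by (auto simp: form_def lab_def letter_form_def coord_form_def)
    moreover have "a v \<le> n" if "v = fst d \<or> Suc v = fst d" using an[of v] that cd by auto
    ultimately show ?case using Suc dn by (auto simp: seg_snoc form_append)
  qed (use dn in simp)
  then have "form (seg a 0 (Suc m)) (seg b 0 (Suc m)) = 0"
    unfolding wb using tel[of "fst d"] dn by simp
  then show "(case x of (a, b) \<Rightarrow> wt a * wt b) \<cong>\<^sub>t (case x of (a, b) \<Rightarrow> wt b * wt a)"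
    using eqv_sym[OF mon_commute[of "seg a 0 (Suc m)" "seg b 0 (Suc m)"]] by (simp add: wt_def x)
qed

text \<open>The common shape of all relations, fitted to the termination of sorting: both products
  on the right begin with a factor smaller than \<open>d\<close>.\<close>

lemma X_straighten:
  assumes "c \<in> coords m n" "d \<in> coords m n" "c < d"
  shows "\<exists>\<alpha> \<beta> c' d'. c' \<in> coords m n \<and> d' \<in> coords m n \<and> c' < d \<and>
    X d * X c \<cong>\<^sub>t const \<alpha> * (X c * X d) + const \<beta> * (X c' * X d')"
proof -
  have triv: ?thesis if "X d * X c \<cong>\<^sub>t const \<alpha> * (X c * X d)" for \<alpha>
    using that assms by (intro exI[of _ \<alpha>] exI[of _ 0] exI[of _ c] exI[of _ d]) simp
  have triv1: ?thesis if "X d * X c \<cong>\<^sub>t X c * X d" using triv[of 1] that by simp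
  have trivq: ?thesis if "X c * X d \<cong>\<^sub>t sc 1 * (X d * X c)"
    using triv[of "q powi (-1)"] eqv_scalar_swap[OF that] by (simp add: sc_def)
  consider "fst c = fst d" "snd c < snd d" | "fst c < fst d" "snd c = snd d"
    | "fst c < fst d" "snd d < snd c" | "fst c < fst d" "snd c < snd d"
    using \<open>c < d\<close> unfolding less_prod_def' by linarith
  then show ?thesis
  proof cases
    case 1 then show ?thesis by (intro trivq X_same_row)
  next
    case 2 then show ?thesis by (intro trivq X_same_col)
  next
    case 3 then show ?thesis using triv1 X_antidiagonal X_antidiagonal_late by blast
  next
    case 4
    show ?thesis
    proof (cases "d \<le> rs")
      case True
      have "X d * X c \<cong>\<^sub>t const 1 * (X c * X d) + const (inverse q - q) * (X (fst c, snd d) * X (fst d, snd c))"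
        using X_diagonal(1)[OF 4 True] by simp
      moreover have "(fst c, snd d) \<in> coords m n" "(fst d, snd c) \<in> coords m n"
        using assms(1,2) by (auto simp: coords_def)
      moreover have "(fst c, snd d) < d" using 4 by (simp add: less_prod_def')
      ultimately show ?thesis by blast
    next
      case False
      then show ?thesis using triv1 X_diagonal(2)[OF 4] late_prec 4 by (auto simp: nw_def)
    qed
  qed
qed

end

section \<open>Vanishing quantum minors\<close>

definition invs :: "nat \<Rightarrow> (nat \<Rightarrow> nat) \<Rightarrow> nat" where
  "invs K \<sigma> = card {(a, b). a < b \<and> b < K \<and> \<sigma> a > \<sigma> b}"

lemma invs_transpose:
  assumes "Suc l < K" "\<sigma> l < \<sigma> (Suc l)"
  shows "invs K (\<sigma> \<circ> transpose l (Suc l)) = Suc (invs K \<sigma>)"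
proof -
  let ?t = "transpose l (Suc l)"
  define S where "S = {(a, b). a < b \<and> b < K \<and> \<sigma> a > \<sigma> b}"
  have fin: "finite S" by (rule finite_subset[of _ "{..<K} \<times> {..<K}"]) (auto simp: S_def)
  have tK: "?t a < K \<longleftrightarrow> a < K" for a using assms(1) by (auto simp: transpose_def)
  have tless: "?t a < ?t b" if "a < b" "(a, b) \<noteq> (l, Suc l)" for a b
    using that by (auto simp: transpose_def)
  have "{(a, b). a < b \<and> b < K \<and> (\<sigma> \<circ> ?t) a > (\<sigma> \<circ> ?t) b} = insert (l, Suc l) (map_prod ?t ?t ` S)"
    (is "?S' = _")
  proof (intro Set.set_eqI iffI)
    fix x assume x: "x \<in> ?S'"
    then obtain a b where ab: "x = (a, b)" "a < b" "b < K" "\<sigma> (?t a) > \<sigma> (?t b)" by auto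
    show "x \<in> insert (l, Suc l) (map_prod ?t ?t ` S)"
    proof (cases "(a, b) = (l, Suc l)")
      case False
      then have "(?t a, ?t b) \<in> S" using ab tless[OF ab(2) False] tK by (auto simp: S_def)
      moreover have "x = map_prod ?t ?t (?t a, ?t b)" by (simp add: ab)
      ultimately show ?thesis by blast
    qed (use ab in simp)
  next
    fix x assume "x \<in> insert (l, Suc l) (map_prod ?t ?t ` S)"
    then consider "x = (l, Suc l)" | a b where "(a, b) \<in> S" "x = (?t a, ?t b)" by auto
    then show "x \<in> ?S'"
    proof cases
      case 2
      then have "(a, b) \<noteq> (l, Suc l)" using assms(2) by (auto simp: S_def)
      then show ?thesis using 2 tless[of a b] tK[of b] by (auto simp: S_def)
    qed (use assms in simp)
  qed
  moreover have "(l, Suc l) \<notin> map_prod ?t ?t ` S"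
  proof
    assume "(l, Suc l) \<in> map_prod ?t ?t ` S"
    then obtain a b where "(a, b) \<in> S" "?t a = l" "?t b = Suc l" by auto
    then have "a = Suc l" "b = l" by (metis transpose_involutory transpose_apply_first transpose_apply_second)+
    then show False using \<open>(a, b) \<in> S\<close> by (simp add: S_def)
  qed
  moreover have "card (map_prod ?t ?t ` S) = card S"
    by (intro card_image inj_onI) (auto dest: injD[OF inj_transpose])
  ultimately show ?thesis using fin by (simp add: invs_def S_def[symmetric])
qed

lemma permutes_increasing_id:
  assumes "\<sigma> permutes {..<K}" "\<And>l. Suc l < K \<Longrightarrow> \<sigma> l < \<sigma> (Suc l)"
  shows "\<sigma> = id"
proof -
  have "map \<sigma> [0..<K] = [0..<K]"
  proof (rule sorted_distinct_set_unique)
    show "sorted (map \<sigma> [0..<K])" using assms(2) by (auto simp: sorted_iff_nth_Suc less_imp_le)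
    show "distinct (map \<sigma> [0..<K])" using permutes_inj_on[OF assms(1)] by (simp add: distinct_map)
    show "set (map \<sigma> [0..<K]) = set [0..<K]" using permutes_image[OF assms(1)] by (simp add: lessThan_atLeast0)
  qed simp_all
  then have "\<sigma> l = l" if "l < K" for l using that by (metis add_0 diff_zero length_upt nth_map nth_upt)
  then show ?thesis using assms(1) by (auto simp: fun_eq_iff permutes_def)
qed

context cauchon_torus
begin

definition first_meet :: "nat \<Rightarrow> (nat \<Rightarrow> nat \<Rightarrow> nat) \<Rightarrow> nat \<times> nat \<Rightarrow> bool" where
  "first_meet K F = (\<lambda>(h, l). Suc l < K \<and> ovl (F l) (F (Suc l)) h \<and>
    (\<forall>l' R. Suc l' < K \<longrightarrow> R < h \<longrightarrow> \<not> ovl (F l') (F (Suc l')) R) \<and>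
    (\<forall>l'. l < l' \<longrightarrow> Suc l' < K \<longrightarrow> \<not> ovl (F l') (F (Suc l')) h))"

text \<open>A pair is selected by its first meeting row but exchanged at its last one, where
  \<open>tail_swap_less\<close> applies. The rows above the selected one are thereby untouched,
  which makes the selection reproducible.\<close>

definition flip :: "nat \<Rightarrow> (nat \<Rightarrow> nat \<Rightarrow> nat) \<Rightarrow> nat \<Rightarrow> nat \<Rightarrow> nat" where
  "flip l F = (let R = Max {R. ovl (F l) (F (Suc l)) R} in
    F(l := swap R (F l) (F (Suc l)), Suc l := swap R (F (Suc l)) (F l)))"

lemma first_meet_unique:
  assumes "first_meet K F x" "first_meet K F y"
  shows "x = y"
proof -
  obtain h l h' l' where xy: "x = (h, l)" "y = (h', l')" by (cases x, cases y)
  have "h = h'" using assms unfolding xy first_meet_def split by (metis linorder_neqE_nat)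
  moreover have "l = l'" using assms \<open>h = h'\<close> unfolding xy first_meet_def split by (metis linorder_neqE_nat)
  ultimately show ?thesis by (simp add: xy)
qed

lemma first_meet_exists:
  assumes "Suc l < K" "ovl (F l) (F (Suc l)) R"
  shows "\<exists>x. first_meet K F x"
proof -
  define h where "h = (LEAST h. \<exists>l. Suc l < K \<and> ovl (F l) (F (Suc l)) h)"
  have ex: "\<exists>h l. Suc l < K \<and> ovl (F l) (F (Suc l)) h" using assms by blast
  have h: "\<exists>l. Suc l < K \<and> ovl (F l) (F (Suc l)) h" unfolding h_def by (rule LeastI_ex[OF ex])
  define A where "A = {l. Suc l < K \<and> ovl (F l) (F (Suc l)) h}"
  have A: "finite A" "A \<noteq> {}" using h by (auto simp: A_def intro: finite_subset[of _ "{..<K}"])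
  have "first_meet K F (h, Max A)"
    unfolding first_meet_def split
  proof (intro conjI allI impI)
    show "Suc (Max A) < K" "ovl (F (Max A)) (F (Suc (Max A))) h" using Max_in[OF A] by (auto simp: A_def)
    show "\<not> ovl (F l') (F (Suc l')) R" if "Suc l' < K" "R < h" for l' R
      using not_less_Least[of R "\<lambda>h. \<exists>l. Suc l < K \<and> ovl (F l) (F (Suc l)) h"] that unfolding h_def by blast
    show "\<not> ovl (F l') (F (Suc l')) h" if "Max A < l'" "Suc l' < K" for l'
      using Max_ge[OF A(1), of l'] that by (auto simp: A_def)
  qed
  then show ?thesis ..
qed

definition configs :: "nat list \<Rightarrow> nat list \<Rightarrow> ((nat \<Rightarrow> nat) \<times> (nat \<Rightarrow> nat \<Rightarrow> nat)) set" where
  "configs is js = Sigma {\<sigma>. \<sigma> permutes {..<length is}}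
    (\<lambda>\<sigma>. PiE {..<length is} (\<lambda>l. {a. vpath (is ! l, js ! \<sigma> l) a}))"

lemma flip_config:
  assumes len: "length js = length is" and sorted: "sorted_wrt (<) is" "sorted_wrt (<) js"
    and bound: "(last is, last js) \<le> rs"
    and x: "(\<sigma>, F) \<in> configs is js" and f: "first_meet (length is) F (h, l)"
  shows "(\<sigma> \<circ> transpose l (Suc l), flip l F) \<in> configs is js"
    and "first_meet (length is) (flip l F) (h, l)"
    and "flip l (flip l F) = F"
proof -
  define K where "K = length is"
  have l: "Suc l < K" using f by (simp add: first_meet_def K_def)
  have perm: "\<sigma> permutes {..<K}" and F: "F \<in> PiE {..<K} (\<lambda>l. {a. vpath (is ! l, js ! \<sigma> l) a})"
    using x by (auto simp: configs_def K_def)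
  have v: "vpath (is ! k, js ! \<sigma> k) (F k)" if "k < K" for k using F that by (auto simp: PiE_iff)
  have sK: "\<sigma> k < K" if "k < K" for k using permutes_in_image[OF perm, of k] that by simp
  have isl: "is ! k < is ! k'" if "k < k'" "k' < K" for k k'
    using sorted_wrt_nth_less[OF sorted(1)] that by (simp add: K_def)
  have lasts: "last is = is ! (K - 1)" "last js = js ! (K - 1)"
    using l len by (auto simp: K_def last_conv_nth simp flip: length_greater_0_conv)
  have le_last: "xs ! k \<le> xs ! (K - 1)" if "sorted_wrt (<) xs" "length xs = K" "k < K" for xs :: "nat list" and k
  proof (cases "k = K - 1")
    case False
    then have "k < K - 1" using that by linarith
    then show ?thesis using sorted_wrt_nth_less[OF that(1), of k "K - 1"] that by simp
  qed simp
  have isle: "is ! k \<le> last is" and jsle: "js ! k \<le> last js" if "k < K" for k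
    unfolding lasts using le_last[OF sorted(1)] le_last[OF sorted(2)] that len by (simp_all add: K_def)
  define R where "R = Max {R. ovl (F l) (F (Suc l)) R}"
  have oh: "ovl (F l) (F (Suc l)) h" using f by (simp add: first_meet_def)
  have oR: "ovl (F l) (F (Suc l)) R"
    using Max_in[OF finite_ovl, of "F l" "F (Suc l)"] oh unfolding R_def by blast
  have hR: "h \<le> R" unfolding R_def using oh finite_ovl by (intro Max_ge) auto
  have va: "vpath (is ! l, js ! \<sigma> l) (F l)" and vb: "vpath (is ! Suc l, js ! \<sigma> (Suc l)) (F (Suc l))"
    using v[of l] v[of "Suc l"] l by simp_all
  \<comment> \<open>The maximum coordinate of the minor bounds the turn that the exchange may
    create.\<close>
  have "(is ! Suc l, max (js ! \<sigma> l) (js ! \<sigma> (Suc l))) \<le> (last is, last js)"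
    using isle[of "Suc l"] jsle[OF sK, of l] jsle[OF sK, of "Suc l"] l by (simp add: less_eq_prod_def)
  then have "(is ! Suc l, max (js ! \<sigma> l) (js ! \<sigma> (Suc l))) \<le> rs" using bound by (rule order_trans)
  then have vs: "vpath (is ! l, js ! \<sigma> (Suc l)) (swap R (F l) (F (Suc l)))"
    "vpath (is ! Suc l, js ! \<sigma> l) (swap R (F (Suc l)) (F l))"
    using vpath_swap_tails[OF va vb oR] isl[of l "Suc l"] l by simp_all
  have flip: "flip l F = F(l := swap R (F l) (F (Suc l)), Suc l := swap R (F (Suc l)) (F l))"
    by (simp add: flip_def R_def Let_def)
  have fl: "flip l F l = swap R (F l) (F (Suc l))" "flip l F (Suc l) = swap R (F (Suc l)) (F l)"
    "\<And>k. k \<noteq> l \<Longrightarrow> k \<noteq> Suc l \<Longrightarrow> flip l F k = F k" by (auto simp: flip)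
  have perm': "\<sigma> \<circ> transpose l (Suc l) permutes {..<K}"
    using l by (intro permutes_compose[OF permutes_swap_id perm]) auto
  have "vpath (is ! k, js ! (\<sigma> \<circ> transpose l (Suc l)) k) (flip l F k)" if "k < K" for k
    using vs v[OF that] fl(3)[of k] by (cases "k = l"; cases "k = Suc l") (auto simp: fl transpose_def)
  moreover have "flip l F k = undefined" if "\<not> k < K" for k
    using F that l by (auto simp: flip PiE_iff extensional_def)
  ultimately show "(\<sigma> \<circ> transpose l (Suc l), flip l F) \<in> configs is js"
    using perm' by (auto simp: configs_def K_def PiE_iff extensional_def)
  have same: "{k. ovl (flip l F l) (flip l F (Suc l)) k} = {k. ovl (F l) (F (Suc l)) k}"
    unfolding fl by (rule ovl_swap_set[OF va vb oR])
  have "flip l (flip l F) = (flip l F)(l := swap R (flip l F l) (flip l F (Suc l)), Suc l := swap R (flip l F (Suc l)) (flip l F l))"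
    unfolding flip_def[of l "flip l F"] Let_def same R_def ..
  then show "flip l (flip l F) = F" by (auto simp: fl fun_eq_iff flip)
  have before: "\<not> ovl (F l') (F (Suc l')) k" if "Suc l' < K" "k < h" for l' k
    using f that by (simp add: first_meet_def K_def)
  have flow: "flip l F k i = F k i" if "i < h" for k i
    using that hR by (auto simp: flip swap_def)
  have "\<not> ovl (flip l F l') (flip l F (Suc l')) k" if "Suc l' < K" "k < h" for l' k
    using before[OF that] that by (simp add: ovl_def flow)
  moreover have "\<not> ovl (flip l F l') (flip l F (Suc l')) h" if l': "l < l'" "Suc l' < K" for l'
  proof (cases "l' = Suc l")
    case False
    then show ?thesis using f l' by (simp add: fl first_meet_def K_def)
  next
    case True
    \<comment> \<open>The pair after the selected one shares an exchanged path. Whether it meets in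
      row \<open>h\<close> depends on the column in which its left path leaves row
      \<open>h - 1\<close>, which is unchanged. As \<open>l\<close> was the last meeting pair in row
      \<open>h\<close>, that column is left of the right path.\<close>
    have no: "\<not> ovl (F l') (F (Suc l')) k" if "k < Suc h" for k
      using f l' before[of l' k] that by (auto simp: first_meet_def K_def less_Suc_eq)
    have h0: "0 < h" "h \<le> m" using oh by (auto simp: ovl_def)
    have "F l' (h - 1) < F (Suc l') (Suc (h - 1)) \<or> F (Suc l') (Suc (h - 1)) = Suc n"
      by (rule no_ovl_lt[OF v v _ no]) (use l' h0 isl in auto)
    then show ?thesis using h0 flow[of "h - 1" l'] True fl(3)[of "Suc l'"] by (auto simp: ovl_def)
  qed
  moreover have "ovl (flip l F l) (flip l F (Suc l)) h" using same oh by blast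
  ultimately show "first_meet (length is) (flip l F) (h, l)"
    using l by (simp add: first_meet_def K_def)
qed

text \<open>If no neighbours met, their ends would increase, so the permutation would be the
  identity and the paths a system.\<close>

lemma config_meet:
  assumes len: "length js = length is" and sorted: "sorted_wrt (<) is" "sorted_wrt (<) js"
    and none: "\<nexists>Q. system (rev (zip is js)) Q" and x: "(\<sigma>, F) \<in> configs is js"
  shows "\<exists>y. first_meet (length is) F y"
proof (rule ccontr)
  assume no: "\<nexists>y. first_meet (length is) F y"
  define K where "K = length is"
  have perm: "\<sigma> permutes {..<K}" and v: "\<And>k. k < K \<Longrightarrow> vpath (is ! k, js ! \<sigma> k) (F k)"
    using x by (auto simp: configs_def K_def PiE_iff)
  have prec: "prec (F l) (F (Suc l))" if l: "Suc l < K" for l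
  proof (rule no_ovl_prec[OF v v])
    show "fst (is ! l, js ! \<sigma> l) < fst (is ! Suc l, js ! \<sigma> (Suc l))"
      using sorted_wrt_nth_less[OF sorted(1)] l by (simp add: K_def)
    show "\<not> ovl (F l) (F (Suc l)) k" for k using no first_meet_exists l unfolding K_def by blast
  qed (use l in auto)
  have "\<sigma> l < \<sigma> (Suc l)" if l: "Suc l < K" for l
  proof (rule ccontr)
    assume "\<not> \<sigma> l < \<sigma> (Suc l)"
    moreover have "js ! \<sigma> l < js ! \<sigma> (Suc l)" using prec_end[OF v v prec[OF l]] l by simp
    moreover have "\<sigma> l < K" using permutes_in_image[OF perm, of l] l by simp
    ultimately show False
      using sorted_wrt_nth_less[OF sorted(2), of "\<sigma> (Suc l)" "\<sigma> l"] len by (cases "\<sigma> l = \<sigma> (Suc l)") (auto simp: K_def)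
  qed
  then have id: "\<sigma> = id" by (rule permutes_increasing_id[OF perm])
  have "system (rev (zip is js)) (rev (map F [0..<K]))"
    unfolding system_def
  proof (intro conjI allI impI)
    show "list_all2 vpath (rev (zip is js)) (rev (map F [0..<K]))"
      unfolding list_all2_rev using v len by (simp add: list_all2_conv_all_nth K_def id)
    fix l assume l: "Suc l < length (rev (map F [0..<K]))"
    then have "Suc (K - Suc (Suc l)) = K - Suc l" by simp
    then show "prec (rev (map F [0..<K]) ! Suc l) (rev (map F [0..<K]) ! l)"
      using prec[of "K - Suc (Suc l)"] l by (simp add: rev_nth)
  qed
  then show False using none by blast
qed

definition config_wt :: "nat \<Rightarrow> (nat \<Rightarrow> nat) \<times> (nat \<Rightarrow> nat \<Rightarrow> nat) \<Rightarrow> torus_letter word \<Rightarrow>\<^sub>0 'k" where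
  "config_wt K = (\<lambda>(\<sigma>, F). const ((- q) ^ invs K \<sigma>) * prod_list (map (\<lambda>l. wt (F l)) [0..<K]))"

text \<open>Undoing the exchange costs a factor \<open>q\<close>, whereas the additional inversion
  carries the factor \<open>- q\<close>.\<close>

lemma flip_weight:
  assumes x: "(\<sigma>, F) \<in> configs is js" and l: "Suc l < length is" "ovl (F l) (F (Suc l)) h"
    and less: "js ! \<sigma> l < js ! \<sigma> (Suc l)" "\<sigma> l < \<sigma> (Suc l)"
  shows "config_wt (length is) (\<sigma>, F) + config_wt (length is) (\<sigma> \<circ> transpose l (Suc l), flip l F) \<cong>\<^sub>t 0"
proof -
  define K where "K = length is"
  have v: "\<And>k. k < K \<Longrightarrow> vpath (is ! k, js ! \<sigma> k) (F k)"
    using x by (auto simp: configs_def K_def PiE_iff)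
  define R where "R = Max {R. ovl (F l) (F (Suc l)) R}"
  have oR: "ovl (F l) (F (Suc l)) R"
    using Max_in[OF finite_ovl, of "F l" "F (Suc l)"] l(2) unfolding R_def by blast
  have last: "\<not> ovl (F l) (F (Suc l)) k" if "R < k" for k
    using Max_ge[OF finite_ovl, of k "F l" "F (Suc l)"] that unfolding R_def by fastforce
  have split: "[0..<K] = [0..<l] @ [l, Suc l] @ [Suc (Suc l)..<K]"
  proof -
    have "[0..<K] = [0..<l] @ [l..<K]" using upt_add_eq_append[of 0 l "K - l"] l by (simp add: K_def)
    also have "[l..<K] = l # Suc l # [Suc (Suc l)..<K]" using l by (simp add: upt_conv_Cons K_def)
    finally show ?thesis by simp
  qed
  let ?pre = "prod_list (map (\<lambda>l. wt (F l)) [0..<l])" and ?post = "prod_list (map (\<lambda>l. wt (F l)) [Suc (Suc l)..<K])"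
  have P: "prod_list (map (\<lambda>l. wt (F l)) [0..<K]) = ?pre * ((wt (F l) * wt (F (Suc l))) * ?post)"
    unfolding split by (simp add: mult.assoc)
  have pre: "map (\<lambda>k. wt (flip l F k)) [0..<l] = map (\<lambda>k. wt (F k)) [0..<l]"
    and post: "map (\<lambda>k. wt (flip l F k)) [Suc (Suc l)..<K] = map (\<lambda>k. wt (F k)) [Suc (Suc l)..<K]"
    by (auto simp: flip_def Let_def)
  define P' where "P' = ?pre * ((wt (swap R (F l) (F (Suc l))) * wt (swap R (F (Suc l)) (F l))) * ?post)"
  have P': "prod_list (map (\<lambda>k. wt (flip l F k)) [0..<K]) = P'"
  proof -
    have "flip l F l = swap R (F l) (F (Suc l))" "flip l F (Suc l) = swap R (F (Suc l)) (F l)"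
      by (simp_all add: flip_def R_def Let_def)
    then show ?thesis unfolding split map_append prod_list.append pre post P'_def by (simp add: mult.assoc)
  qed
  have "wt (F l) * wt (F (Suc l)) \<cong>\<^sub>t sc 1 * (wt (swap R (F l) (F (Suc l))) * wt (swap R (F (Suc l)) (F l)))"
    by (rule tail_swap_less[OF v v oR last]) (use l less in \<open>auto simp: K_def\<close>)
  then have "prod_list (map (\<lambda>l. wt (F l)) [0..<K])
      \<cong>\<^sub>t ?pre * ((sc 1 * (wt (swap R (F l) (F (Suc l))) * wt (swap R (F (Suc l)) (F l)))) * ?post)"
    unfolding P by (rule eqv_mult[OF eqv_refl eqv_mult[OF _ eqv_refl]])
  also have "\<dots> = sc 1 * P'" unfolding P'_def mult.assoc by (rule sc_pull)
  finally have e: "prod_list (map (\<lambda>l. wt (F l)) [0..<K]) \<cong>\<^sub>t sc 1 * P'" .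
  define i where "i = invs K \<sigma>"
  have i': "invs K (\<sigma> \<circ> transpose l (Suc l)) = Suc i" using invs_transpose[of l K \<sigma>] l less by (simp add: K_def i_def)
  have "config_wt K (\<sigma>, F) + config_wt K (\<sigma> \<circ> transpose l (Suc l), flip l F)
      \<cong>\<^sub>t const ((- q) ^ i) * (sc 1 * P') + const ((- q) ^ Suc i) * P'"
    unfolding config_wt_def prod.case i' P' i_def[symmetric] by (intro eqv_add eqv_mult e eqv_refl)
  also have "const ((- q) ^ i) * (sc 1 * P') + const ((- q) ^ Suc i) * P'
      = const ((- q) ^ i * q + (- q) ^ Suc i) * P'"
    by (simp add: sc_def const_mult mult.assoc[symmetric] distrib_right[symmetric] const_add)
  also have "\<dots> = 0" by (simp add: mult.commute)
  finally show ?thesis by (simp add: K_def)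
qed

text \<open>
  The involution exchanges the tails, after their last meeting, of the pair of consecutive paths
  that meet in the highest possible row, the last such pair being taken.
\<close>

lemma minor_vanishes:
  assumes len: "length js = length is" and sorted: "sorted_wrt (<) is" "sorted_wrt (<) js"
    and bound: "(last is, last js) \<le> rs" and none: "\<nexists>Q. system (rev (zip is js)) Q"
  shows "(\<Sum>\<sigma>\<in>{\<sigma>. \<sigma> permutes {..<length is}}. const ((- q) ^ invs (length is) \<sigma>) *
    prod_list (map (\<lambda>l. X (is ! l, js ! \<sigma> l)) [0..<length is])) \<cong>\<^sub>t 0"
proof -
  define K where "K = length is"
  define lof where "lof F = snd (SOME y. first_meet K F y)" for F
  define \<tau> where "\<tau> = (\<lambda>(\<sigma> :: nat \<Rightarrow> nat, F). (\<sigma> \<circ> transpose (lof F) (Suc (lof F)), flip (lof F) F))"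
  define \<Omega> where "\<Omega> = configs is js"
  \<comment> \<open>One half of the involution: the configurations whose exchange creates an
    inversion.\<close>
  define \<Omega>1 where "\<Omega>1 = {(\<sigma>, F) \<in> \<Omega>. \<sigma> (lof F) < \<sigma> (Suc (lof F))}"
  have fin: "finite \<Omega>"
    unfolding \<Omega>_def configs_def using finite_vpaths by (intro finite_SigmaI finite_permutations finite_PiE) auto
  have lof: "lof F = l" if "first_meet K F (h, l)" for F h l
    using someI[of "first_meet K F", OF that] first_meet_unique[OF that] unfolding lof_def by (metis snd_conv)
  have meet: "\<exists>h. first_meet K F (h, lof F)" if x: "(\<sigma>, F) \<in> \<Omega>" for \<sigma> F
  proof -
    obtain y where y: "first_meet K F y"
      using config_meet[OF len sorted none x[unfolded \<Omega>_def]] unfolding K_def by blast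
    then have f: "first_meet K F (fst y, snd y)" by simp
    then have "first_meet K F (fst y, lof F)" by (simp only: lof[OF f])
    then show ?thesis ..
  qed
  have tau: "\<tau> x \<in> \<Omega>" "\<tau> (\<tau> x) = x" "\<tau> x \<in> \<Omega>1 \<longleftrightarrow> x \<notin> \<Omega>1" if x: "x \<in> \<Omega>" for x
  proof -
    obtain \<sigma> F where xx: "x = (\<sigma>, F)" by (cases x)
    obtain h where h: "first_meet K F (h, lof F)" using meet x xx by blast
    note f = flip_config[OF len sorted bound x[unfolded xx \<Omega>_def] h[unfolded K_def], folded K_def]
    have l': "lof (flip (lof F) F) = lof F" by (rule lof[OF f(2)])
    show 1: "\<tau> x \<in> \<Omega>" using f(1) by (simp add: \<tau>_def xx \<Omega>_def)
    show "\<tau> (\<tau> x) = x" using f(3) by (simp add: \<tau>_def xx l' comp_assoc)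
    have "\<sigma> permutes {..<K}" using x by (auto simp: xx \<Omega>_def configs_def K_def)
    then have "\<sigma> (lof F) \<noteq> \<sigma> (Suc (lof F))" by (simp add: inj_eq[OF permutes_inj])
    then show "\<tau> x \<in> \<Omega>1 \<longleftrightarrow> x \<notin> \<Omega>1" using 1 x by (auto simp: \<tau>_def xx l' \<Omega>1_def)
  qed
  have "(\<Sum>\<sigma>\<in>{\<sigma>. \<sigma> permutes {..<K}}. const ((- q) ^ invs K \<sigma>) *
      prod_list (map (\<lambda>l. X (is ! l, js ! \<sigma> l)) [0..<K])) = (\<Sum>x\<in>\<Omega>. config_wt K x)"
  proof -
    have "const ((- q) ^ invs K \<sigma>) * prod_list (map (\<lambda>l. X (is ! l, js ! \<sigma> l)) [0..<K])
        = (\<Sum>F\<in>PiE {..<K} (\<lambda>l. {a. vpath (is ! l, js ! \<sigma> l) a}). config_wt K (\<sigma>, F))" for \<sigma>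
      unfolding X_def config_wt_def using prod_list_sum_distrib[of K "\<lambda>l. {a. vpath (is ! l, js ! \<sigma> l) a}" "\<lambda>_. wt"]
      by (simp add: finite_vpaths sum_distrib_left)
    moreover have "(\<Sum>\<sigma>\<in>{\<sigma>. \<sigma> permutes {..<K}}.
        \<Sum>F\<in>PiE {..<K} (\<lambda>l. {a. vpath (is ! l, js ! \<sigma> l) a}). config_wt K (\<sigma>, F))
        = (\<Sum>(\<sigma>, F)\<in>\<Omega>. config_wt K (\<sigma>, F))"
      unfolding \<Omega>_def configs_def K_def[symmetric]
      by (rule sum.Sigma) (auto intro!: finite_permutations finite_PiE finite_vpaths)
    ultimately show ?thesis by simp
  qed
  also have "\<dots> = (\<Sum>x\<in>\<Omega> - \<Omega>1. config_wt K x) + (\<Sum>x\<in>\<Omega>1. config_wt K x)"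
    by (rule sum.subset_diff[OF _ fin]) (auto simp: \<Omega>1_def)
  also have "(\<Sum>x\<in>\<Omega> - \<Omega>1. config_wt K x) = (\<Sum>x\<in>\<Omega>1. config_wt K (\<tau> x))"
  proof (rule sum.reindex_bij_witness[of _ \<tau> \<tau>])
    fix x assume "x \<in> \<Omega> - \<Omega>1"
    then show "\<tau> (\<tau> x) = x" "\<tau> x \<in> \<Omega>1" "config_wt K (\<tau> (\<tau> x)) = config_wt K x" using tau[of x] by auto
  next
    fix x assume x: "x \<in> \<Omega>1"
    then have "x \<in> \<Omega>" by (auto simp: \<Omega>1_def)
    then show "\<tau> (\<tau> x) = x" "\<tau> x \<in> \<Omega> - \<Omega>1" using tau[of x] x by auto
  qed
  also have "(\<Sum>x\<in>\<Omega>1. config_wt K (\<tau> x)) + (\<Sum>x\<in>\<Omega>1. config_wt K x) = (\<Sum>x\<in>\<Omega>1. config_wt K x + config_wt K (\<tau> x))"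
    by (simp add: sum.distrib add.commute)
  also have "\<dots> \<cong>\<^sub>t (\<Sum>x\<in>\<Omega>1. 0)"
  proof (rule eqv_sum)
    fix x assume x: "x \<in> \<Omega>1"
    obtain \<sigma> F where xx: "x = (\<sigma>, F)" by (cases x)
    have xO: "(\<sigma>, F) \<in> \<Omega>" and less: "\<sigma> (lof F) < \<sigma> (Suc (lof F))" using x by (auto simp: xx \<Omega>1_def)
    obtain h where h: "first_meet K F (h, lof F)" using meet xO by blast
    have perm: "\<sigma> permutes {..<K}" using xO by (auto simp: \<Omega>_def configs_def K_def)
    have l: "Suc (lof F) < length is" "ovl (F (lof F)) (F (Suc (lof F))) h"
      using h by (auto simp: first_meet_def K_def)
    have "\<sigma> (Suc (lof F)) < length js" using permutes_in_image[OF perm, of "Suc (lof F)"] l len by (simp add: K_def)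
    then have "js ! \<sigma> (lof F) < js ! \<sigma> (Suc (lof F))" using sorted_wrt_nth_less[OF sorted(2) less] by simp
    from flip_weight[OF xO[unfolded \<Omega>_def] l this less]
    show "config_wt K x + config_wt K (\<tau> x) \<cong>\<^sub>t 0" by (simp add: xx \<tau>_def K_def)
  qed
  finally show ?thesis by (simp add: K_def)
qed

end

section \<open>Coefficients of torus monomials\<close>

definition expo :: "torus_letter list \<Rightarrow> nat \<times> nat \<Rightarrow> int" where
  "expo u c = (\<Sum>x\<leftarrow>u. if letter_coord x = c then letter_sign x else 0)"

text \<open>The power of \<open>q\<close> arising when ordered words \<open>u\<close> and
  \<open>v\<close> are merged: every pair of letters in the wrong order is transposed once.\<close>

definition disorder :: "torus_letter list \<Rightarrow> torus_letter list \<Rightarrow> int" where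
  "disorder u v = (\<Sum>x\<leftarrow>u. \<Sum>y\<leftarrow>v. if letter_coord y < letter_coord x then letter_form x y else 0)"

text \<open>A word \<open>u\<close> equals \<open>q ^ normal_exp u\<close> times the ordered monomial with exponents \<open>expo u\<close>.\<close>

fun normal_exp :: "torus_letter list \<Rightarrow> int" where
  "normal_exp [] = 0"
| "normal_exp (x # u) = disorder [x] u + normal_exp u"

lemma expo_append: "expo (u @ v) c = expo u c + expo v c"
  by (simp add: expo_def)

lemma expo_plus_iff:
  "expo (letters (u + v)) = e \<longleftrightarrow> expo (letters v) = (\<lambda>c. e c - expo (letters u) c)"
  "expo (letters (u + v)) = e \<longleftrightarrow> expo (letters u) = (\<lambda>c. e c - expo (letters v) c)"
proof -
  have "expo (letters (u + v)) c = e c \<longleftrightarrow> expo (letters v) c = e c - expo (letters u) c"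
    "expo (letters (u + v)) c = e c \<longleftrightarrow> expo (letters u) c = e c - expo (letters v) c" for c
    by (auto simp: plus_word_def expo_append)
  then show "expo (letters (u + v)) = e \<longleftrightarrow> expo (letters v) = (\<lambda>c. e c - expo (letters u) c)"
    "expo (letters (u + v)) = e \<longleftrightarrow> expo (letters u) = (\<lambda>c. e c - expo (letters v) c)"
    by (simp_all only: fun_eq_iff)
qed

lemma disorder_append: "disorder (u @ u') v = disorder u v + disorder u' v"
  "disorder u (v @ v') = disorder u v + disorder u v'"
  by (simp_all add: disorder_def sum_list_addf)

lemma normal_exp_append: "normal_exp (u @ v) = normal_exp u + normal_exp v + disorder u v"
proof (induction u)
  case (Cons x u)
  then show ?case using disorder_append(1)[of "[x]" u v] disorder_append(2)[of "[x]" u v] by simp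
qed (simp add: disorder_def)

lemma sum_list_by_coord:
  assumes "finite S" "letter_coord ` set u \<subseteq> S"
  shows "(\<Sum>x\<leftarrow>u. letter_sign x * g (letter_coord x)) = (\<Sum>c\<in>S. expo u c * g c)"
  using assms(2)
proof (induction u)
  case (Cons x u)
  then have "(\<Sum>c\<in>S. expo (x # u) c * g c)
      = (\<Sum>c\<in>S. (if letter_coord x = c then letter_sign x * g c else 0)) + (\<Sum>c\<in>S. expo u c * g c)"
    unfolding sum.distrib[symmetric] by (intro sum.cong refl) (simp add: expo_def distrib_right)
  then show ?case using Cons assms(1) by (simp add: sum.delta')
qed (simp add: expo_def)

text \<open>Collecting the sum by coordinates shows that only exponents matter. This makes the
  functionals \<open>coef\<close> compatible with multiplication.\<close>

lemma disorder_cong_left: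
  assumes "expo u = expo u'"
  shows "disorder u v = disorder u' v"
proof -
  define g where "g c = (\<Sum>y\<leftarrow>v. if letter_coord y < c then letter_sign y * coord_form c (letter_coord y) else 0)" for c
  have d: "disorder w v = (\<Sum>x\<leftarrow>w. letter_sign x * g (letter_coord x))" for w
    unfolding disorder_def g_def sum_list_const_mult[symmetric]
    by (intro arg_cong[where f = sum_list] map_cong refl) (simp add: letter_form_def)
  let ?S = "letter_coord ` set (u @ u')"
  have S: "finite ?S" "letter_coord ` set u \<subseteq> ?S" "letter_coord ` set u' \<subseteq> ?S" by auto
  show ?thesis
    unfolding d sum_list_by_coord[OF S(1,2)] sum_list_by_coord[OF S(1,3)] assms ..
qed

lemma disorder_cong_right:
  assumes "expo v = expo v'"
  shows "disorder u v = disorder u v'"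
proof -
  define g where "g x d = (if d < letter_coord x then letter_sign x * coord_form (letter_coord x) d else 0)" for x d
  have d: "disorder u w = (\<Sum>x\<leftarrow>u. \<Sum>y\<leftarrow>w. letter_sign y * g x (letter_coord y))" for w
    unfolding disorder_def g_def
    by (intro arg_cong[where f = sum_list] map_cong refl) (simp add: letter_form_def)
  let ?S = "letter_coord ` set (v @ v')"
  have S: "finite ?S" "letter_coord ` set v \<subseteq> ?S" "letter_coord ` set v' \<subseteq> ?S" by auto
  show ?thesis
    unfolding d sum_list_by_coord[OF S(1,2)] sum_list_by_coord[OF S(1,3)] assms ..
qed

context quantum_torus
begin

definition val :: "(nat \<times> nat \<Rightarrow> int) \<Rightarrow> torus_letter word \<Rightarrow> 'k" where
  "val e w = (if expo (letters w) = e then q powi normal_exp (letters w) else 0)"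

text \<open>The coefficient of the ordered monomial with exponents \<open>e\<close>, defined on the
  free algebra. That it annihilates the ideal (\<open>coef_torus_ideal\<close>) takes the place of a
  basis theorem for the torus.\<close>

definition coef :: "(nat \<times> nat \<Rightarrow> int) \<Rightarrow> (torus_letter word \<Rightarrow>\<^sub>0 'k) \<Rightarrow> 'k" where
  "coef e f = (\<Sum>w\<in>Poly_Mapping.keys f. Poly_Mapping.lookup f w * val e w)"

lemma coef_superset:
  "finite S \<Longrightarrow> Poly_Mapping.keys f \<subseteq> S \<Longrightarrow> coef e f = (\<Sum>w\<in>S. Poly_Mapping.lookup f w * val e w)"
  unfolding coef_def by (rule sum.mono_neutral_left) (auto simp: in_keys_iff)

lemma coef_add: "coef e (f + g) = coef e f + coef e g"
proof -
  let ?S = "Poly_Mapping.keys f \<union> Poly_Mapping.keys g"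
  show ?thesis
    using coef_superset[of ?S f e] coef_superset[of ?S g e] coef_superset[of ?S "f + g" e] Poly_Mapping.keys_add[of f g]
    by (simp add: lookup_add distrib_right sum.distrib)
qed

lemma coef_0 [simp]: "coef e 0 = 0" by (simp add: coef_def)

lemma coef_sum: "coef e (\<Sum>x\<in>A. f x) = (\<Sum>x\<in>A. coef e (f x))"
  by (induction A rule: infinite_finite_induct) (simp_all add: coef_add)

lemma coef_single: "coef e (Poly_Mapping.single w c) = c * val e w"
  by (simp add: coef_def)

lemma coef_const_mult: "coef e (const c * f) = c * coef e f"
proof -
  have "const c * Poly_Mapping.single w d = Poly_Mapping.single w (c * d)" for w and d :: 'k
    by (simp add: const_def mult_single)
  then show ?thesis
    by (subst (1 2) poly_mapping_sum_single[of f, symmetric])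
      (simp add: sum_distrib_left coef_sum coef_single mult.assoc)
qed

lemma coef_uminus: "coef e (- f) = - coef e f"
  using coef_add[of e f "- f"] by (simp add: eq_neg_iff_add_eq_0 add.commute)

lemma val_plus_left:
  assumes "expo (letters v0) = (\<lambda>c. e c - expo (letters u) c)"
  shows "val e (u + v) = q powi (normal_exp (letters u) + disorder (letters u) (letters v0)) *
    val (\<lambda>c. e c - expo (letters u) c) v"
proof (cases "expo (letters v) = (\<lambda>c. e c - expo (letters u) c)")
  case True
  then have "expo (letters (u + v)) = e" by (simp only: expo_plus_iff(1))
  moreover have "disorder (letters u) (letters v) = disorder (letters u) (letters v0)"
    using True assms by (intro disorder_cong_right) simp
  ultimately show ?thesis using True q0
    by (simp add: val_def plus_word_def normal_exp_append power_int_add[symmetric] add_ac)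
next
  case False
  then have "expo (letters (u + v)) \<noteq> e" by (simp only: expo_plus_iff(1) simp_thms)
  then show ?thesis using False by (simp add: val_def)
qed

lemma val_plus_right:
  assumes "expo (letters u0) = (\<lambda>c. e c - expo (letters v) c)"
  shows "val e (u + v) = q powi (normal_exp (letters v) + disorder (letters u0) (letters v)) *
    val (\<lambda>c. e c - expo (letters v) c) u"
proof (cases "expo (letters u) = (\<lambda>c. e c - expo (letters v) c)")
  case True
  then have "expo (letters (u + v)) = e" by (simp only: expo_plus_iff(2))
  moreover have "disorder (letters u) (letters v) = disorder (letters u0) (letters v)"
    using True assms by (intro disorder_cong_left) simp
  ultimately show ?thesis using True q0
    by (simp add: val_def plus_word_def normal_exp_append power_int_add[symmetric] add_ac)
next
  case False
  then have "expo (letters (u + v)) \<noteq> e" by (simp only: expo_plus_iff(2) simp_thms)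
  then show ?thesis using False by (simp add: val_def)
qed

text \<open>Multiplication by a word \<open>u\<close> shifts \<open>e\<close> and multiplies by a
  power of \<open>q\<close> that is the same for all words of the right exponents, so it can be read
  off from one representative \<open>v0\<close>.\<close>

lemma coef_mult_left:
  assumes "\<And>e. coef e g = 0"
  shows "coef e (f * g) = 0"
proof -
  have "coef e (Poly_Mapping.single u c * g) = 0" for u c
  proof -
    let ?e = "\<lambda>c. e c - expo (letters u) c"
    have "Poly_Mapping.single u c * g
        = (\<Sum>v\<in>Poly_Mapping.keys g. Poly_Mapping.single (u + v) (c * Poly_Mapping.lookup g v))"
      by (subst (1) poly_mapping_sum_single[of g, symmetric]) (simp add: sum_distrib_left mult_single)
    then have 1: "coef e (Poly_Mapping.single u c * g)
        = (\<Sum>v\<in>Poly_Mapping.keys g. c * Poly_Mapping.lookup g v * val e (u + v))"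
      by (simp add: coef_sum coef_single)
    show ?thesis
    proof (cases "\<exists>v0\<in>Poly_Mapping.keys g. expo (letters v0) = ?e")
      case True
      then obtain v0 where "expo (letters v0) = ?e" by blast
      from val_plus_left[OF this] have "coef e (Poly_Mapping.single u c * g)
          = c * q powi (normal_exp (letters u) + disorder (letters u) (letters v0)) * coef ?e g"
        unfolding 1 by (simp add: coef_def sum_distrib_left mult_ac)
      then show ?thesis using assms by simp
    next
      case False
      then have "val e (u + v) = 0" if "v \<in> Poly_Mapping.keys g" for v
        using that unfolding val_def expo_plus_iff(1) by metis
      then show ?thesis unfolding 1 by simp
    qed
  qed
  then show ?thesis
    by (subst poly_mapping_sum_single[of f, symmetric]) (simp add: sum_distrib_right coef_sum)
qed

lemma coef_mult_right:
  assumes "\<And>e. coef e f = 0"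
  shows "coef e (f * g) = 0"
proof -
  have "coef e (f * Poly_Mapping.single v c) = 0" for v c
  proof -
    let ?e = "\<lambda>c. e c - expo (letters v) c"
    have "f * Poly_Mapping.single v c
        = (\<Sum>u\<in>Poly_Mapping.keys f. Poly_Mapping.single (u + v) (Poly_Mapping.lookup f u * c))"
      by (subst (1) poly_mapping_sum_single[of f, symmetric]) (simp add: sum_distrib_right mult_single)
    then have 1: "coef e (f * Poly_Mapping.single v c)
        = (\<Sum>u\<in>Poly_Mapping.keys f. Poly_Mapping.lookup f u * c * val e (u + v))"
      by (simp add: coef_sum coef_single)
    show ?thesis
    proof (cases "\<exists>u0\<in>Poly_Mapping.keys f. expo (letters u0) = ?e")
      case True
      then obtain u0 where "expo (letters u0) = ?e" by blast
      from val_plus_right[OF this] have "coef e (f * Poly_Mapping.single v c)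
          = c * q powi (normal_exp (letters v) + disorder (letters u0) (letters v)) * coef ?e f"
        unfolding 1 by (simp add: coef_def sum_distrib_left mult_ac)
      then show ?thesis using assms by simp
    next
      case False
      then have "val e (u + v) = 0" if "u \<in> Poly_Mapping.keys f" for u
        using that unfolding val_def expo_plus_iff(2) by metis
      then show ?thesis unfolding 1 by simp
    qed
  qed
  then show ?thesis
    by (subst poly_mapping_sum_single[of g, symmetric]) (simp add: sum_distrib_left coef_sum)
qed

lemma coef_mon: "coef e (mon u) = val e (Word u)"
  by (simp add: mon_def coef_single)

lemma coef_relator:
  assumes "f \<in> torus_relators m n q"
  shows "coef e f = 0"
proof -
  have lm: "letter x * letter y = mon [x, y]" for x y
    by (simp add: letter_def mon_def mult_single plus_word_def)
  have rel: "coef e (mon u - const c * mon v) = 0"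
    if "expo u = expo v" "q powi normal_exp u = c * q powi normal_exp v" for u v c
    using that coef_add[of e "mon u" "- (const c * mon v)"]
    by (simp add: coef_uminus coef_const_mult coef_mon val_def)
  have rel1: "coef e (mon u - mon v) = 0" if "expo u = expo v" "normal_exp u = normal_exp v" for u v
    using rel[of u v 1] that by simp
  have swap: "expo [x, y] = expo [y, x]" for x y by (auto simp: expo_def fun_eq_iff)
  consider c where "f = mon [Pos c, Neg c] - mon [] \<or> f = mon [Neg c, Pos c] - mon []"
    | i i' j j' where "i < i'" "j < j'" "f \<in> submatrix_relators q (i, j) (i, j') (i', j) (i', j')"
    using assms unfolding torus_relators_def lm mon_Nil by blast
  then show ?thesis
  proof cases
    case 1
    have "expo [Pos c, Neg c] = expo []" "expo [Neg c, Pos c] = expo []" by (auto simp: expo_def fun_eq_iff)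
    then show ?thesis using 1 by (auto intro!: rel1 simp: disorder_def)
  next
    case 2
    have nz: "q * inverse q = 1" using q0 by simp
    show ?thesis
      using 2 unfolding submatrix_relators_def Let_def mult.assoc lm
      by (elim insertE emptyE; simp only:; intro rel rel1 swap)
        (simp_all add: disorder_def letter_form_def coord_form_def nz)
  qed
qed

lemma coef_torus_ideal:
  assumes "f \<in> torus_ideal m n q"
  shows "coef e f = 0"
proof -
  let ?F = "free_alg m n :: (torus_letter word \<Rightarrow>\<^sub>0 'k) ring"
  define I where "I = {f \<in> carrier ?F. \<forall>e. coef e f = 0}"
  interpret R: ring ?F by (rule ring_free_alg)
  have ops: "f \<oplus>\<^bsub>?F\<^esub> g = f + g" "f \<otimes>\<^bsub>?F\<^esub> g = f * g" "\<zero>\<^bsub>?F\<^esub> = 0" for f g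
    by (simp_all add: free_alg_def)
  have neg: "\<ominus>\<^bsub>?F\<^esub> f = - f" if f: "f \<in> carrier ?F" for f
    using R.l_neg[OF f] unfolding ops by (simp add: add_eq_0_iff2)
  have "ideal I ?F"
  proof (rule idealI[OF ring_free_alg])
    show "subgroup I (add_monoid ?F)"
    proof (rule group.subgroupI[OF R.add.is_group], goal_cases)
      case 1 show ?case by (auto simp: I_def)
    next
      case 2
      have "0 \<in> I" using R.zero_closed by (simp add: I_def ops)
      then show ?case by blast
    next
      case (3 f)
      then have "f \<in> carrier ?F" by (simp add: I_def)
      then show ?case using 3 neg[of f] R.a_inv_closed[of f] by (simp add: I_def coef_uminus a_inv_def)
    next
      case (4 f g)
      then show ?case using R.a_closed[of f g] by (simp add: I_def ops coef_add)
    qed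
    show "x \<otimes>\<^bsub>?F\<^esub> f \<in> I" "f \<otimes>\<^bsub>?F\<^esub> x \<in> I" if "f \<in> I" "x \<in> carrier ?F" for f x
      using that R.m_closed[of x f] R.m_closed[of f x] coef_mult_left[of f _ x] coef_mult_right[of f _ x]
      by (simp_all add: I_def ops)
  qed
  moreover have "torus_relators m n q \<subseteq> I"
    using torus_relators_in_free_alg coef_relator by (auto simp: I_def)
  ultimately have "torus_ideal m n q \<subseteq> I" unfolding torus_ideal_def by (rule R.genideal_minimal)
  then show ?thesis using assms by (auto simp: I_def)
qed

lemma coef_cong:
  assumes "f \<cong>\<^sub>t g"
  shows "coef e (kill m n f) = coef e (kill m n g)"
proof -
  let ?F = "free_alg m n :: (torus_letter word \<Rightarrow>\<^sub>0 'k) ring"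
  interpret R: ring ?F by (rule ring_free_alg)
  interpret I: ideal "torus_ideal m n q" ?F by (rule torus_ideal_is_ideal)
  have "torus_ideal m n q +>\<^bsub>?F\<^esub> kill m n f = torus_ideal m n q +>\<^bsub>?F\<^esub> kill m n g"
    using assms by (simp add: eqv_def cls_def torus_class_def)
  then have "kill m n f \<in> torus_ideal m n q +>\<^bsub>?F\<^esub> kill m n g"
    using I.a_rcos_self[OF kill_in_free_alg, of f] by simp
  then obtain h where "h \<in> torus_ideal m n q" "kill m n f = h \<oplus>\<^bsub>?F\<^esub> kill m n g"
    by (auto simp: a_r_coset_def')
  then show ?thesis using coef_torus_ideal[of h e] by (simp add: coef_add free_alg_def)
qed

lemma kill_sum: "kill m n (\<Sum>x\<in>A. f x) = (\<Sum>x\<in>A. kill m n (f x))"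
proof (induction A rule: infinite_finite_induct)
  case (insert x F) then show ?case by (simp add: kill_add)
qed (use kill_add[of m n 0 0] in simp_all)

lemma kill_const [simp]: "kill m n (const c) = const c"
  by (rule kill_id[OF const_in_free_alg])

lemma kill_mon: "proper m n (Word w) \<Longrightarrow> kill m n (mon w) = mon w"
  by (rule kill_id) (auto simp: mon_def free_alg_def proper_def)

end

context cauchon_torus
begin

lemma proper_seg:
  assumes "vpath c a" "v \<le> Suc m"
  shows "proper m n (Word (seg a 0 v))"
  using assms(2)
proof (induction v)
  case (Suc v)
  have "proper m n (Word (lab v (a v)))"
    using vpath_ge[OF assms(1), of v] vpath_range[OF assms(1)] vpath_le_iff[OF assms(1), of v] Suc.prems
    by (auto simp: proper_def lab_def coords_def)
  then show ?case using Suc by (auto simp: seg_snoc proper_def)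
qed (simp add: proper_def)

text \<open>The exponent of \<open>t\<^sub>k\<^sub>,\<^sub>c\<close> is the number of paths leaving row \<open>k\<close> minus the number of paths entering
  it in column \<open>c\<close>.\<close>

lemma expo_seg:
  assumes "vpath d a" "1 \<le> k" "k \<le> m" "c \<le> n"
  shows "expo (seg a 0 (Suc m)) (k, c) = of_bool (a k = c) - of_bool (a (k - 1) = c)"
proof -
  have l: "expo (lab k' c') (k, c) = (if c' = c then of_bool (k' = k) - of_bool (Suc k' = k) else 0)"
    if "k' \<le> m" for k' c'
    using assms(3,4) by (auto simp: lab_def expo_def)
  have "expo (seg a 0 v) (k, c) = (if v = k then - of_bool (a (k - 1) = c)
      else if k < v then of_bool (a k = c) - of_bool (a (k - 1) = c) else 0)" if "v \<le> Suc m" for v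
    using that
  proof (induction v)
    case (Suc v)
    then show ?case using l[of v "a v"] assms(2) by (auto simp: seg_snoc expo_append)
  qed (use assms(2) in \<open>simp add: expo_def\<close>)
  then show ?thesis using assms(3) by simp
qed

definition config :: "(nat \<times> nat) list \<Rightarrow> (nat \<Rightarrow> nat \<Rightarrow> nat) \<Rightarrow> ((nat \<times> nat) \<times> (nat \<Rightarrow> nat)) multiset" where
  "config cs F = mset (map (\<lambda>l. (cs ! l, F l)) [0..<length cs])"

definition config_word :: "nat \<Rightarrow> (nat \<Rightarrow> nat \<Rightarrow> nat) \<Rightarrow> torus_letter list" where
  "config_word L F = concat (map (\<lambda>l. seg (F l) 0 (Suc m)) [0..<L])"

lemma expo_config_word:
  assumes F: "\<And>l. l < length cs \<Longrightarrow> vpath (cs ! l) (F l)" and k: "1 \<le> k" "k \<le> m" "c \<le> n"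
  shows "expo (config_word (length cs) F) (k, c)
    = int (count (image_mset (\<lambda>z. snd z k) (config cs F)) c)
      - int (count (image_mset (\<lambda>z. snd z (k - 1)) (config cs F)) c)"
proof -
  have cnt: "image_mset (\<lambda>z. snd z i) (config cs F) = mset (map (\<lambda>l. F l i) [0..<length cs])" for i
    by (simp add: config_def image_mset.compositionality comp_def flip: mset_map)
  have "expo (config_word L F) (k, c)
      = int (count (mset (map (\<lambda>l. F l k) [0..<L])) c) - int (count (mset (map (\<lambda>l. F l (k - 1)) [0..<L])) c)"
    if "L \<le> length cs" for L
    using that
  proof (induction L)
    case (Suc L)
    then show ?case using expo_seg[OF F[of L] k] by (simp add: config_word_def expo_append)
  qed (simp add: config_word_def expo_def)
  then show ?thesis unfolding cnt by simp
qed

text \<open>Row by row from row 0, where no path has started, the exponents give the changes of the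
  column counts. The count of \<open>Suc n\<close> follows from the number of paths, which is known
  from row \<open>m\<close>, where all have started; equal lengths of \<open>cs\<close> and
  \<open>ds\<close> are not presupposed.\<close>

lemma config_levels:
  assumes F: "\<And>l. l < length cs \<Longrightarrow> vpath (cs ! l) (F l)" and G: "\<And>l. l < length ds \<Longrightarrow> vpath (ds ! l) (G l)"
    and eq: "expo (config_word (length cs) F) = expo (config_word (length ds) G)" and "k \<le> m"
  shows "image_mset (\<lambda>z. snd z k) (config cs F) = image_mset (\<lambda>z. snd z k) (config ds G)"
proof -
  let ?f = "\<lambda>k. image_mset (\<lambda>z. snd z k) (config cs F)" and ?g = "\<lambda>k. image_mset (\<lambda>z. snd z k) (config ds G)"
  have mem: "\<exists>l<length cs. z = (cs ! l, F l)" if "z \<in># config cs F" for z cs F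
    using that by (auto simp: config_def)
  have zero: "count (image_mset (\<lambda>z. snd z 0) (config cs F)) c = 0"
    if "c \<le> n" "\<And>l. l < length cs \<Longrightarrow> vpath (cs ! l) (F l)" for cs F c
  proof -
    have "snd z 0 = Suc n" if z: "z \<in># config cs F" for z
    proof -
      obtain l where l: "l < length cs" "z = (cs ! l, F l)" using mem[OF z] by blast
      show ?thesis using vpath_before[OF \<open>\<And>l. l < length cs \<Longrightarrow> vpath (cs ! l) (F l)\<close>[OF l(1)], of 0]
          vpath_range[OF \<open>\<And>l. l < length cs \<Longrightarrow> vpath (cs ! l) (F l)\<close>[OF l(1)]] l by simp
    qed
    then have "c \<notin># image_mset (\<lambda>z. snd z 0) (config cs F)" using \<open>c \<le> n\<close> by auto
    then show ?thesis by (simp only: not_in_iff)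
  qed
  have low: "count (?f k) c = count (?g k) c" if "k \<le> m" "c \<le> n" for k c
    using that(1)
  proof (induction k)
    case 0
    then show ?case using zero[OF that(2) F] zero[OF that(2) G] by simp
  next
    case (Suc k)
    then show ?case
      using expo_config_word[OF F _ _ that(2), of "Suc k"] expo_config_word[OF G _ _ that(2), of "Suc k"] eq by simp
  qed
  have bound: "v \<le> Suc n" if vk: "v \<in># image_mset (\<lambda>z. snd z k) (config cs F)"
    and vF: "\<And>l. l < length cs \<Longrightarrow> vpath (cs ! l) (F l)" for v k cs F
  proof -
    obtain z where z: "z \<in># config cs F" "v = snd z k" using vk unfolding in_image_mset by blast
    obtain l where l: "l < length cs" "z = (cs ! l, F l)" using mem[OF z(1)] by blast
    show ?thesis using vpath_le[OF vF[OF l(1)], of k] z l by simp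
  qed
  have sum: "size M = (\<Sum>v\<le>n. count M v) + count M (Suc n)" if "\<And>v. v \<in># M \<Longrightarrow> v \<le> Suc n" for M :: "nat multiset"
  proof -
    have "size M = (\<Sum>v\<in>{..Suc n}. count M v)"
      unfolding size_multiset_overloaded_eq
      by (rule sum.mono_neutral_left) (use that in \<open>auto simp: not_in_iff\<close>)
    then show ?thesis by simp
  qed
  have last: "count (image_mset (\<lambda>z. snd z m) (config cs F)) (Suc n) = 0"
    if "\<And>l. l < length cs \<Longrightarrow> vpath (cs ! l) (F l)" for cs F
  proof -
    have "snd z m \<noteq> Suc n" if z: "z \<in># config cs F" for z
    proof -
      obtain l where l: "l < length cs" "z = (cs ! l, F l)" using mem[OF z] by blast
      note v = \<open>\<And>l. l < length cs \<Longrightarrow> vpath (cs ! l) (F l)\<close>[OF l(1)]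
      show ?thesis using vpath_end[OF v, of m] vpath_range[OF v] l by simp
    qed
    then have "Suc n \<notin># image_mset (\<lambda>z. snd z m) (config cs F)" unfolding in_image_mset by (metis imageE)
    then show ?thesis by (simp only: not_in_iff)
  qed
  have sF: "size (?f i) = (\<Sum>v\<le>n. count (?f i) v) + count (?f i) (Suc n)" for i by (rule sum, rule bound[OF _ F])
  have sG: "size (?g i) = (\<Sum>v\<le>n. count (?g i) v) + count (?g i) (Suc n)" for i by (rule sum, rule bound[OF _ G])
  have low_sum: "(\<Sum>v\<le>n. count (?f i) v) = (\<Sum>v\<le>n. count (?g i) v)" if "i \<le> m" for i
    using low[OF that] by (intro sum.cong) auto
  have "count (?f m) (Suc n) = 0" "count (?g m) (Suc n) = 0" by (rule last, rule F, assumption) (rule last, rule G)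
  then have "size (?f m) = size (?g m)" using sF[of m] sG[of m] low_sum[of m] by (metis order_refl)
  then have "size (?f k) = size (?g k)" by simp
  then have top: "count (?f k) (Suc n) = count (?g k) (Suc n)"
    using sF[of k] sG[of k] low_sum[OF \<open>k \<le> m\<close>] by (metis add_left_cancel)
  show ?thesis
  proof (rule multiset_eqI)
    fix v
    consider "v \<le> n" | "v = Suc n" | "Suc n < v" by linarith
    then show "count (?f k) v = count (?g k) v"
    proof cases
      case 3
      then have "v \<notin># ?f k" "v \<notin># ?g k" using bound[OF _ F, of v k] bound[OF _ G, of v k] by fastforce+
      then show ?thesis by (simp only: not_in_iff)
    qed (use low[OF \<open>k \<le> m\<close>] top in simp_all)
  qed
qed

definition Xs :: "(nat \<times> nat) list \<Rightarrow> torus_letter word \<Rightarrow>\<^sub>0 'k" where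
  "Xs cs = prod_list (map X cs)"

lemma coef_Xs:
  "coef e (kill m n (Xs cs)) = (\<Sum>F\<in>PiE {..<length cs} (\<lambda>l. {a. vpath (cs ! l) a}). val e (Word (config_word (length cs) F)))"
proof -
  have w: "prod_list (map (\<lambda>l. wt (F l)) [0..<L]) = mon (config_word L F)" for L F
    by (induction L) (simp_all add: config_word_def mon_Nil wt_def mon_mult)
  have pr: "proper m n (Word (config_word (length cs) F))"
    if F: "F \<in> PiE {..<length cs} (\<lambda>l. {a. vpath (cs ! l) a})" for F
  proof -
    have "set (seg (F l) 0 (Suc m)) \<subseteq> Pos ` coords m n \<union> Neg ` coords m n" if "l < length cs" for l
      using proper_seg[of "cs ! l" "F l" "Suc m"] F that by (simp add: PiE_iff proper_def)
    then show ?thesis by (fastforce simp: proper_def config_word_def)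
  qed
  have "Xs cs = prod_list (map (\<lambda>l. \<Sum>a\<in>{a. vpath (cs ! l) a}. wt a) [0..<length cs])"
  proof -
    have "map X cs = map (\<lambda>l. X (cs ! l)) [0..<length cs]" by (rule nth_equalityI) simp_all
    then show ?thesis unfolding Xs_def X_def by simp
  qed
  also have "\<dots> = (\<Sum>F\<in>PiE {..<length cs} (\<lambda>l. {a. vpath (cs ! l) a}). mon (config_word (length cs) F))"
    by (simp add: prod_list_sum_distrib finite_vpaths w)
  finally show ?thesis by (simp add: kill_sum coef_sum kill_mon[OF pr] coef_mon)
qed

text \<open>
  The monomial of a least family occurs in the product of generators with the same starts and ends,
  but in no product with a smaller exponent matrix.
\<close>

lemma separating_monomial:
  assumes L: "least_family S P" and cs0: "set cs0 \<subseteq> S"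
  obtains e where "coef e (kill m n (Xs cs0)) \<noteq> 0"
    and "\<And>cs. mset cs \<noteq> mset cs0 \<Longrightarrow> \<not> (\<exists>c. count (mset cs0) c < count (mset cs) c \<and>
      (\<forall>d < c. count (mset cs0) d = count (mset cs) d)) \<Longrightarrow> coef e (kill m n (Xs cs)) = 0"
proof -
  define F0 where "F0 = (\<lambda>l\<in>{..<length cs0}. P (cs0 ! l))"
  define e where "e = expo (config_word (length cs0) F0)"
  have inS: "cs0 ! l \<in> S" if "l < length cs0" for l using cs0 that by auto
  have v0: "vpath (cs0 ! l) (F0 l)" if "l < length cs0" for l
    using least_familyD(1)[OF L inS[OF that]] that by (simp add: F0_def)
  have F0: "F0 \<in> PiE {..<length cs0} (\<lambda>l. {a. vpath (cs0 ! l) a})" using v0 by (auto simp: F0_def)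
  have fst_config: "image_mset fst (config cs F) = mset cs" for cs F
    by (simp add: config_def comp_def map_nth flip: mset_map)
  have X0: "fst z \<in> S \<and> snd z = P (fst z)" if z: "z \<in># config cs0 F0" for z
    using z inS by (auto simp: config_def F0_def)
  have alt: "config cs0 F0 = config cs F \<or> (\<exists>c. count (mset cs0) c < count (mset cs) c \<and>
      (\<forall>d < c. count (mset cs0) d = count (mset cs) d))"
    if F: "F \<in> PiE {..<length cs} (\<lambda>l. {a. vpath (cs ! l) a})" and eq: "expo (config_word (length cs) F) = e" for cs F
  proof -
    have v: "vpath (cs ! l) (F l)" if "l < length cs" for l using F that by (simp add: PiE_iff)
    have "vpath (fst z) (snd z)" if z: "z \<in># config cs F" for z using z v by (auto simp: config_def)
    from least_family_unique[OF L X0 this config_levels[OF v0 v eq[symmetric, unfolded e_def]]]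
    show ?thesis unfolding fst_config by blast
  qed
  \<comment> \<open>For \<open>cs0\<close> itself the counts agree, so \<open>F0\<close> is the only
    contributing family and nothing can cancel.\<close>
  have "val e (Word (config_word (length cs0) F)) = (if F = F0 then q powi normal_exp (config_word (length cs0) F0) else 0)"
    if F: "F \<in> PiE {..<length cs0} (\<lambda>l. {a. vpath (cs0 ! l) a})" for F
  proof (cases "expo (config_word (length cs0) F) = e")
    case True
    then have "config cs0 F0 = config cs0 F" using alt[OF F True] by auto
    have "F l = F0 l" for l
    proof (cases "l < length cs0")
      case True
      then have "(cs0 ! l, F l) \<in># config cs0 F" by (auto simp: config_def)
      then show ?thesis using X0[of "(cs0 ! l, F l)"] \<open>config cs0 F0 = config cs0 F\<close> True by (simp add: F0_def)
    next
      case False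
      then show ?thesis using F by (simp add: F0_def PiE_iff extensional_def)
    qed
    then have "F = F0" ..
    then show ?thesis by (simp add: val_def e_def)
  next
    case False
    then show ?thesis by (auto simp: val_def e_def)
  qed
  then have "coef e (kill m n (Xs cs0)) = (\<Sum>F\<in>PiE {..<length cs0} (\<lambda>l. {a. vpath (cs0 ! l) a}).
      if F = F0 then q powi normal_exp (config_word (length cs0) F0) else 0)"
    unfolding coef_Xs by (rule sum.cong[OF refl])
  also have "\<dots> = q powi normal_exp (config_word (length cs0) F0)"
    using F0 by (subst sum.delta) (auto intro!: finite_PiE finite_vpaths)
  finally have nz: "coef e (kill m n (Xs cs0)) \<noteq> 0" using q0 by simp
  have "coef e (kill m n (Xs cs)) = 0"
    if cs: "mset cs \<noteq> mset cs0" and nless: "\<not> (\<exists>c. count (mset cs0) c < count (mset cs) c \<and>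
      (\<forall>d < c. count (mset cs0) d = count (mset cs) d))" for cs
    unfolding coef_Xs
  proof (rule sum.neutral, rule ballI)
    fix F assume F: "F \<in> PiE {..<length cs} (\<lambda>l. {a. vpath (cs ! l) a})"
    have "expo (config_word (length cs) F) \<noteq> e"
    proof
      assume "expo (config_word (length cs) F) = e"
      then have "config cs0 F0 = config cs F" using alt[OF F] nless by blast
      then have "mset cs0 = mset cs" using fst_config by metis
      then show False using cs by simp
    qed
    then show "val e (Word (config_word (length cs) F)) = 0" by (simp add: val_def)
  qed
  with nz show ?thesis by (rule that)
qed

end

section \<open>Path sums in the Cauchon graph\<close>

fun arc_word :: "vertex \<times> vertex \<Rightarrow> torus_letter word \<Rightarrow>\<^sub>0 'k::field" where
  "arc_word (White (i, j), White (i', j')) = (if i = i' then mon [Neg (i, j), Pos (i', j')] else 1)"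
| "arc_word (Row _, White c) = mon [Pos c]"
| "arc_word _ = 1"

context cauchon_torus
begin

abbreviation HA where "HA \<equiv> horizontal_arcs m n B"
abbreviation VA where "VA \<equiv> vertical_arcs m n B"

lemma HA_White: "(White (k, u), y) \<in> HA \<longleftrightarrow> (\<exists>u'. y = White (k, u') \<and> (k, u) \<in> W \<and> (k, u') \<in> W \<and> u' < u \<and>
    (\<forall>u''. u' < u'' \<and> u'' < u \<longrightarrow> (k, u'') \<notin> W))"
  by (auto simp: horizontal_arcs_def W_def Let_def)

lemma HA_Row: "(Row i, y) \<in> HA \<longleftrightarrow> (\<exists>u. y = White (i, u) \<and> (i, u) \<in> W \<and> (\<forall>u' > u. (i, u') \<notin> W))"
  by (auto simp: horizontal_arcs_def W_def Let_def)

lemma VA_White: "(White (k, u), y) \<in> VA \<longleftrightarrow> (k, u) \<in> W \<and>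
    ((\<exists>k'. y = White (k', u) \<and> (k', u) \<in> W \<and> k < k' \<and> (\<forall>k''. k < k'' \<and> k'' < k' \<longrightarrow> (k'', u) \<notin> W))
      \<or> y = Col u \<and> (\<forall>k' > k. (k', u) \<notin> W))"
  by (auto simp: vertical_arcs_def W_def Let_def)

lemma no_arcs: "(Row i, y) \<notin> VA" "(Col i, y) \<notin> VA" "(Col i, y) \<notin> HA"
  by (auto simp: vertical_arcs_def horizontal_arcs_def Let_def)

lemma VA_HA: "e \<in> VA \<Longrightarrow> e \<notin> HA"
proof -
  assume e: "e \<in> VA"
  obtain x y where xy: "e = (x, y)" by (cases e)
  show "e \<notin> HA"
  proof (cases x)
    case (White c)
    obtain k u where "c = (k, u)" by (cases c)
    then show ?thesis using e xy White by (auto simp: VA_White HA_White)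
  qed (use e xy no_arcs in auto)
qed

text \<open>Arcs decrease the rank, so the graph is acyclic and all its walks are paths.\<close>

fun rank :: "vertex \<Rightarrow> nat" where
  "rank (White (i, j)) = (Suc m - i) * Suc n + j"
| "rank (Row i) = Suc m * Suc n + Suc n"
| "rank (Col j) = 0"

lemma rank_less:
  assumes "(x, y) \<in> HA \<union> VA"
  shows "rank y < rank x"
proof (cases x)
  case (White c)
  obtain k u where c: "c = (k, u)" by (cases c)
  from assms consider u' where "y = White (k, u')" "u' < u" | k' where "y = White (k', u)" "k < k'" "(k', u) \<in> W"
    | "y = Col u" "(k, u) \<in> W"
    unfolding White c Un_iff HA_White VA_White by blast
  then show ?thesis
  proof cases
    case 2
    then have "Suc m - k' < Suc m - k" using W_range[of k' u] by auto
    then have "(Suc m - k') * Suc n < (Suc m - k) * Suc n" by (intro mult_less_mono1) simp_all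
    then show ?thesis using 2 by (simp only: White c rank.simps add_less_cancel_right)
  next
    case 3
    then show ?thesis using W_range[of k u] by (simp add: White c)
  qed (simp add: White c)
next
  case (Row i)
  then obtain u where "y = White (i, u)" "(i, u) \<in> W" using assms no_arcs by (auto simp: HA_Row)
  moreover from this have "(Suc m - i) * Suc n + u < Suc m * Suc n + Suc n"
    using W_range[of i u] by (intro add_le_less_mono mult_le_mono1) auto
  ultimately show ?thesis by (simp only: Row rank.simps)
qed (use assms no_arcs in auto)

fun walk :: "nat \<Rightarrow> vertex \<Rightarrow> (vertex \<times> vertex) list \<Rightarrow> bool" where
  "walk j v [] \<longleftrightarrow> v = Col j"
| "walk j v (e # p) \<longleftrightarrow> e \<in> HA \<union> VA \<and> fst e = v \<and> walk j (snd e) p"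

definition turn_ok :: "vertex \<times> vertex \<Rightarrow> (vertex \<times> vertex) list \<Rightarrow> bool" where
  "turn_ok e p \<longleftrightarrow> (e \<in> VA \<longrightarrow> p \<noteq> [] \<longrightarrow> hd p \<in> HA \<longrightarrow> (\<forall>c. snd e = White c \<longrightarrow> c \<le> rs))"

fun turns_ok :: "(vertex \<times> vertex) list \<Rightarrow> bool" where
  "turns_ok [] \<longleftrightarrow> True"
| "turns_ok (e # p) \<longleftrightarrow> turn_ok e p \<and> turns_ok p"

definition walks :: "nat \<Rightarrow> vertex \<Rightarrow> (vertex \<times> vertex) list set" where
  "walks j v = {p. walk j v p \<and> turns_ok p}"

definition path_sum :: "(vertex \<times> vertex) list set \<Rightarrow> torus_letter word \<Rightarrow>\<^sub>0 'k" where
  "path_sum A = (\<Sum>p\<in>A. prod_list (map arc_word p))"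

lemma finite_walks: "finite (walks j v)"
proof -
  have fin: "finite (HA \<union> VA)"
  proof (rule finite_subset)
    let ?V = "White ` coords m n \<union> Row ` {1..m} \<union> Col ` {1..n}"
    show "HA \<union> VA \<subseteq> ?V \<times> ?V"
      by (auto simp: horizontal_arcs_def vertical_arcs_def Let_def coords_def)
    show "finite (?V \<times> ?V)" by (auto simp: coords_def)
  qed
  have "set p \<subseteq> HA \<union> VA \<and> length p \<le> rank v" if "walk j v p" for p v
    using that
  proof (induction p arbitrary: v)
    case (Cons e p)
    then have "length p \<le> rank (snd e)" "e \<in> HA \<union> VA" "set p \<subseteq> HA \<union> VA" "fst e = v" by auto
    moreover have "rank (snd e) < rank v" using rank_less[of "fst e" "snd e"] Cons.prems by simp
    ultimately show ?case by simp
  qed simp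
  then have "walks j v \<subseteq> {p. set p \<subseteq> HA \<union> VA \<and> length p \<le> rank v}" by (auto simp: walks_def)
  then show ?thesis using finite_lists_length_le[OF fin] by (rule finite_subset)
qed

lemma path_sum_Cons: "path_sum (Cons e ` A) = arc_word e * path_sum A"
  unfolding path_sum_def by (subst sum.reindex) (auto simp: sum_distrib_left)

text \<open>The continuations to column \<open>j\<close> of a walk that leaves row \<open>k\<close> downwards in column \<open>u\<close>.\<close>

definition below :: "nat \<Rightarrow> nat \<Rightarrow> nat \<Rightarrow> (vertex \<times> vertex) list set" where
  "below j k u = (if \<exists>k' > k. (k', u) \<in> W
    then let k' = (LEAST k'. k < k' \<and> (k', u) \<in> W) in
      {p \<in> walks j (White (k', u)). p \<noteq> [] \<longrightarrow> hd p \<in> HA \<longrightarrow> (k', u) \<le> rs}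
    else walks j (Col u))"

lemma walks_Col: "walks j (Col u) = (if u = j then {[]} else {})"
proof -
  have w: "walk j (Col u) p \<longleftrightarrow> p = [] \<and> u = j" for p
    by (cases p) (auto simp: no_arcs)
  have "walks j (Col u) = {p. (p = [] \<and> u = j) \<and> turns_ok p}" by (simp only: walks_def w)
  also have "\<dots> = (if u = j then {[]} else {})" by auto
  finally show ?thesis .
qed

lemma below_skip:
  assumes "(Suc k, u) \<notin> W"
  shows "below j k u = below j (Suc k) u"
proof -
  have "k < k' \<and> (k', u) \<in> W \<longleftrightarrow> Suc k < k' \<and> (k', u) \<in> W" for k'
    using assms by (metis Suc_lessD Suc_lessI)
  then show ?thesis by (simp only: below_def)
qed

lemma below_Suc:
  assumes "(Suc k, u) \<in> W"
  shows "below j k u = {p \<in> walks j (White (Suc k, u)). p \<noteq> [] \<longrightarrow> hd p \<in> HA \<longrightarrow> (Suc k, u) \<le> rs}"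
proof -
  have "(LEAST k'. k < k' \<and> (k', u) \<in> W) = Suc k"
    by (rule Least_equality) (use assms in auto)
  moreover have "\<exists>k' > k. (k', u) \<in> W" using assms by blast
  ultimately show ?thesis by (simp add: below_def)
qed

lemma walks_first_arc:
  assumes e: "(x, y) \<in> A" and A: "A \<subseteq> HA \<union> VA" and uniq: "\<And>z. (x, z) \<in> A \<Longrightarrow> z = y"
  shows "{p \<in> walks j x. p \<noteq> [] \<and> hd p \<in> A} = Cons (x, y) ` {p \<in> walks j y. turn_ok (x, y) p}"
proof (intro Set.set_eqI iffI)
  fix p assume p: "p \<in> {p \<in> walks j x. p \<noteq> [] \<and> hd p \<in> A}"
  then obtain e' p' where ep: "p = e' # p'" by (cases p) auto
  then have "e' \<in> A" "fst e' = x" using p by (auto simp: walks_def)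
  then have "e' = (x, y)" using uniq[of "snd e'"] by (metis prod.collapse)
  then show "p \<in> Cons (x, y) ` {p \<in> walks j y. turn_ok (x, y) p}" using p ep by (auto simp: walks_def)
next
  fix p assume "p \<in> Cons (x, y) ` {p \<in> walks j y. turn_ok (x, y) p}"
  then show "p \<in> {p \<in> walks j x. p \<noteq> [] \<and> hd p \<in> A}" using e A by (auto simp: walks_def)
qed

lemma vertical_walks:
  assumes W: "(k, u) \<in> W"
  shows "\<exists>y. arc_word (White (k, u), y) = (1 :: torus_letter word \<Rightarrow>\<^sub>0 'k) \<and>
    {p \<in> walks j (White (k, u)). p \<noteq> [] \<and> hd p \<in> VA} = Cons (White (k, u), y) ` below j k u"
proof (cases "\<exists>k' > k. (k', u) \<in> W")
  case True
  define k' where "k' = (LEAST k'. k < k' \<and> (k', u) \<in> W)"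
  have k': "k < k'" "(k', u) \<in> W" using LeastI_ex[of "\<lambda>k'. k < k' \<and> (k', u) \<in> W"] True unfolding k'_def by auto
  have least: "(k'', u) \<notin> W" if "k < k''" "k'' < k'" for k''
    using not_less_Least[of k'' "\<lambda>k'. k < k' \<and> (k', u) \<in> W"] that unfolding k'_def by blast
  let ?e = "(White (k, u), White (k', u))"
  have e: "?e \<in> VA" unfolding VA_White using W k' least by blast
  have uniq: "y = White (k', u)" if "(White (k, u), y) \<in> VA" for y
    using that k' least unfolding VA_White by (metis linorder_neqE_nat)
  have "below j k u = {p \<in> walks j (White (k', u)). turn_ok ?e p}"
    unfolding below_def k'_def if_P[OF True] Let_def turn_ok_def using e unfolding k'_def by simp
  then show ?thesis using walks_first_arc[OF e _ uniq] k' by (intro exI[of _ "White (k', u)"]) simp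
next
  case False
  let ?e = "(White (k, u), Col u)"
  have e: "?e \<in> VA" unfolding VA_White using W False by blast
  have uniq: "y = Col u" if "(White (k, u), y) \<in> VA" for y
    using that False unfolding VA_White by blast
  have "below j k u = {p \<in> walks j (Col u). turn_ok ?e p}"
    unfolding below_def if_not_P[OF False] turn_ok_def by simp
  then show ?thesis using walks_first_arc[OF e _ uniq] by (intro exI[of _ "Col u"]) simp
qed

text \<open>The part of a column sequence below row \<open>k\<close>. The values up to row
  \<open>k\<close> are fixed so that each such part is a single function.\<close>

definition tails :: "nat \<Rightarrow> nat \<Rightarrow> nat \<Rightarrow> (nat \<Rightarrow> nat) set" where
  "tails j k u = {b. (\<forall>l \<le> k. b l = u) \<and> (\<forall>l. k \<le> l \<and> l < m \<longrightarrow> step (Suc l) (b l) (b (Suc l))) \<and> (\<forall>l \<ge> m. b l = j)}"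

text \<open>The weights of the runs in the rows below \<open>k\<close>, from column
  \<open>b l\<close> to column \<open>b (Suc l)\<close>. A straight passage contributes an inverse
  times its generator, which is 1 only in the torus; hence the comparison with walks uses
  \<open>\<cong>\<^sub>t\<close>.\<close>

definition tail_word :: "nat \<Rightarrow> nat \<Rightarrow> (nat \<Rightarrow> nat) \<Rightarrow> torus_letter list" where
  "tail_word k v b = concat (map (\<lambda>l. [Neg (Suc l, b l), Pos (Suc l, b (Suc l))]) [k..<v])"

definition tail_sum :: "nat \<Rightarrow> nat \<Rightarrow> nat \<Rightarrow> torus_letter word \<Rightarrow>\<^sub>0 'k" where
  "tail_sum j k u = (\<Sum>b\<in>tails j k u. mon (tail_word k m b))"

lemma finite_tails: "finite (tails j k u)"
proof (rule inj_on_finite)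
  have le: "b l \<le> u" if "b \<in> tails j k u" "l \<le> m" for b l
  proof (cases "l \<le> k")
    case False
    then have "k \<le> l" by simp
    then show ?thesis using that(2)
    proof (induction l rule: dec_induct)
      case base
      then show ?case using that by (simp add: tails_def)
    next
      case (step l)
      then have "step (Suc l) (b l) (b (Suc l))" using that(1) by (simp add: tails_def)
      then show ?case using step_le step by (metis Suc_leD order_trans)
    qed
  qed (use that in \<open>simp add: tails_def\<close>)
  show "(\<lambda>b. restrict b {..m}) ` tails j k u \<subseteq> PiE {..m} (\<lambda>_. {..u})"
    by (intro image_subsetI PiE_I) (auto simp: le)
  show "inj_on (\<lambda>b. restrict b {..m}) (tails j k u)"
  proof (rule inj_onI, rule ext)
    fix a b l assume ab: "a \<in> tails j k u" "b \<in> tails j k u" "restrict a {..m} = restrict b {..m}"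
    show "a l = b l"
    proof (cases "l \<le> m")
      case True
      then show ?thesis using fun_cong[OF ab(3), of l] by simp
    qed (use ab in \<open>simp add: tails_def\<close>)
  qed
qed (auto intro: finite_PiE)

lemma tail_sum_end: "tail_sum j m u = (if u = j then 1 else 0)"
proof -
  have "tails j m u = (if u = j then {\<lambda>_. j} else {})"
  proof (cases "u = j")
    case True
    have "b = (\<lambda>_. j)" if b: "b \<in> tails j m j" for b
    proof
      fix l show "b l = j" using b by (cases "l \<le> m") (auto simp: tails_def)
    qed
    moreover have "(\<lambda>_. j) \<in> tails j m j" by (simp add: tails_def)
    ultimately have "tails j m j = {\<lambda>_. j}" by blast
    then show ?thesis using True by simp
  next
    case False
    have "b m = u" "b m = j" if "b \<in> tails j m u" for b using that by (auto simp: tails_def)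
    then show ?thesis using False by auto
  qed
  then show ?thesis by (simp add: tail_sum_def tail_word_def mon_Nil)
qed

lemma tail_sum_rec:
  assumes k: "k < m"
  shows "tail_sum j k u = (\<Sum>w\<in>{w. step (Suc k) u w}. mon [Neg (Suc k, u), Pos (Suc k, w)] * tail_sum j (Suc k) w)"
proof -
  let ?g = "\<lambda>(w, b). \<lambda>l. if l \<le> k then u else b l"
  let ?A = "Sigma {w. step (Suc k) u w} (tails j (Suc k))"
  have fin: "finite {w. step (Suc k) u w}" by (rule finite_subset[of _ "{..u}"]) (auto dest: step_le)
  have "tail_sum j k u = (\<Sum>x\<in>?A. mon (tail_word k m (?g x)))"
    unfolding tail_sum_def
  proof (rule sum.reindex_bij_witness[of _ ?g "\<lambda>b. (b (Suc k), \<lambda>l. if l \<le> k then b (Suc k) else b l)"])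
    fix b assume b: "b \<in> tails j k u"
    show eq: "?g (b (Suc k), \<lambda>l. if l \<le> k then b (Suc k) else b l) = b"
      using b by (auto simp: tails_def fun_eq_iff)
    show "(b (Suc k), \<lambda>l. if l \<le> k then b (Suc k) else b l) \<in> ?A"
      using b k by (auto simp: tails_def le_Suc_eq)
    show "mon (tail_word k m (?g (b (Suc k), \<lambda>l. if l \<le> k then b (Suc k) else b l))) = mon (tail_word k m b)"
      unfolding eq ..
  next
    fix x assume "x \<in> ?A"
    then obtain w b where x: "x = (w, b)" "step (Suc k) u w" "b \<in> tails j (Suc k) w" by auto
    then have bl: "b l = w" if "l \<le> Suc k" for l using that by (simp add: tails_def)
    show "(?g x (Suc k), \<lambda>l. if l \<le> k then ?g x (Suc k) else ?g x l) = x"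
      using bl by (auto simp: x(1) fun_eq_iff)
    have "step (Suc l) (?g x l) (?g x (Suc l))" if "k \<le> l" "l < m" for l
      using that x bl[of "Suc k"] by (cases "l = k") (auto simp: tails_def)
    then show "?g x \<in> tails j k u" using x k by (auto simp: tails_def)
  qed
  also have "\<dots> = (\<Sum>(w, b)\<in>?A. mon [Neg (Suc k, u), Pos (Suc k, w)] * mon (tail_word (Suc k) m b))"
  proof (rule sum.cong[OF refl])
    fix x assume "x \<in> ?A"
    then obtain w b where x: "x = (w, b)" "b \<in> tails j (Suc k) w" by auto
    then have bk: "b (Suc k) = w" by (simp add: tails_def)
    have "tail_word k m (?g x) = [Neg (Suc k, u), Pos (Suc k, w)] @ tail_word (Suc k) m (?g x)"
      using k bk by (simp add: tail_word_def upt_conv_Cons x(1))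
    also have "tail_word (Suc k) m (?g x) = tail_word (Suc k) m b"
      unfolding tail_word_def x(1) by (intro arg_cong[where f = concat] map_cong) auto
    finally show "mon (tail_word k m (?g x))
        = (case x of (w, b) \<Rightarrow> mon [Neg (Suc k, u), Pos (Suc k, w)] * mon (tail_word (Suc k) m b))"
      by (simp add: x(1) mon_mult)
  qed
  also have "\<dots> = (\<Sum>w\<in>{w. step (Suc k) u w}. \<Sum>b\<in>tails j (Suc k) w.
      mon [Neg (Suc k, u), Pos (Suc k, w)] * mon (tail_word (Suc k) m b))"
    by (rule sum.Sigma[symmetric]) (use fin finite_tails in auto)
  finally show ?thesis by (simp add: tail_sum_def sum_distrib_left)
qed

lemma neg_pos_cancel:
  assumes "c \<in> coords m n"
  shows "mon [Neg c, Pos c] * f \<cong>\<^sub>t f" "mon [x, Pos c] * (mon [Neg c, y] * f) \<cong>\<^sub>t mon [x, y] * f"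
    "mon [Pos c] * (mon [Neg c, y] * f) \<cong>\<^sub>t mon [y] * f"
proof -
  have "mon [Neg c, Pos c] * f = (mon [Neg c] * mon [Pos c]) * f" by (simp add: mon_mult)
  also have "\<dots> \<cong>\<^sub>t 1 * f" by (intro eqv_mult eqv_inverse assms eqv_refl)
  finally show "mon [Neg c, Pos c] * f \<cong>\<^sub>t f" by simp
  have "mon [x, Pos c] * (mon [Neg c, y] * f) = mon [x] * ((mon [Pos c] * mon [Neg c]) * (mon [y] * f))"
    by (simp add: mon_mult mult.assoc[symmetric])
  also have "\<dots> \<cong>\<^sub>t mon [x] * (1 * (mon [y] * f))" by (intro eqv_mult eqv_inverse assms eqv_refl)
  finally show "mon [x, Pos c] * (mon [Neg c, y] * f) \<cong>\<^sub>t mon [x, y] * f" by (simp add: mon_mult mult.assoc[symmetric])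
  have "mon [Pos c] * (mon [Neg c, y] * f) = (mon [Pos c] * mon [Neg c]) * (mon [y] * f)"
    by (simp add: mon_mult mult.assoc[symmetric])
  also have "\<dots> \<cong>\<^sub>t 1 * (mon [y] * f)" by (intro eqv_mult eqv_inverse assms eqv_refl)
  finally show "mon [Pos c] * (mon [Neg c, y] * f) \<cong>\<^sub>t mon [y] * f" by simp
qed

text \<open>A walk runs left through white squares to some \<open>w\<close> and then drops. The
  weights of its horizontal arcs telescope, which the induction over the first arc shows.\<close>

lemma row_sum:
  assumes D: "\<And>w. (k, w) \<in> W \<Longrightarrow> path_sum (below j k w) \<cong>\<^sub>t tail_sum j k w"
  shows "(k, u) \<in> W \<Longrightarrow> path_sum (walks j (White (k, u)))
    \<cong>\<^sub>t (\<Sum>w\<in>{w. w \<le> u \<and> (k, w) \<in> W}. mon [Neg (k, u), Pos (k, w)] * tail_sum j k w)"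
proof (induction u rule: less_induct)
  case (less u)
  let ?f = "\<lambda>u w. mon [Neg (k, u), Pos (k, w)] * tail_sum j k w"
  have uc: "(k, u) \<in> coords m n" using less.prems by (simp add: W_def)
  define V where "V = {p \<in> walks j (White (k, u)). p \<noteq> [] \<and> hd p \<in> VA}"
  define H where "H = {p \<in> walks j (White (k, u)). p \<noteq> [] \<and> hd p \<in> HA}"
  have "p \<in> V \<union> H" if "p \<in> walks j (White (k, u))" for p
    using that by (cases p) (auto simp: V_def H_def walks_def)
  then have "walks j (White (k, u)) = V \<union> H" by (auto simp: V_def H_def)
  moreover have "V \<inter> H = {}" unfolding V_def H_def using VA_HA by blast
  moreover have "finite V" "finite H" using finite_walks by (auto simp: V_def H_def)
  ultimately have split: "path_sum (walks j (White (k, u))) = path_sum V + path_sum H"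
    by (simp add: path_sum_def sum.union_disjoint)
  obtain y where y: "arc_word (White (k, u), y) = (1 :: torus_letter word \<Rightarrow>\<^sub>0 'k)" "V = Cons (White (k, u), y) ` below j k u"
    using vertical_walks[OF less.prems] unfolding V_def by metis
  have "path_sum V = path_sum (below j k u)" unfolding y(2) path_sum_Cons y(1) by simp
  also have "\<dots> \<cong>\<^sub>t tail_sum j k u" by (rule D[OF less.prems])
  also have "\<dots> \<cong>\<^sub>t ?f u u" by (rule eqv_sym[OF neg_pos_cancel(1)[OF uc]])
  finally have V: "path_sum V \<cong>\<^sub>t ?f u u" .
  show ?case
  proof (cases "\<exists>u' < u. (k, u') \<in> W")
    case True
    define A where "A = {u'. u' < u \<and> (k, u') \<in> W}"
    have A: "finite A" "A \<noteq> {}" using True by (auto simp: A_def)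
    define u' where "u' = Max A"
    have u': "u' < u" "(k, u') \<in> W" using Max_in[OF A] unfolding u'_def A_def by auto
    have max: "w \<le> u'" if "w < u" "(k, w) \<in> W" for w
      using Max_ge[OF A(1), of w] that unfolding u'_def A_def by simp
    let ?e = "(White (k, u), White (k, u'))"
    have e: "?e \<in> HA" unfolding HA_White using less.prems u' max by (metis leD)
    have uniq: "y = White (k, u')" if "(White (k, u), y) \<in> HA" for y
      using that u' max unfolding HA_White by (metis le_neq_implies_less)
    have "H = Cons ?e ` walks j (White (k, u'))"
      using walks_first_arc[OF e _ uniq, of j] VA_HA[of ?e] e unfolding H_def by (auto simp: turn_ok_def)
    then have "path_sum H = mon [Neg (k, u), Pos (k, u')] * path_sum (walks j (White (k, u')))"
      by (simp add: path_sum_Cons)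
    also have "\<dots> \<cong>\<^sub>t mon [Neg (k, u), Pos (k, u')] * (\<Sum>w\<in>{w. w \<le> u' \<and> (k, w) \<in> W}. ?f u' w)"
      by (intro eqv_mult less.IH u' eqv_refl)
    also have "\<dots> \<cong>\<^sub>t (\<Sum>w\<in>{w. w \<le> u' \<and> (k, w) \<in> W}. ?f u w)"
      unfolding sum_distrib_left by (intro eqv_sum neg_pos_cancel) (use u' in \<open>simp add: W_def\<close>)
    finally have H: "path_sum H \<cong>\<^sub>t (\<Sum>w\<in>{w. w \<le> u' \<and> (k, w) \<in> W}. ?f u w)" .
    have "{w. w \<le> u \<and> (k, w) \<in> W} = insert u {w. w \<le> u' \<and> (k, w) \<in> W}"
      using less.prems u' max by (auto simp: le_less)
    moreover have "u \<notin> {w. w \<le> u' \<and> (k, w) \<in> W}" using u' by auto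
    ultimately have "(\<Sum>w\<in>{w. w \<le> u \<and> (k, w) \<in> W}. ?f u w) = ?f u u + (\<Sum>w\<in>{w. w \<le> u' \<and> (k, w) \<in> W}. ?f u w)"
      by simp
    then show ?thesis unfolding split using eqv_add[OF V H] by simp
  next
    case False
    have "H = {}"
    proof (rule ccontr)
      assume "H \<noteq> {}"
      then obtain p where p: "p \<in> H" by blast
      then obtain e' p' where ep: "p = e' # p'" by (cases p) (auto simp: H_def)
      then have "e' \<in> HA" "fst e' = White (k, u)" using p by (auto simp: ep H_def walks_def)
      then have "(White (k, u), snd e') \<in> HA" by (metis prod.collapse)
      then show False using False unfolding HA_White by blast
    qed
    moreover have "{w. w \<le> u \<and> (k, w) \<in> W} = {u}" using less.prems False by (auto simp: le_less)
    ultimately show ?thesis unfolding split using V by (simp add: path_sum_def)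
  qed
qed

text \<open>From row \<open>m\<close> upwards, walks and column sequences are compared in row
  \<open>Suc k\<close>: over a black square and at a white one beyond \<open>rs\<close> both can
  only go straight, elsewhere \<open>row_sum\<close> applies.\<close>

lemma below_sum:
  assumes "k \<le> m" "1 \<le> u" "u \<le> n"
  shows "path_sum (below j k u) \<cong>\<^sub>t tail_sum j k u"
  using assms
proof (induction arbitrary: u rule: inc_induct)
  case base
  have "\<not> (\<exists>k' > m. (k', u) \<in> W)" using W_range by fastforce
  then have "below j m u = walks j (Col u)" unfolding below_def by auto
  then show ?case by (simp add: walks_Col path_sum_def tail_sum_end)
next
  case (step k)
  have c: "(Suc k, u) \<in> coords m n" using step by (simp add: coords_def)
  show ?case
  proof (cases "(Suc k, u) \<in> W")
    case False
    then have "{w. step (Suc k) u w} = {u}" using step(5) by (auto simp: step_def)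
    then have "tail_sum j k u = mon [Neg (Suc k, u), Pos (Suc k, u)] * tail_sum j (Suc k) u"
      using tail_sum_rec[OF step(2)] by simp
    then have t: "tail_sum j k u \<cong>\<^sub>t tail_sum j (Suc k) u" using neg_pos_cancel(1)[OF c] by simp
    show ?thesis unfolding below_skip[OF False] by (rule eqv_trans[OF step.IH eqv_sym[OF t]]) (use step in auto)
  next
    case True
    have R: "path_sum (below j (Suc k) w) \<cong>\<^sub>t tail_sum j (Suc k) w" if "(Suc k, w) \<in> W" for w
      using step.IH W_range[OF that] by simp
    show ?thesis
    proof (cases "(Suc k, u) \<le> rs")
      case rs: True
      have "{w. step (Suc k) u w} = {w. w \<le> u \<and> (Suc k, w) \<in> W}" using True rs step(5) by (auto simp: step_def)
      then have "tail_sum j k u = (\<Sum>w\<in>{w. w \<le> u \<and> (Suc k, w) \<in> W}. mon [Neg (Suc k, u), Pos (Suc k, w)] * tail_sum j (Suc k) w)"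
        using tail_sum_rec[OF step(2)] by simp
      moreover have "below j k u = walks j (White (Suc k, u))" unfolding below_Suc[OF True] using rs by auto
      ultimately show ?thesis using row_sum[OF R True] by simp
    next
      case rs: False
      have ne: "p \<noteq> [] \<and> hd p \<in> HA \<union> VA" if "p \<in> walks j (White c)" for p c
        using that by (cases p) (auto simp: walks_def)
      have "below j k u = {p \<in> walks j (White (Suc k, u)). p \<noteq> [] \<and> hd p \<in> VA}"
        unfolding below_Suc[OF True] using rs ne VA_HA by blast
      then obtain y where y: "arc_word (White (Suc k, u), y) = (1 :: torus_letter word \<Rightarrow>\<^sub>0 'k)"
        "below j k u = Cons (White (Suc k, u), y) ` below j (Suc k) u"
        using vertical_walks[OF True] by metis
      have "path_sum (below j k u) = path_sum (below j (Suc k) u)" unfolding y(2) path_sum_Cons y(1) by simp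
      also have "\<dots> \<cong>\<^sub>t tail_sum j (Suc k) u" by (rule R[OF True])
      also have "\<dots> \<cong>\<^sub>t mon [Neg (Suc k, u), Pos (Suc k, u)] * tail_sum j (Suc k) u"
        by (rule eqv_sym[OF neg_pos_cancel(1)[OF c]])
      also have "\<dots> = tail_sum j k u"
      proof -
        have "{w. step (Suc k) u w} = {u}" using rs step(5) by (auto simp: step_def)
        then show ?thesis using tail_sum_rec[OF step(2)] by simp
      qed
      finally show ?thesis .
    qed
  qed
qed

text \<open>The word in \<open>wt\<close> pairs the letters by the column of a descent, the arcs of
  the graph pair them by the runs within a row. Regrouping passes from one form to the
  other.\<close>

lemma X_tails:
  assumes ij: "(i, j) \<in> coords m n"
  shows "X (i, j) = (\<Sum>w\<in>{w. (i, w) \<in> W}. mon [Pos (i, w)] * tail_sum j i w)"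
proof -
  let ?A = "Sigma {w. (i, w) \<in> W} (tails j i)"
  let ?g = "\<lambda>(w, b). \<lambda>l. if l < i then Suc n else b l"
  have i: "1 \<le> i" "i \<le> m" using ij by (auto simp: coords_def)
  have fin: "finite {w. (i, w) \<in> W}" by (rule finite_subset[of _ "{..n}"]) (auto dest: W_range)
  have "X (i, j) = (\<Sum>x\<in>?A. wt (?g x))"
    unfolding X_def
  proof (rule sum.reindex_bij_witness[of _ ?g "\<lambda>a. (a i, \<lambda>l. if l < i then a i else a l)"])
    fix a assume "a \<in> {a. vpath (i, j) a}"
    then have a: "vpath (i, j) a" by simp
    have ai: "a (i - 1) = Suc n" "a i \<le> n" using vpath_before[OF a, of "i - 1"] vpath_after[OF a, of i] i by auto
    have "step (Suc (i - 1)) (a (i - 1)) (a (Suc (i - 1)))" by (rule vpath_step[OF a]) (use i in simp)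
    then have white: "(i, a i) \<in> W" using ai i by (auto simp: step_def)
    show eq: "?g (a i, \<lambda>l. if l < i then a i else a l) = a" using vpath_before[OF a] by auto
    show "wt (?g (a i, \<lambda>l. if l < i then a i else a l)) = wt a" unfolding eq ..
    show "(a i, \<lambda>l. if l < i then a i else a l) \<in> ?A"
      using white vpath_step[OF a] vpath_end[OF a] i by (auto simp: tails_def)
  next
    fix x assume "x \<in> ?A"
    then obtain w b where x: "x = (w, b)" "(i, w) \<in> W" "b \<in> tails j i w" by auto
    have bl: "b l = w" if "l \<le> i" for l using x that by (simp add: tails_def)
    show "(?g x i, \<lambda>l. if l < i then ?g x i else ?g x l) = x" using bl by (auto simp: x(1) fun_eq_iff)
    have "step (Suc l) (?g x l) (?g x (Suc l))" if "l < m" for l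
    proof -
      consider "Suc l < i" | "Suc l = i" | "i \<le> l" by linarith
      then show ?thesis
      proof cases
        case 2
        then show ?thesis using x W_range[OF x(2)] bl[of i] by (auto simp: step_def)
      next
        case 3
        then show ?thesis using x that by (simp add: tails_def)
      qed (simp add: x(1))
    qed
    then show "?g x \<in> {a. vpath (i, j) a}"
      using x ij i W_range[OF x(2)] bl[of i] by (auto simp: vpath_def tails_def)
  qed
  also have "\<dots> = (\<Sum>(w, b)\<in>?A. mon [Pos (i, w)] * mon (tail_word i m b))"
  proof (rule sum.cong[OF refl])
    fix x assume "x \<in> ?A"
    then obtain w b where x: "x = (w, b)" "(i, w) \<in> W" "b \<in> tails j i w" by auto
    have "b i = w" using x by (simp add: tails_def)
    have le: "b l \<le> n" if "i \<le> l" "l \<le> m" for l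
      using that
    proof (induction l rule: dec_induct)
      case base
      then show ?case using \<open>b i = w\<close> W_range[OF x(2)] by simp
    next
      case (step l)
      then have "step (Suc l) (b l) (b (Suc l))" using x(3) by (simp add: tails_def)
      then show ?case using step_le step by (metis Suc_leD order_trans)
    qed
    have "seg (?g x) 0 i = []" by (auto simp: seg_def x(1))
    then have "seg (?g x) 0 (Suc m) = seg (?g x) i (Suc m)"
      using seg_append[of 0 i "Suc m" "?g x"] i by simp
    also have "\<dots> = seg b i (Suc m)" by (rule seg_cong) (simp add: x(1))
    also have "\<dots> = seg b i m @ [Pos (m, b m)]" using i le[of m] by (simp add: seg_snoc lab_def)
    also have "seg b i v @ [Pos (v, b v)] = Pos (i, w) # tail_word i v b" if "i \<le> v" "v \<le> m" for v
      using that
    proof (induction v rule: dec_induct)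
      case base
      then show ?case using \<open>b i = w\<close> by (simp add: tail_word_def)
    next
      case (step v)
      then show ?case using le[of v] by (simp add: seg_snoc lab_def tail_word_def)
    qed
    note this[of m]
    finally have "seg (?g x) 0 (Suc m) = Pos (i, w) # tail_word i m b" using i by simp
    then show "wt (?g x) = (case x of (w, b) \<Rightarrow> mon [Pos (i, w)] * mon (tail_word i m b))"
      by (simp add: wt_def x(1) mon_mult)
  qed
  also have "\<dots> = (\<Sum>w\<in>{w. (i, w) \<in> W}. \<Sum>b\<in>tails j i w. mon [Pos (i, w)] * mon (tail_word i m b))"
    by (rule sum.Sigma[symmetric]) (use fin finite_tails in auto)
  finally show ?thesis by (simp add: tail_sum_def sum_distrib_left)
qed

lemma walks_Row_sum:
  assumes ij: "(i, j) \<in> coords m n"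
  shows "path_sum (walks j (Row i)) \<cong>\<^sub>t X (i, j)"
proof (cases "\<exists>u. (i, u) \<in> W")
  case True
  define A where "A = {u. (i, u) \<in> W}"
  have A: "finite A" "A \<noteq> {}" using True W_range by (auto simp: A_def intro: finite_subset[of _ "{..n}"])
  define u where "u = Max A"
  have u: "(i, u) \<in> W" using Max_in[OF A] unfolding u_def A_def by simp
  have max: "w \<le> u" if "(i, w) \<in> W" for w using Max_ge[OF A(1), of w] that unfolding u_def A_def by simp
  let ?e = "(Row i, White (i, u))"
  have e: "?e \<in> HA" unfolding HA_Row using u max by (metis leD)
  have uniq: "y = White (i, u)" if "(Row i, y) \<in> HA" for y
    using that u max unfolding HA_Row by (metis le_neq_implies_less)
  have "p \<noteq> [] \<and> hd p \<in> HA" if "p \<in> walks j (Row i)" for p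
    using that no_arcs(1)[of i] by (cases p) (auto simp: walks_def)
  then have "walks j (Row i) = {p \<in> walks j (Row i). p \<noteq> [] \<and> hd p \<in> HA}" by blast
  also have "\<dots> = Cons ?e ` walks j (White (i, u))"
    using walks_first_arc[OF e _ uniq, of j] VA_HA[of ?e] e by (auto simp: turn_ok_def)
  finally have "walks j (Row i) = Cons ?e ` walks j (White (i, u))" .
  then have "path_sum (walks j (Row i)) = mon [Pos (i, u)] * path_sum (walks j (White (i, u)))"
    by (simp add: path_sum_Cons)
  also have "\<dots> \<cong>\<^sub>t mon [Pos (i, u)] * (\<Sum>w\<in>{w. w \<le> u \<and> (i, w) \<in> W}. mon [Neg (i, u), Pos (i, w)] * tail_sum j i w)"
  proof (intro eqv_mult row_sum u eqv_refl)
    show "path_sum (below j i w) \<cong>\<^sub>t tail_sum j i w" if "(i, w) \<in> W" for w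
      using below_sum W_range[OF that] by simp
  qed
  also have "\<dots> \<cong>\<^sub>t (\<Sum>w\<in>{w. w \<le> u \<and> (i, w) \<in> W}. mon [Pos (i, w)] * tail_sum j i w)"
    unfolding sum_distrib_left by (intro eqv_sum neg_pos_cancel) (use u in \<open>simp add: W_def\<close>)
  also have "{w. w \<le> u \<and> (i, w) \<in> W} = {w. (i, w) \<in> W}" using max by auto
  finally show ?thesis by (simp add: X_tails[OF ij])
next
  case False
  have "walks j (Row i) = {}"
  proof (rule ccontr)
    assume "walks j (Row i) \<noteq> {}"
    then obtain p where p: "p \<in> walks j (Row i)" by blast
    then obtain e' p' where ep: "p = e' # p'" by (cases p) (auto simp: walks_def)
    then have "e' \<in> HA \<union> VA" "fst e' = Row i" using p by (auto simp: walks_def)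
    then have "(Row i, snd e') \<in> HA" using no_arcs(1)[of i "snd e'"] by (metis Un_iff prod.collapse)
    then show False using False unfolding HA_Row by blast
  qed
  then show ?thesis using False by (simp add: X_tails[OF ij] path_sum_def)
qed

lemma turns_ok_iff: "turns_ok p \<longleftrightarrow> (\<forall>c\<in>turns m n B p. c \<le> rs)"
proof (induction p)
  case (Cons e p)
  have "turns m n B (e # p) = turns m n B p \<union> {c. p \<noteq> [] \<and> e \<in> VA \<and> hd p \<in> HA \<and> snd e = White c}"
  proof (intro Set.set_eqI iffI)
    fix c assume "c \<in> turns m n B (e # p)"
    then obtain k where k: "Suc k < length (e # p)" "(e # p) ! k \<in> VA" "(e # p) ! Suc k \<in> HA" "snd ((e # p) ! k) = White c"
      by (auto simp: turns_def)
    then show "c \<in> turns m n B p \<union> {c. p \<noteq> [] \<and> e \<in> VA \<and> hd p \<in> HA \<and> snd e = White c}"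
      by (cases k) (auto simp: turns_def hd_conv_nth)
  next
    fix c assume "c \<in> turns m n B p \<union> {c. p \<noteq> [] \<and> e \<in> VA \<and> hd p \<in> HA \<and> snd e = White c}"
    then consider k where "Suc k < length p" "p ! k \<in> VA" "p ! Suc k \<in> HA" "snd (p ! k) = White c"
      | "p \<noteq> []" "e \<in> VA" "hd p \<in> HA" "snd e = White c" by (auto simp: turns_def)
    then show "c \<in> turns m n B (e # p)"
    proof cases
      case 1 then show ?thesis unfolding turns_def by (intro CollectI exI[of _ "Suc k"]) simp
    next
      case 2 then show ?thesis unfolding turns_def by (intro CollectI exI[of _ 0]) (simp add: hd_conv_nth)
    qed
  qed
  then show ?case using Cons by (auto simp: turn_ok_def)
qed (simp add: turns_def)

lemma walk_apath:
  assumes "1 \<le> i" "i \<le> m"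
  shows "walk j (Row i) p \<longleftrightarrow> pre_digraph.apath (cauchon_graph m n B) (Row i) p (Col j)"
proof -
  let ?G = "cauchon_graph m n B"
  have G: "arcs ?G = HA \<union> VA" "tail ?G = fst" "head ?G = snd" by (simp_all add: cauchon_graph_def)
  have w: "walk j v p \<longleftrightarrow> set p \<subseteq> arcs ?G \<and> pre_digraph.cas ?G v p (Col j)" for v p
    by (induction p arbitrary: v) (auto simp: pre_digraph.cas.simps G)
  have "distinct (pre_digraph.awalk_verts ?G v p) \<and> (\<forall>x\<in>set (pre_digraph.awalk_verts ?G v p). rank x \<le> rank v)"
    if "walk j v p" for v p
    using that
  proof (induction p arbitrary: v)
    case (Cons e p)
    have "rank (snd e) < rank v" using rank_less[of "fst e" "snd e"] Cons.prems by auto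
    moreover have "distinct (pre_digraph.awalk_verts ?G (snd e) p)"
      "\<forall>x\<in>set (pre_digraph.awalk_verts ?G (snd e) p). rank x \<le> rank (snd e)" using Cons by auto
    ultimately show ?case using Cons.prems by (fastforce simp: pre_digraph.awalk_verts.simps G)
  qed (simp add: pre_digraph.awalk_verts.simps)
  moreover have "Row i \<in> verts ?G" using assms by (simp add: cauchon_graph_def)
  ultimately show ?thesis unfolding pre_digraph.apath_def pre_digraph.awalk_def using w by blast
qed

lemma cls_path_weight:
  assumes "walk j v p"
  shows "cls m n q (prod_list (map arc_word p)) = path_weight m n q p"
  using assms
proof (induction p arbitrary: v)
  case Nil
  then show ?case by (simp add: path_weight_def ordered_prod_def cls_1)
next
  case (Cons e p)
  have "cls m n q (arc_word e) = arc_weight m n q e"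
  proof -
    obtain x y where e: "e = (x, y)" by (cases e)
    have xy: "(x, y) \<in> HA \<or> (x, y) \<in> VA" using Cons.prems e by auto
    show ?thesis
    proof (cases x)
      case (White c)
      obtain k u where c: "c = (k, u)" by (cases c)
      show ?thesis
      proof (cases y)
        case y: (White d)
        obtain k' u' where d: "d = (k', u')" by (cases d)
        have "(k, u) \<in> coords m n" "(k', u') \<in> coords m n"
          using xy unfolding White c y d HA_White VA_White by (auto simp: W_def)
        then show ?thesis
          using cls_mult[of "mon [Neg (k, u)]" "mon [Pos (k', u')]"]
          by (cases "k = k'") (simp_all add: e White c y d tinv_cls tgen_cls cls_1 mon_mult)
      qed (simp_all add: e White c cls_1)
    next
      case (Row i)
      then obtain u where "y = White (i, u)" "(i, u) \<in> W" using xy no_arcs by (auto simp: HA_Row)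
      then show ?thesis using tgen_cls[of "(i, u)"] by (simp add: e Row W_def)
    qed (use xy no_arcs in auto)
  qed
  then show ?case
    using Cons.IH[of "snd e"] Cons.prems by (simp add: path_weight_def ordered_prod_def cls_mult)
qed

text \<open>The link between the graph and column sequences: the remaining arguments about
  generators take place in terms of \<open>X\<close>.\<close>

lemma xgen_cls:
  assumes c: "c \<in> coords m n" and rs: "nth_coord m n t = rs"
  shows "xgen m n q B t c = cls m n q (X c)"
proof -
  obtain i j where ij: "c = (i, j)" by (cases c)
  have i: "1 \<le> i" "i \<le> m" using c by (auto simp: ij coords_def)
  have paths: "paths m n B t c = walks j (Row i)"
    unfolding paths_def walks_def ij prod.case rs using walk_apath[OF i] turns_ok_iff by auto
  have "xgen m n q B t c = (\<Oplus>\<^bsub>T\<^esub>p\<in>walks j (Row i). cls m n q (prod_list (map arc_word p)))"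
    unfolding xgen_def paths
    by (rule T.add.finprod_cong') (auto simp: walks_def cls_path_weight)
  also have "\<dots> = cls m n q (path_sum (walks j (Row i)))"
    unfolding path_sum_def by (rule cls_sum[OF finite_walks, symmetric])
  also have "\<dots> = cls m n q (X c)" using walks_Row_sum[of i j] c unfolding ij eqv_def by blast
  finally show ?thesis .
qed

end

section \<open>Exponent matrices\<close>

lemma finite_coords [simp]: "finite (coords m n)"
  by (simp add: coords_def)

definition expl :: "nat \<Rightarrow> nat \<Rightarrow> (nat \<times> nat \<Rightarrow> nat) \<Rightarrow> (nat \<times> nat) list" where
  "expl m n N = concat (map (\<lambda>c. replicate (N c) c) (sorted_list_of_set (coords m n)))"

lemma count_concat_replicate:
  "distinct xs \<Longrightarrow> count (mset (concat (map (\<lambda>c. replicate (N c) c) xs))) c = (if c \<in> set xs then N c else 0)"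
  by (induction xs) auto

lemma count_expl: "count (mset (expl m n N)) c = (if c \<in> coords m n then N c else 0)"
  unfolding expl_def by (subst count_concat_replicate) simp_all

lemma set_expl: "set (expl m n N) = {c \<in> coords m n. N c > 0}"
  by (auto simp: expl_def)

lemma sorted_expl: "sorted (expl m n N)"
proof -
  have "sorted xs \<Longrightarrow> sorted (concat (map (\<lambda>c. replicate (N c) c) xs))" for xs :: "(nat \<times> nat) list"
    by (induction xs) (auto simp: sorted_append)
  then show ?thesis by (simp add: expl_def)
qed

lemma sorted_eq_expl:
  assumes "sorted cs" "set cs \<subseteq> coords m n"
  shows "expl m n (\<lambda>c\<in>coords m n. count (mset cs) c) = cs"
proof -
  have "mset (expl m n (\<lambda>c\<in>coords m n. count (mset cs) c)) = mset cs"
    using assms(2) by (intro multiset_eqI) (auto simp: count_expl count_eq_zero_iff)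
  then show ?thesis using sorted_expl assms(1) by (metis properties_for_sort)
qed

lemma mset_expl_inj:
  assumes "M \<in> exponents m n" "N \<in> exponents m n" "mset (expl m n M) = mset (expl m n N)"
  shows "M = N"
proof
  fix c
  show "M c = N c"
  proof (cases "c \<in> coords m n")
    case True
    have "count (mset (expl m n M)) c = count (mset (expl m n N)) c" by (rule arg_cong[OF assms(3)])
    then show ?thesis unfolding count_expl if_P[OF True] .
  next
    case False
    then show ?thesis
      using PiE_arb[OF assms(1)[unfolded exponents_def], of c] PiE_arb[OF assms(2)[unfolded exponents_def], of c] by simp
  qed
qed

lemma matrix_less_total:
  assumes "M \<in> exponents m n" "N \<in> exponents m n" "M \<noteq> N"
  shows "matrix_less m n M N \<or> matrix_less m n N M"
proof -
  have "\<exists>c. c \<in> coords m n \<and> M c \<noteq> N c"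
  proof (rule ccontr)
    assume "\<nexists>c. c \<in> coords m n \<and> M c \<noteq> N c"
    then have "M = N" using assms(1,2) unfolding exponents_def by (intro PiE_ext[where k = "coords m n"]) auto
    then show False using assms(3) by simp
  qed
  then obtain c where c: "c \<in> coords m n" "M c \<noteq> N c"
    and least: "\<And>d. d < c \<Longrightarrow> \<not> (d \<in> coords m n \<and> M d \<noteq> N d)"
    unfolding exists_least_iff[of "\<lambda>c. c \<in> coords m n \<and> M c \<noteq> N c"] by blast
  then have "\<forall>d\<in>coords m n. d < c \<longrightarrow> M d = N d" by blast
  then show ?thesis using c unfolding matrix_less_def by (metis linorder_neqE_nat)
qed

lemma matrix_less_asym: "matrix_less m n M N \<Longrightarrow> \<not> matrix_less m n N M"
  unfolding matrix_less_def by (metis linorder_neqE not_less_iff_gr_or_eq)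

lemma matrix_less_trans:
  assumes "matrix_less m n L M" "matrix_less m n M N"
  shows "matrix_less m n L N"
proof -
  obtain c d where c: "c \<in> coords m n" "L c < M c" "\<And>c'. c' \<in> coords m n \<Longrightarrow> c' < c \<Longrightarrow> L c' = M c'"
    and d: "d \<in> coords m n" "M d < N d" "\<And>c'. c' \<in> coords m n \<Longrightarrow> c' < d \<Longrightarrow> M c' = N c'"
    using assms unfolding matrix_less_def by blast
  have "min c d \<in> coords m n" using c(1) d(1) by (simp add: min_def)
  moreover have "L (min c d) < N (min c d)"
    using c(2) d(2) c(3)[OF d(1)] d(3)[OF c(1)] by (cases c d rule: linorder_cases) (auto simp: min_def)
  moreover have "\<forall>c'\<in>coords m n. c' < min c d \<longrightarrow> L c' = N c'" using c(3) d(3) by simp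
  ultimately show ?thesis unfolding matrix_less_def by blast
qed

lemma matrix_greatest_exists:
  assumes "finite A" "A \<noteq> {}" "A \<subseteq> exponents m n"
  shows "\<exists>N\<in>A. \<forall>M\<in>A. M \<noteq> N \<longrightarrow> matrix_less m n M N"
  using assms
proof (induction A rule: finite_ne_induct)
  case (insert x A)
  then obtain N where N: "N \<in> A" "\<And>M. M \<in> A \<Longrightarrow> M \<noteq> N \<Longrightarrow> matrix_less m n M N" by auto
  have "x \<noteq> N" using insert N(1) by auto
  then consider "matrix_less m n x N" | "matrix_less m n N x"
    using matrix_less_total[of x m n N] insert.prems N(1) by auto
  then show ?case
  proof cases
    case 1
    then show ?thesis using N by (intro bexI[of _ N]) auto
  next
    case 2
    have "matrix_less m n M x" if "M \<in> A" for M
      using N(2)[OF that] 2 matrix_less_trans by (cases "M = N") blast+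
    then show ?thesis by (intro bexI[of _ x]) auto
  qed
qed simp

section \<open>Linear combinations of monomials\<close>

lemma wf_less_coord: "wf {(c, d). (c :: nat \<times> nat) < d}"
  by (rule wf)

lemma not_sorted_adjacent:
  assumes "\<not> sorted (cs :: 'a::linorder list)"
  obtains us d c vs where "cs = us @ [d, c] @ vs" "c < d"
proof -
  obtain i where i: "Suc i < length cs" "cs ! Suc i < cs ! i"
    using assms unfolding sorted_iff_nth_Suc by (meson not_le)
  have "cs = take i cs @ [cs ! i, cs ! Suc i] @ drop (Suc (Suc i)) cs"
    using i id_take_nth_drop[of i cs] Cons_nth_drop_Suc[of "Suc i" cs] by simp
  then show ?thesis using that i(2) by blast
qed

context cauchon_torus
begin

lemma Xs_append: "Xs (cs @ ds) = Xs cs * Xs ds"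
  by (simp add: Xs_def)

lemma Xs_Nil [simp]: "Xs [] = 1" by (simp add: Xs_def)

text \<open>The same coefficients can be evaluated for every diagram: for \<open>B = {}\<close> this
  gives an element of the algebra, for other diagrams its image.\<close>

definition lin :: "((nat \<times> nat \<Rightarrow> nat) \<Rightarrow>\<^sub>0 'k) \<Rightarrow> torus_letter word \<Rightarrow>\<^sub>0 'k" where
  "lin f = (\<Sum>N\<in>Poly_Mapping.keys f. const (Poly_Mapping.lookup f N) * Xs (expl m n N))"

lemma lin_superset:
  "finite S \<Longrightarrow> Poly_Mapping.keys f \<subseteq> S \<Longrightarrow> lin f = (\<Sum>N\<in>S. const (Poly_Mapping.lookup f N) * Xs (expl m n N))"
  unfolding lin_def by (rule sum.mono_neutral_left) (auto simp: in_keys_iff)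

lemma lin_add: "lin (f + g) = lin f + lin g"
proof -
  let ?S = "Poly_Mapping.keys f \<union> Poly_Mapping.keys g"
  show ?thesis
    using lin_superset[of ?S f] lin_superset[of ?S g] lin_superset[of ?S "f + g"] Poly_Mapping.keys_add[of f g]
    by (simp add: lookup_add const_add[symmetric] distrib_right sum.distrib)
qed

lemma lin_single: "lin (Poly_Mapping.single N c) = const c * Xs (expl m n N)"
  by (cases "c = 0") (simp_all add: lin_def)

lemma lin_0 [simp]: "lin 0 = 0" by (simp add: lin_def)

lemma lin_sum: "lin (\<Sum>x\<in>A. f x) = (\<Sum>x\<in>A. lin (f x))"
  by (induction A rule: infinite_finite_induct) (simp_all add: lin_add)

definition spanned :: "(torus_letter word \<Rightarrow>\<^sub>0 'k) \<Rightarrow> bool" where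
  "spanned g \<longleftrightarrow> (\<exists>f. Poly_Mapping.keys f \<subseteq> exponents m n \<and> g \<cong>\<^sub>t lin f)"

lemma spanned_add: "spanned g \<Longrightarrow> spanned h \<Longrightarrow> spanned (g + h)"
proof -
  assume "spanned g" "spanned h"
  then obtain f f' where "Poly_Mapping.keys f \<subseteq> exponents m n" "g \<cong>\<^sub>t lin f"
    "Poly_Mapping.keys f' \<subseteq> exponents m n" "h \<cong>\<^sub>t lin f'" unfolding spanned_def by blast
  then have "Poly_Mapping.keys (f + f') \<subseteq> exponents m n" "g + h \<cong>\<^sub>t lin (f + f')"
    using Poly_Mapping.keys_add[of f f'] eqv_add by (blast, simp add: lin_add eqv_add)
  then show ?thesis unfolding spanned_def by blast
qed

lemma spanned_const: "spanned g \<Longrightarrow> spanned (const c * g)"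
proof -
  assume "spanned g"
  then obtain f where f: "Poly_Mapping.keys f \<subseteq> exponents m n" "g \<cong>\<^sub>t lin f" unfolding spanned_def by blast
  define f' where "f' = (\<Sum>N\<in>Poly_Mapping.keys f. Poly_Mapping.single N (c * Poly_Mapping.lookup f N))"
  have "Poly_Mapping.lookup f' N = 0" if "N \<notin> Poly_Mapping.keys f" for N
    using that unfolding f'_def lookup_sum by (intro sum.neutral) (auto simp: lookup_single when_def)
  then have "Poly_Mapping.keys f' \<subseteq> Poly_Mapping.keys f" unfolding in_keys_iff[of _ f'] subset_iff by blast
  then have "Poly_Mapping.keys f' \<subseteq> exponents m n" using f(1) by blast
  moreover have "lin f' = const c * lin f"
    unfolding f'_def lin_sum lin_single by (simp add: lin_def sum_distrib_left const_mult[symmetric] mult.assoc)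
  ultimately show ?thesis using eqv_mult[OF eqv_refl f(2)] unfolding spanned_def by metis
qed

lemma spanned_cong: "g \<cong>\<^sub>t h \<Longrightarrow> spanned h \<Longrightarrow> spanned g"
  unfolding spanned_def using eqv_trans by blast

end

text \<open>Sorting words of generators terminates: the relations replace a word by lexicographically smaller ones.\<close>

lemma (in cauchon_torus) spanned_Xs:
  assumes "set cs \<subseteq> coords m n"
  shows "spanned (Xs cs)"
  using assms
proof (induction cs rule: wf_induct_rule[OF wf_lex[OF wf_less_coord]])
  case (1 cs)
  show ?case
  proof (cases "sorted cs")
    case True
    let ?N = "\<lambda>c\<in>coords m n. count (mset cs) c"
    have "lin (Poly_Mapping.single ?N 1) = Xs cs"
      unfolding lin_single sorted_eq_expl[OF True "1.prems"] by simp
    moreover have "Poly_Mapping.keys (Poly_Mapping.single ?N (1::'k)) \<subseteq> exponents m n" by (simp add: exponents_def)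
    ultimately show ?thesis unfolding spanned_def by (metis eqv_refl)
  next
    case False
    then obtain us d c vs where cs: "cs = us @ [d, c] @ vs" "c < d" by (rule not_sorted_adjacent)
    have cd: "c \<in> coords m n" "d \<in> coords m n" "set us \<subseteq> coords m n" "set vs \<subseteq> coords m n" using "1.prems" by (auto simp: cs)
    obtain \<alpha> \<beta> c' d' where s: "c' \<in> coords m n" "d' \<in> coords m n" "c' < d"
      and e: "X d * X c \<cong>\<^sub>t const \<alpha> * (X c * X d) + const \<beta> * (X c' * X d')"
      using X_straighten[OF cd(1,2) cs(2)] by blast
    have sp: "spanned (Xs (us @ [a, b] @ vs))" if "a \<in> coords m n" "b \<in> coords m n" "a < d" for a b
    proof (rule "1.IH")
      show "(us @ [a, b] @ vs, cs) \<in> lex {(c, d). c < d}"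
        unfolding lex_conv cs(1) using that(3)
        by (intro CollectI case_prodI conjI exI[of _ us] exI[of _ a] exI[of _ d] exI[of _ "b # vs"] exI[of _ "c # vs"]) auto
      show "set (us @ [a, b] @ vs) \<subseteq> coords m n" using that cd by auto
    qed
    have P: "const \<gamma> * Xs (us @ [a, b] @ vs) = Xs us * ((const \<gamma> * (X a * X b)) * Xs vs)" for a b \<gamma>
    proof -
      have "const \<gamma> * Xs (us @ [a, b] @ vs) = (const \<gamma> * Xs us) * ((X a * X b) * Xs vs)"
        by (simp add: Xs_def mult.assoc)
      also have "const \<gamma> * Xs us = Xs us * const \<gamma>" by (rule const_central)
      finally show ?thesis by (simp add: mult.assoc)
    qed
    have "Xs cs = Xs us * ((X d * X c) * Xs vs)" by (simp add: cs Xs_def mult.assoc)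
    also have "\<dots> \<cong>\<^sub>t Xs us * ((const \<alpha> * (X c * X d) + const \<beta> * (X c' * X d')) * Xs vs)"
      by (intro eqv_mult e eqv_refl)
    also have "\<dots> = const \<alpha> * Xs (us @ [c, d] @ vs) + const \<beta> * Xs (us @ [c', d'] @ vs)"
      unfolding P by (simp add: distrib_left distrib_right)
    finally show ?thesis
      by (rule spanned_cong) (intro spanned_add spanned_const sp cd s cs(2))
  qed
qed

section \<open>Products and combinations of generators; nonvanishing by the leading exponent\<close>

context cauchon_torus
begin

inductive_set words :: "(torus_letter word \<Rightarrow>\<^sub>0 'k) set" where
  word: "set cs \<subseteq> coords m n \<Longrightarrow> const c * Xs cs \<in> words"
| add: "g \<in> words \<Longrightarrow> h \<in> words \<Longrightarrow> g + h \<in> words"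

lemma words_const_mult: "g \<in> words \<Longrightarrow> const c * g \<in> words"
proof (induction rule: words.induct)
  case (word cs d)
  then show ?case using words.word[of cs "c * d"] by (simp add: const_mult[symmetric] mult.assoc)
qed (simp add: distrib_left words.add)

lemma words_mult: "g \<in> words \<Longrightarrow> h \<in> words \<Longrightarrow> g * h \<in> words"
proof (induction rule: words.induct)
  case (word cs c)
  show ?case using word.prems
  proof (induction rule: words.induct)
    case (word ds d)
    have "(const c * Xs cs) * (const d * Xs ds) = const c * (Xs cs * const d) * Xs ds" by (simp add: mult.assoc)
    also have "Xs cs * const d = const d * Xs cs" by (rule const_central[symmetric])
    also have "const c * (const d * Xs cs) * Xs ds = const (c * d) * Xs (cs @ ds)"
      by (simp add: const_mult[symmetric] mult.assoc Xs_append)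
    finally show ?case using \<open>set cs \<subseteq> coords m n\<close> word words.word[of "cs @ ds" "c * d"] by simp
  qed (simp add: distrib_left words.add)
qed (simp add: distrib_right words.add)

lemma spanned_words: "g \<in> words \<Longrightarrow> spanned g"
  by (induction rule: words.induct) (auto intro: spanned_add spanned_const spanned_Xs)

lemma lin_words: "Poly_Mapping.keys f \<subseteq> exponents m n \<Longrightarrow> lin f \<in> words"
proof -
  have "(\<Sum>N\<in>A. const (g N) * Xs (expl m n N)) \<in> words" if "finite A" for A g
    using that
  proof (induction A rule: finite_induct)
    case empty
    then show ?case using words.word[of "[]" 0] by simp
  next
    case (insert N A)
    have "set (expl m n N) \<subseteq> coords m n" by (auto simp: set_expl)
    then show ?case using insert by (simp add: words.add words.word)
  qed
  then show ?thesis by (simp add: lin_def)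
qed

text \<open>The functional belonging to the least family is nonzero on the term of \<open>N\<close>
  and zero on all terms with smaller exponents.\<close>

lemma top_nonzero:
  assumes f: "Poly_Mapping.keys f \<subseteq> exponents m n" and N: "N \<in> Poly_Mapping.keys f"
    and max: "\<And>M. M \<in> Poly_Mapping.keys f \<Longrightarrow> M \<noteq> N \<Longrightarrow> matrix_less m n M N"
    and L: "least_family {c \<in> coords m n. N c > 0} P"
  shows "\<not> lin f \<cong>\<^sub>t 0"
proof
  assume z: "lin f \<cong>\<^sub>t 0"
  have "set (expl m n N) \<subseteq> {c \<in> coords m n. N c > 0}" by (simp add: set_expl)
  from separating_monomial[OF L this] obtain e where e: "coef e (kill m n (Xs (expl m n N))) \<noteq> 0"
    and sep: "\<And>cs. mset cs \<noteq> mset (expl m n N) \<Longrightarrow> \<not> (\<exists>c. count (mset (expl m n N)) c < count (mset cs) c \<and>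
      (\<forall>d < c. count (mset (expl m n N)) d = count (mset cs) d)) \<Longrightarrow> coef e (kill m n (Xs cs)) = 0"
    by metis
  have zero: "coef e (kill m n (Xs (expl m n M))) = 0" if M: "M \<in> Poly_Mapping.keys f" "M \<noteq> N" for M
  proof (rule sep)
    show "mset (expl m n M) \<noteq> mset (expl m n N)" using mset_expl_inj[of M m n N] M f N by auto
    show "\<not> (\<exists>c. count (mset (expl m n N)) c < count (mset (expl m n M)) c \<and>
        (\<forall>d < c. count (mset (expl m n N)) d = count (mset (expl m n M)) d))"
    proof
      assume "\<exists>c. count (mset (expl m n N)) c < count (mset (expl m n M)) c \<and>
        (\<forall>d < c. count (mset (expl m n N)) d = count (mset (expl m n M)) d)"
      then obtain c where c: "count (mset (expl m n N)) c < count (mset (expl m n M)) c"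
        "\<forall>d < c. count (mset (expl m n N)) d = count (mset (expl m n M)) d" by blast
      have "c \<in> coords m n" using c(1) unfolding count_expl by (auto split: if_splits)
      moreover have "N d = M d" if "d \<in> coords m n" "d < c" for d
      proof -
        have "count (mset (expl m n N)) d = count (mset (expl m n M)) d" using c(2) that(2) by blast
        then show ?thesis unfolding count_expl using that(1) by simp
      qed
      moreover have "N c < M c" using c(1) calculation(1) unfolding count_expl by simp
      ultimately have "matrix_less m n N M" unfolding matrix_less_def by blast
      then show False using matrix_less_asym[OF max[OF M]] by simp
    qed
  qed
  have "coef e (kill m n (lin f)) = (\<Sum>M\<in>Poly_Mapping.keys f. Poly_Mapping.lookup f M * coef e (kill m n (Xs (expl m n M))))"
    by (simp add: lin_def kill_sum coef_sum kill_mult coef_const_mult)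
  also have "\<dots> = (\<Sum>M\<in>Poly_Mapping.keys f. if M = N then Poly_Mapping.lookup f N * coef e (kill m n (Xs (expl m n N))) else 0)"
    by (intro sum.cong refl) (simp add: zero)
  also have "\<dots> = Poly_Mapping.lookup f N * coef e (kill m n (Xs (expl m n N)))" using N by simp
  finally have "coef e (kill m n (lin f)) \<noteq> 0" using e N by (simp add: in_keys_iff)
  then show False using coef_cong[OF z, of e] by simp
qed

definition straight :: "nat \<times> nat \<Rightarrow> nat \<Rightarrow> nat" where
  "straight c = (\<lambda>k. if k < fst c then Suc n else snd c)"

lemma straight_vpath:
  assumes "c \<in> W"
  shows "vpath c (straight c)"
proof -
  have c: "c \<in> coords m n" "1 \<le> fst c" "fst c \<le> m" "snd c \<le> n" using assms W_range[of "fst c" "snd c"] by (auto simp: W_def)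
  have "step (Suc k) (straight c k) (straight c (Suc k))" for k
  proof (cases "Suc k = fst c")
    case True
    then have "(Suc k, snd c) \<in> W" using assms by simp
    then show ?thesis using True c by (simp add: straight_def step_def)
  qed (auto simp: straight_def)
  then show ?thesis using c by (auto simp: vpath_def straight_def)
qed

text \<open>Beyond \<open>rs\<close> turns are forbidden, so a path to \<open>c\<close> must drop
  into column \<open>snd c\<close> directly in row \<open>fst c\<close>, at the square
  \<open>c\<close>.\<close>

lemma late_white:
  assumes a: "vpath c a" and "\<not> c \<le> rs"
  shows "c \<in> W"
proof -
  have "\<not> (Suc (fst c), snd c) \<le> rs"
    using assms(2) order_trans[of c "(Suc (fst c), snd c)" rs] by (auto simp: less_eq_prod_def)
  then have "a (fst c) = snd c" using vpath_straight[OF a order_refl] by blast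
  moreover have "step (Suc (fst c - 1)) (a (fst c - 1)) (a (Suc (fst c - 1)))"
    by (rule vpath_step[OF a]) (use vpath_range[OF a] in auto)
  moreover have "a (fst c - 1) = Suc n" using vpath_before[OF a, of "fst c - 1"] vpath_range[OF a] by simp
  ultimately show ?thesis using vpath_range[OF a] by (auto simp: step_def)
qed

text \<open>A white coordinate beyond \<open>rs\<close> never obstructs, since its straight path
  avoids all paths of coordinates north-west of it. Such coordinates can be removed from the head of
  the chain until its maximum is \<open>\<le> rs\<close>, as the minors of the basis
  require.\<close>

lemma bad_chain:
  assumes "chain C" "\<nexists>Q. system C Q" and white: "\<And>c. c \<in> set C \<Longrightarrow> \<not> c \<le> rs \<Longrightarrow> c \<in> W"
  shows "\<exists>C'. chain C' \<and> set C' \<subseteq> set C \<and> hd C' \<le> rs \<and> (\<nexists>Q. system C' Q)"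
  using assms
proof (induction C)
  case (Cons c C)
  show ?case
  proof (cases "c \<le> rs")
    case True
    then show ?thesis using Cons.prems by (intro exI[of _ "c # C"]) simp
  next
    case False
    then have v: "vpath c (straight c)" using Cons.prems(3) straight_vpath by simp
    show ?thesis
    proof (cases "C = []")
      case True
      then have "system (c # C) [straight c]" using v by (simp add: system_def)
      then show ?thesis using Cons.prems(2) by blast
    next
      case ne: False
      then have ch: "chain C" using Cons.prems(1) by (auto simp: chain_def dest: spec[of _ "Suc _"])
      have nw: "nw (hd C) c" using Cons.prems(1) ne by (auto simp: chain_def hd_conv_nth dest: spec[of _ 0])
      have "\<nexists>Q. system C Q"
      proof
        assume "\<exists>Q. system C Q"
        then obtain Q where Q: "system C Q" by blast
        obtain d C' where C: "C = d # C'" using ne by (cases C) auto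
        then obtain b Q' where Q': "Q = b # Q'" "vpath d b" using Q by (auto simp: system_def list_all2_Cons1)
        have "prec b (straight c)" using late_prec[OF Q'(2) v] nw False C by simp
        then have "system (c # C) (straight c # Q)"
          using Q v Q' by (auto simp: system_def nth_Cons split: nat.split)
        then show False using Cons.prems(2) by blast
      qed
      then obtain C' where "chain C'" "set C' \<subseteq> set C" "hd C' \<le> rs" "\<nexists>Q. system C' Q"
        using Cons.IH[OF ch] Cons.prems(3) by auto
      then show ?thesis by (intro exI[of _ C']) auto
    qed
  qed
qed (simp add: chain_def)

end

section \<open>Unique expansions, leading terms and the algebras of path sums\<close>

context cauchon_torus
begin

lemma white_least_family:
  assumes "S \<subseteq> W"
  obtains P where "least_family S P"
proof (rule least_family_exists[of S])
  fix C assume C: "chain C" "set C \<subseteq> S"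
  have "prec (straight c) (straight d)" if "nw c d" for c d
    using that by (auto simp: prec_def straight_def nw_def)
  moreover have "list_all2 vpath C (map straight C)"
    unfolding list_all2_conv_all_nth
  proof (intro conjI allI impI)
    fix i assume i: "i < length C"
    then have "C ! i \<in> W" using nth_mem[OF i] C(2) assms by blast
    then show "vpath (C ! i) (map straight C ! i)" using straight_vpath i by simp
  qed simp
  ultimately have "system C (map straight C)" using C(1) unfolding system_def chain_def by simp
  then show "\<exists>Q. system C Q" ..
qed

lemma W_empty: "B = {} \<Longrightarrow> W = coords m n"
  unfolding W_def by blast

lemma xgen_empty:
  assumes "B = {}" "nth_coord m n t = rs" "c \<in> coords m n"
  shows "xgen m n q {} t c = cls m n q (X c)"
  using xgen_cls[OF assms(3,2)] by (subst assms(1)[symmetric])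

text \<open>If all squares are white, straight paths join every chain, so every support has a least
  family and \<open>top_nonzero\<close> applies to any nonzero combination.\<close>

lemma lin_eq_0:
  assumes W: "W = coords m n" and f: "Poly_Mapping.keys f \<subseteq> exponents m n" and z: "lin f \<cong>\<^sub>t 0"
  shows "f = 0"
proof (rule ccontr)
  assume "f \<noteq> 0"
  then have "Poly_Mapping.keys f \<noteq> {}" by simp
  then obtain N where N: "N \<in> Poly_Mapping.keys f" "\<And>M. M \<in> Poly_Mapping.keys f \<Longrightarrow> M \<noteq> N \<Longrightarrow> matrix_less m n M N"
    using matrix_greatest_exists[OF finite_keys _ f] by blast
  obtain P where "least_family {c \<in> coords m n. N c > 0} P" using white_least_family[of "{c \<in> coords m n. N c > 0}"] W by blast
  then show False using top_nonzero[OF f N] z by blast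
qed

lemma lin_inj:
  assumes W: "W = coords m n" and f: "Poly_Mapping.keys f \<subseteq> exponents m n" "Poly_Mapping.keys g \<subseteq> exponents m n"
    and eq: "lin f \<cong>\<^sub>t lin g"
  shows "f = g"
proof -
  have "lin g + const (-1) * lin f \<cong>\<^sub>t lin g + const (-1) * lin g" by (intro eqv_add eqv_mult eq eqv_refl)
  also have "\<dots> = 0" by (simp add: const_uminus)
  finally have z: "lin g + const (-1) * lin f \<cong>\<^sub>t 0" .
  have "const (-1) * lin f = lin (- f)"
  proof -
    have "lin f + lin (- f) = 0" unfolding lin_add[symmetric] by simp
    then have "- lin f = lin (- f)" by (rule minus_unique)
    then show ?thesis by (simp add: const_uminus)
  qed
  then have "lin (g - f) \<cong>\<^sub>t 0" using z lin_add[of g "- f"] by simp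
  moreover have "Poly_Mapping.keys (g - f) \<subseteq> exponents m n" using Poly_Mapping.keys_diff[of g f] f by blast
  ultimately have "g - f = 0" by (intro lin_eq_0[OF W])
  then show ?thesis by simp
qed

lemma cls_power: "cls m n q (f ^ k) = cls m n q f [^]\<^bsub>T\<^esub> k"
proof (induction k)
  case (Suc k)
  have "cls m n q (f ^ Suc k) = cls m n q (f ^ k * f)" by (simp add: power_commutes)
  then show ?case using Suc by (simp add: cls_mult)
qed (simp add: cls_1)

lemma ordered_prod_cls:
  "ordered_prod T (map (\<lambda>x. cls m n q (f x)) xs) = cls m n q (prod_list (map f xs))"
  by (induction xs) (simp_all add: ordered_prod_def cls_1 cls_mult)

lemma Xs_replicate: "Xs (replicate k c) = X c ^ k"
  by (induction k) (simp_all add: Xs_def)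

lemma Xs_concat: "Xs (concat css) = prod_list (map Xs css)"
  by (induction css) (simp_all add: Xs_append)

lemma xmonom_cls:
  assumes B: "B = {}" and t: "nth_coord m n t = rs"
  shows "xmonom m n q t N = cls m n q (Xs (expl m n N))"
proof -
  have "xmonom m n q t N = ordered_prod T (map (\<lambda>c. cls m n q (X c ^ N c)) (sorted_list_of_set (coords m n)))"
    unfolding xmonom_def
    by (intro arg_cong[where f = "ordered_prod T"] map_cong refl) (simp add: xgen_empty[OF B t] cls_power)
  then show ?thesis by (simp add: ordered_prod_cls expl_def Xs_concat comp_def Xs_replicate)
qed

lemma expansion_lin:
  assumes B: "B = {}" and t: "nth_coord m n t = rs" and f: "Poly_Mapping.keys f \<subseteq> exponents m n"
  shows "expansion m n q t (cls m n q (lin f)) = f"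
proof -
  note W = W_empty[OF B]
  have lin: "(\<Oplus>\<^bsub>T\<^esub>N \<in> Poly_Mapping.keys g. scalar m n q (Poly_Mapping.lookup g N) \<otimes>\<^bsub>T\<^esub> xmonom m n q t N) = cls m n q (lin g)" for g
    unfolding lin_def by (subst cls_sum) (simp_all add: scalar_cls xmonom_cls[OF B t] cls_mult)
  show ?thesis
    unfolding expansion_def lin
  proof (rule the_equality)
    show "g = f" if "Poly_Mapping.keys g \<subseteq> exponents m n \<and> cls m n q (lin f) = cls m n q (lin g)" for g
      using lin_inj[OF W f, of g] that by (simp add: eqv_def)
  qed (use f in simp)
qed

lemma leading_term_lin:
  assumes B: "B = {}" and t: "nth_coord m n t = rs" and f: "Poly_Mapping.keys f \<subseteq> exponents m n"
    and N: "N \<in> Poly_Mapping.keys f" and max: "\<And>M. M \<in> Poly_Mapping.keys f \<Longrightarrow> M \<noteq> N \<Longrightarrow> matrix_less m n M N"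
  shows "leading_term m n q t (cls m n q (lin f)) = xmonom m n q t N"
    and "cls m n q (lin f) \<noteq> \<zero>\<^bsub>T\<^esub>"
proof -
  have "(THE N. N \<in> Poly_Mapping.keys f \<and> (\<forall>M \<in> Poly_Mapping.keys f. M \<noteq> N \<longrightarrow> matrix_less m n M N)) = N"
  proof (rule the_equality)
    show "M = N" if M: "M \<in> Poly_Mapping.keys f \<and> (\<forall>L \<in> Poly_Mapping.keys f. L \<noteq> M \<longrightarrow> matrix_less m n L M)" for M
      using M N max[of M] matrix_less_asym[of m n M N] by metis
  qed (use N max in blast)
  then show "leading_term m n q t (cls m n q (lin f)) = xmonom m n q t N"
    unfolding leading_term_def expansion_lin[OF B t f] by simp
  show "cls m n q (lin f) \<noteq> \<zero>\<^bsub>T\<^esub>"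
  proof
    assume "cls m n q (lin f) = \<zero>\<^bsub>T\<^esub>"
    then have "lin f \<cong>\<^sub>t 0" by (simp add: eqv_def cls_0)
    then have "f = 0" using lin_eq_0[OF W_empty[OF B] f] by blast
    then show False using N by simp
  qed
qed

lemma generators_closed: "nth_coord m n t = rs \<Longrightarrow> range (scalar m n q) \<union> xgen m n q B t ` coords m n \<subseteq> carrier T"
  by (auto simp: scalar_cls xgen_cls)

lemma ring_path_alg:
  assumes "nth_coord m n t = rs"
  shows "ring (path_alg m n q B t)"
  unfolding path_alg_def subalg_def
  by (rule T.subring_is_ring[OF T.generate_ring_is_subring[OF generators_closed[OF assms]]])

lemma path_alg_simps:
  "carrier (path_alg m n q B t) = generate_ring T (range (scalar m n q) \<union> xgen m n q B t ` coords m n)"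
  "x \<otimes>\<^bsub>path_alg m n q B t\<^esub> y = x \<otimes>\<^bsub>T\<^esub> y" "x \<oplus>\<^bsub>path_alg m n q B t\<^esub> y = x \<oplus>\<^bsub>T\<^esub> y"
  "\<one>\<^bsub>path_alg m n q B t\<^esub> = \<one>\<^bsub>T\<^esub>" "\<zero>\<^bsub>path_alg m n q B t\<^esub> = \<zero>\<^bsub>T\<^esub>"
  by (simp_all add: path_alg_def subalg_def)

lemma words_path_alg:
  assumes t: "nth_coord m n t = rs" and "g \<in> words"
  shows "cls m n q g \<in> carrier (path_alg m n q B t)"
proof -
  let ?G = "range (scalar m n q) \<union> xgen m n q B t ` coords m n"
  have c: "cls m n q (const c) \<in> generate_ring T ?G" for c
    by (rule generate_ring.incl) (simp add: scalar_cls[symmetric])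
  have Xs: "cls m n q (Xs cs) \<in> generate_ring T ?G" if "set cs \<subseteq> coords m n" for cs
    using that
  proof (induction cs)
    case (Cons c cs)
    have "cls m n q (X c) \<in> generate_ring T ?G"
      by (rule generate_ring.incl) (use Cons.prems xgen_cls[OF _ t, of c] in auto)
    then show ?case using Cons generate_ring.eng_mult[of "cls m n q (X c)" T ?G] by (simp add: Xs_def cls_mult)
  qed (simp add: cls_1 generate_ring.one)
  show ?thesis using assms(2) unfolding path_alg_simps
  proof (induction rule: words.induct)
    case (word cs d)
    then show ?case unfolding cls_mult by (intro generate_ring.eng_mult c Xs)
  next
    case (add g h)
    then show ?case unfolding cls_add by (intro generate_ring.eng_add)
  qed
qed

lemma path_alg_words:
  assumes t: "nth_coord m n t = rs" and "a \<in> carrier (path_alg m n q B t)"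
  shows "\<exists>g\<in>words. a = cls m n q g"
  using assms(2) unfolding path_alg_simps
proof (induction rule: generate_ring.induct)
  case one
  show ?case using words.word[of "[]" 1] cls_1 by (intro bexI[of _ 1]) simp_all
next
  case (incl h)
  then consider c where "h = cls m n q (const c)" | c where "c \<in> coords m n" "h = cls m n q (X c)"
    using xgen_cls[OF _ t] by (auto simp: scalar_cls)
  then show ?case
  proof cases
    case (1 c)
    then show ?thesis using words.word[of "[]" c] by (intro bexI[of _ "const c"]) simp_all
  next
    case (2 c)
    then show ?thesis using words.word[of "[c]" 1] by (intro bexI[of _ "X c"]) (simp_all add: Xs_def)
  qed
next
  case (a_inv h)
  then obtain g where g: "g \<in> words" "h = cls m n q g" by blast
  have "cls m n q (const (-1) * g) \<oplus>\<^bsub>T\<^esub> cls m n q g = \<zero>\<^bsub>T\<^esub>"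
    unfolding cls_add[symmetric] by (simp add: const_uminus cls_0)
  then have "\<ominus>\<^bsub>T\<^esub> h = cls m n q (const (-1) * g)" unfolding g(2) by (rule T.minus_equality) simp_all
  then show ?case using words_const_mult[OF g(1)] by blast
next
  case (eng_add h k)
  then obtain g g' where "g \<in> words" "h = cls m n q g" "g' \<in> words" "k = cls m n q g'" by blast
  then show ?case using words.add[of g g'] cls_add[of g g'] by metis
next
  case (eng_mult h k)
  then obtain g g' where "g \<in> words" "h = cls m n q g" "g' \<in> words" "k = cls m n q g'" by blast
  then show ?case using words_mult[of g g'] cls_mult[of g g'] by metis
qed

lemma path_alg_lin:
  assumes t: "nth_coord m n t = rs" and a: "a \<in> carrier (path_alg m n q B t)"
  obtains f where "Poly_Mapping.keys f \<subseteq> exponents m n" "a = cls m n q (lin f)"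
  using path_alg_words[OF assms] spanned_words unfolding spanned_def eqv_def by metis

section \<open>Expansions and leading terms of quantum minors\<close>

definition minor :: "nat list \<Rightarrow> nat list \<Rightarrow> torus_letter word \<Rightarrow>\<^sub>0 'k" where
  "minor is js = (\<Sum>\<sigma>\<in>{\<sigma>. \<sigma> permutes {..<length is}}. const ((- q) ^ invs (length is) \<sigma>) *
    prod_list (map (\<lambda>l. X (is ! l, js ! \<sigma> l)) [0..<length is]))"

lemma qminor_cls:
  assumes B: "B = {}" and t: "nth_coord m n t = rs" and I: "I \<subseteq> {1..m}" and J: "J \<subseteq> {1..n}" and card: "card I = card J"
  shows "qminor m n q t I J = cls m n q (minor (sorted_list_of_set I) (sorted_list_of_set J))"
proof -
  let ?is = "sorted_list_of_set I" and ?js = "sorted_list_of_set J"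
  have fin: "finite I" "finite J" using I J finite_subset by blast+
  have len: "length ?is = card I" "length ?js = card I" using card by simp_all
  have term_eq: "scalar m n q ((- q) ^ card {(a, b). a < b \<and> b < card I \<and> \<sigma> a > \<sigma> b}) \<otimes>\<^bsub>T\<^esub>
      ordered_prod T (map (\<lambda>a. xgen m n q {} t (?is ! a, ?js ! \<sigma> a)) [0..<card I])
    = cls m n q (const ((- q) ^ invs (card I) \<sigma>) * prod_list (map (\<lambda>l. X (?is ! l, ?js ! \<sigma> l)) [0..<card I]))"
    if \<sigma>: "\<sigma> permutes {..<card I}" for \<sigma>
  proof -
    have "(?is ! a, ?js ! \<sigma> a) \<in> coords m n" if "a < card I" for a
    proof -
      have "\<sigma> a < card I" using permutes_in_image[OF \<sigma>, of a] that by simp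
      then have "?is ! a \<in> I" "?js ! \<sigma> a \<in> J"
        using nth_mem[of a ?is] nth_mem[of "\<sigma> a" ?js] that len fin by simp_all
      then show ?thesis using I J by (auto simp: coords_def)
    qed
    then have map_eq: "map (\<lambda>a. xgen m n q {} t (?is ! a, ?js ! \<sigma> a)) [0..<card I]
        = map (\<lambda>a. cls m n q (X (?is ! a, ?js ! \<sigma> a))) [0..<card I]"
      by (intro map_cong refl xgen_empty[OF B t]) simp
    show ?thesis unfolding map_eq ordered_prod_cls scalar_cls invs_def cls_mult ..
  qed
  have "qminor m n q t I J = (\<Oplus>\<^bsub>T\<^esub>\<sigma> \<in> {\<sigma>. \<sigma> permutes {..<card I}}.
      cls m n q (const ((- q) ^ invs (card I) \<sigma>) * prod_list (map (\<lambda>l. X (?is ! l, ?js ! \<sigma> l)) [0..<card I])))"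
    unfolding qminor_def by (rule T.add.finprod_cong') (auto simp only: mem_Collect_eq term_eq Pi_iff cls_closed)
  also have "\<dots> = cls m n q (minor ?is ?js)"
    unfolding minor_def len by (rule cls_sum[symmetric]) (simp add: finite_permutations)
  finally show ?thesis .
qed

definition perm_exp :: "nat list \<Rightarrow> nat list \<Rightarrow> (nat \<Rightarrow> nat) \<Rightarrow> nat \<times> nat \<Rightarrow> nat" where
  "perm_exp is js \<sigma> = (\<lambda>c\<in>coords m n. count (mset (map (\<lambda>l. (is ! l, js ! \<sigma> l)) [0..<length is])) c)"

text \<open>Determined by the index lists and \<open>q\<close> alone, so the same coefficients
  describe a minor and its image in the algebra of any diagram.\<close>

definition minor_coeffs :: "nat list \<Rightarrow> nat list \<Rightarrow> (nat \<times> nat \<Rightarrow> nat) \<Rightarrow>\<^sub>0 'k" where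
  "minor_coeffs is js = (\<Sum>\<sigma>\<in>{\<sigma>. \<sigma> permutes {..<length is}}.
    Poly_Mapping.single (perm_exp is js \<sigma>) ((- q) ^ invs (length is) \<sigma>))"

context
  fixes "is" js :: "nat list"
  assumes len: "length js = length is" and srt: "sorted_wrt (<) is" "sorted_wrt (<) js"
    and rng: "set is \<subseteq> {1..m}" "set js \<subseteq> {1..n}"
begin

text \<open>As the rows increase, each summand is already an ordered monomial, so both sides agree
  in the free algebra.\<close>

lemma minor_lin: "minor is js = lin (minor_coeffs is js)"
proof -
  have "prod_list (map (\<lambda>l. X (is ! l, js ! \<sigma> l)) [0..<length is]) = Xs (expl m n (perm_exp is js \<sigma>))"
    if \<sigma>: "\<sigma> permutes {..<length is}" for \<sigma>
  proof -
    let ?cs = "map (\<lambda>l. (is ! l, js ! \<sigma> l)) [0..<length is]"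
    have "sorted ?cs"
      unfolding sorted_iff_nth_Suc using sorted_wrt_nth_less[OF srt(1)] by (auto simp: less_eq_prod_def)
    moreover have "set ?cs \<subseteq> coords m n"
    proof
      fix c assume "c \<in> set ?cs"
      then obtain l where l: "l < length is" "c = (is ! l, js ! \<sigma> l)" by auto
      have "\<sigma> l < length js" using permutes_in_image[OF \<sigma>, of l] l len by simp
      then have "is ! l \<in> {1..m}" "js ! \<sigma> l \<in> {1..n}"
        using l rng nth_mem[of l "is"] nth_mem[of "\<sigma> l" js] by blast+
      then show "c \<in> coords m n" by (simp add: l(2) coords_def)
    qed
    ultimately have "expl m n (perm_exp is js \<sigma>) = ?cs" unfolding perm_exp_def by (rule sorted_eq_expl)
    then show ?thesis by (simp add: Xs_def comp_def)
  qed
  then show ?thesis unfolding minor_def minor_coeffs_def lin_sum lin_single by (intro sum.cong refl) simp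
qed

lemma minor_keys: "M \<in> Poly_Mapping.keys (minor_coeffs is js) \<Longrightarrow> \<exists>\<sigma>. \<sigma> permutes {..<length is} \<and> M = perm_exp is js \<sigma>"
proof (rule ccontr)
  assume "M \<in> Poly_Mapping.keys (minor_coeffs is js)" and no: "\<nexists>\<sigma>. \<sigma> permutes {..<length is} \<and> M = perm_exp is js \<sigma>"
  moreover have "Poly_Mapping.lookup (minor_coeffs is js) M = 0"
    unfolding minor_coeffs_def lookup_sum using no by (intro sum.neutral) (auto simp: lookup_single when_def)
  ultimately show False by (simp add: in_keys_iff)
qed

text \<open>The first index \<open>l\<close> moved by \<open>\<sigma>\<close> goes to a larger one,
  the smaller values being taken. The matrices agree before the coordinate
  \<open>(is ! l, js ! l)\<close>, where \<open>\<sigma>\<close> has 0 and the identity 1.\<close>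

lemma perm_exp_less:
  assumes \<sigma>: "\<sigma> permutes {..<length is}" "\<sigma> \<noteq> id"
  shows "matrix_less m n (perm_exp is js \<sigma>) (perm_exp is js id)"
proof -
  define K where "K = length is"
  have pK: "\<sigma> permutes {..<K}" using \<sigma> by (simp add: K_def)
  have "\<exists>l. \<sigma> l \<noteq> l" using \<sigma>(2) by (auto simp: fun_eq_iff)
  then obtain l where l: "\<sigma> l \<noteq> l" and least: "\<And>k. k < l \<Longrightarrow> \<sigma> k = k"
    unfolding exists_least_iff[of "\<lambda>l. \<sigma> l \<noteq> l"] by blast
  have lK: "l < K" using l permutes_not_in[OF pK, of l] by (cases "l < K") auto
  have sK: "\<sigma> k < K" if "k < K" for k using permutes_in_image[OF pK, of k] that by simp
  have gt: "l < \<sigma> l"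
  proof (rule ccontr)
    assume "\<not> l < \<sigma> l"
    then have "\<sigma> l < l" using l by simp
    then have "\<sigma> (\<sigma> l) = \<sigma> l" using least by blast
    then show False using l by (simp add: inj_eq[OF permutes_inj[OF pK]])
  qed
  have isl: "is ! a < is ! b" if "a < b" "b < K" for a b using sorted_wrt_nth_less[OF srt(1)] that by (simp add: K_def)
  have jsl: "js ! a < js ! b" if "a < b" "b < K" for a b using sorted_wrt_nth_less[OF srt(2)] that len by (simp add: K_def)
  have is_inj: "a = b" if "is ! a = is ! b" "a < K" "b < K" for a b
    using isl[of a b] isl[of b a] that by (metis less_irrefl linorder_neqE_nat)
  have cnt: "count (mset (map (\<lambda>k. (is ! k, js ! \<tau> k)) [0..<K])) (is ! i, j) = (if js ! \<tau> i = j then 1 else 0)"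
    if i: "i < K" for \<tau> i j
  proof -
    have "distinct (map (\<lambda>k. (is ! k, js ! \<tau> k)) [0..<K])"
      unfolding distinct_map by (auto intro!: inj_onI is_inj)
    then have "count (mset (map (\<lambda>k. (is ! k, js ! \<tau> k)) [0..<K])) (is ! i, j)
        = (if (is ! i, j) \<in> set (map (\<lambda>k. (is ! k, js ! \<tau> k)) [0..<K]) then 1 else 0)"
      by (rule distinct_count_atmost_1[THEN iffD1, rule_format])
    also have "(is ! i, j) \<in> set (map (\<lambda>k. (is ! k, js ! \<tau> k)) [0..<K]) \<longleftrightarrow> js ! \<tau> i = j"
      using i is_inj[of i] by (auto simp: image_iff)
    finally show ?thesis .
  qed
  have cnt0: "count (mset (map (\<lambda>k. (is ! k, js ! \<tau> k)) [0..<K])) (r, j) = 0"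
    if "r \<notin> set is" for \<tau> r j
    using that by (auto simp: count_eq_zero_iff K_def)
  define c where "c = (is ! l, js ! l)"
  have "is ! l \<in> {1..m}" "js ! l \<in> {1..n}"
    using rng nth_mem[of l "is"] nth_mem[of l js] lK[unfolded K_def] len by (metis subsetD)+
  then have c: "c \<in> coords m n" by (simp add: c_def coords_def)
  have "perm_exp is js \<sigma> c = 0" "perm_exp is js id c = 1"
    using c cnt[OF lK, of \<sigma> "js ! l"] cnt[OF lK, of id "js ! l"] jsl[OF gt sK[OF lK]]
    by (simp_all add: perm_exp_def K_def[symmetric] c_def)
  moreover have "perm_exp is js \<sigma> d = perm_exp is js id d" if d: "d \<in> coords m n" "d < c" for d
  proof -
    obtain r j where rj: "d = (r, j)" by (cases d)
    have "count (mset (map (\<lambda>k. (is ! k, js ! \<sigma> k)) [0..<K])) (r, j)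
        = count (mset (map (\<lambda>k. (is ! k, js ! id k)) [0..<K])) (r, j)"
    proof (cases "r \<in> set is")
      case True
      then obtain i where i: "i < K" "r = is ! i" by (auto simp: in_set_conv_nth K_def)
      have "i \<le> l" using d(2) i isl[of l i] by (auto simp: rj c_def intro: leI)
      show ?thesis
      proof (cases "i = l")
        case True
        then have "j < js ! l" using d(2) i by (auto simp: rj c_def)
        moreover have "j < js ! \<sigma> l" using calculation jsl[OF gt sK[OF lK]] by simp
        ultimately show ?thesis unfolding i(2) cnt[OF i(1)] using True by simp
      next
        case False
        then have "\<sigma> i = i" using \<open>i \<le> l\<close> least by simp
        then show ?thesis unfolding i(2) cnt[OF i(1)] by simp
      qed
    next
      case False
      then show ?thesis by (simp only: cnt0[OF False])
    qed
    then show ?thesis using d(1) by (simp add: perm_exp_def K_def rj)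
  qed
  ultimately show ?thesis unfolding matrix_less_def using c by (intro bexI[of _ c]) auto
qed

lemma minor_leading:
  shows "Poly_Mapping.keys (minor_coeffs is js) \<subseteq> exponents m n"
    and "perm_exp is js id \<in> Poly_Mapping.keys (minor_coeffs is js)"
    and "\<And>M. M \<in> Poly_Mapping.keys (minor_coeffs is js) \<Longrightarrow> M \<noteq> perm_exp is js id \<Longrightarrow>
      matrix_less m n M (perm_exp is js id)"
proof -
  have "perm_exp is js \<sigma> \<in> exponents m n" for \<sigma> by (simp add: perm_exp_def exponents_def)
  then show "Poly_Mapping.keys (minor_coeffs is js) \<subseteq> exponents m n" using minor_keys by blast
  show "matrix_less m n M (perm_exp is js id)"
    if "M \<in> Poly_Mapping.keys (minor_coeffs is js)" "M \<noteq> perm_exp is js id" for M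
    using minor_keys[OF that(1)] that(2) perm_exp_less by metis
  have ne: "perm_exp is js \<sigma> \<noteq> perm_exp is js id" if "\<sigma> permutes {..<length is}" "\<sigma> \<noteq> id" for \<sigma>
    using perm_exp_less[OF that] matrix_less_asym by metis
  have "Poly_Mapping.lookup (minor_coeffs is js) (perm_exp is js id)
      = (\<Sum>\<sigma>\<in>{\<sigma>. \<sigma> permutes {..<length is}}. if \<sigma> = id then (- q) ^ invs (length is) id else 0)"
    unfolding minor_coeffs_def lookup_sum
    by (intro sum.cong refl) (use ne in \<open>auto simp: lookup_single when_def\<close>)
  also have "\<dots> = (- q) ^ invs (length is) id"
    using permutes_id[of "{..<length is}"] by (simp add: finite_permutations)
  finally show "perm_exp is js id \<in> Poly_Mapping.keys (minor_coeffs is js)"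
    using q0 by (simp add: in_keys_iff)
qed

end

end

section \<open>The Groebner basis\<close>

theorem theorem4p4p1:
  fixes m n t :: nat and q :: "'k::field" and B :: "(nat \<times> nat) set"
    and \<sigma> :: "(torus_letter word \<Rightarrow>\<^sub>0 'k) set \<Rightarrow> (torus_letter word \<Rightarrow>\<^sub>0 'k) set"
    and K :: "(torus_letter word \<Rightarrow>\<^sub>0 'k) set set"
  assumes "infinite (UNIV :: 'k set)"
    and "m \<ge> 2" and "n \<ge> 2"
    and "q \<noteq> 0" and "\<forall>k>0. q ^ k \<noteq> 1"
    and "cauchon_diagram m n B"
    and "t \<in> {1..m * n}"
    and "\<sigma> \<in> alg_hom m n q (path_alg m n q {} t) (path_alg m n q B t)"
    and "\<forall>c \<in> coords m n. \<sigma> (xgen m n q {} t c) = xgen m n q B t c"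
    and "K = a_kernel (path_alg m n q {} t) (path_alg m n q B t) \<sigma>"
  shows "groebner_basis m n q t K
    ({xgen m n q {} t c | c. c \<in> B \<and> nth_coord m n t < c}
     \<union> {qminor m n q t I J | I J. I \<subseteq> {1..m} \<and> J \<subseteq> {1..n} \<and> card I = card J \<and> I \<noteq> {} \<and>
          qminor m n q t I J \<in> K \<and> (Max I, Max J) \<le> nth_coord m n t})"
proof -
  define rs where "rs = nth_coord m n t"
  \<comment> \<open>Two instances over the same torus: \<open>E\<close> with the empty diagram for
    the domain of \<open>\<sigma>\<close>, \<open>D\<close> with \<open>B\<close> for its
    target.\<close>
  interpret E: cauchon_torus m n "{}" rs q
    by unfold_locales (use assms(2-4) in \<open>auto simp: cauchon_diagram_def\<close>)
  interpret D: cauchon_torus m n B rs q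
    by unfold_locales (use assms(2-4,6) in auto)
  note t = rs_def[symmetric]
  let ?PE = "path_alg m n q {} t" and ?PD = "path_alg m n q B t"
  let ?T = "torus m n q"
  have Bc: "B \<subseteq> coords m n" using assms(6) by (simp add: cauchon_diagram_def)
  have hom: "\<sigma> \<in> ring_hom ?PE ?PD" and sc: "\<And>c. \<sigma> (scalar m n q c) = scalar m n q c"
    using assms(8) by (auto simp: alg_hom_def)
  have K: "a \<in> K \<longleftrightarrow> a \<in> carrier ?PE \<and> \<sigma> a = \<zero>\<^bsub>?T\<^esub>" for a
    unfolding assms(10) a_kernel_def' D.path_alg_simps by simp
  have mult: "\<sigma> (cls m n q g \<otimes>\<^bsub>?T\<^esub> cls m n q h) = \<sigma> (cls m n q g) \<otimes>\<^bsub>?T\<^esub> \<sigma> (cls m n q h)"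
    if "g \<in> E.words" "h \<in> E.words" for g h
    using ring_hom_mult[OF hom E.words_path_alg[OF t that(1)] E.words_path_alg[OF t that(2)]]
    unfolding E.path_alg_simps D.path_alg_simps .
  have add: "\<sigma> (cls m n q g \<oplus>\<^bsub>?T\<^esub> cls m n q h) = \<sigma> (cls m n q g) \<oplus>\<^bsub>?T\<^esub> \<sigma> (cls m n q h)"
    if "g \<in> E.words" "h \<in> E.words" for g h
    using ring_hom_add[OF hom E.words_path_alg[OF t that(1)] E.words_path_alg[OF t that(2)]]
    unfolding E.path_alg_simps D.path_alg_simps .
  have cw: "const c \<in> E.words" for c using E.words.word[of "[]" c] by simp
  have xw: "E.Xs cs \<in> E.words" if "set cs \<subseteq> coords m n" for cs using E.words.word[OF that, of 1] by simp
  have Xs: "\<sigma> (cls m n q (E.Xs cs)) = cls m n q (D.Xs cs)" if "set cs \<subseteq> coords m n" for cs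
    using that
  proof (induction cs)
    case Nil
    have "\<sigma> (cls m n q (const 1)) = cls m n q (const 1)" using sc[of 1] by (simp only: E.scalar_cls)
    then show ?case by simp
  next
    case (Cons c cs)
    have c: "c \<in> coords m n" "set cs \<subseteq> coords m n" using Cons.prems by auto
    have "\<sigma> (cls m n q (E.X c)) = cls m n q (D.X c)"
      using assms(9)[rule_format, OF c(1)] E.xgen_cls[OF c(1) t] D.xgen_cls[OF c(1) t] by (simp only:)
    moreover have "E.X c \<in> E.words" using xw[of "[c]"] c(1) by (simp add: E.Xs_def)
    moreover have "E.Xs (c # cs) = E.X c * E.Xs cs" "D.Xs (c # cs) = D.X c * D.Xs cs"
      by (simp_all add: E.Xs_def D.Xs_def)
    ultimately show ?case using mult[OF _ xw[OF c(2)]] Cons.IH[OF c(2)] by (simp only: E.cls_mult)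
  qed
  have lin: "\<sigma> (cls m n q (E.lin f)) = cls m n q (D.lin f)" if "Poly_Mapping.keys f \<subseteq> exponents m n" for f
  proof -
    have "(\<Sum>N\<in>A. const (g N) * E.Xs (expl m n N)) \<in> E.words \<and>
        \<sigma> (cls m n q (\<Sum>N\<in>A. const (g N) * E.Xs (expl m n N))) = cls m n q (\<Sum>N\<in>A. const (g N) * D.Xs (expl m n N))"
      if "finite A" for A and g :: "(nat \<times> nat \<Rightarrow> nat) \<Rightarrow> 'k"
      using that
    proof (induction A rule: finite_induct)
      case empty
      have "\<sigma> (cls m n q (const 0)) = cls m n q (const 0)" using sc[of 0] by (simp only: E.scalar_cls)
      then show ?case using cw[of 0] by simp
    next
      case (insert N A)
      have N: "set (expl m n N) \<subseteq> coords m n" by (auto simp: set_expl)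
      have w: "const (g N) * E.Xs (expl m n N) \<in> E.words" by (rule E.words.word[OF N])
      have "\<sigma> (cls m n q (const (g N) * E.Xs (expl m n N))) = cls m n q (const (g N) * D.Xs (expl m n N))"
        unfolding E.cls_mult mult[OF cw xw[OF N]] Xs[OF N] using sc[of "g N"] by (simp only: E.scalar_cls)
      then show ?case
        using insert add[OF w] w E.words.add[OF w] by (simp add: E.cls_add)
    qed
    then show ?thesis unfolding E.lin_def D.lin_def by simp
  qed
  \<comment> \<open>Membership in the kernel becomes the vanishing of the same combination over
    \<open>B\<close>, a question about paths.\<close>
  have lin_K: "cls m n q (E.lin f) \<in> K \<longleftrightarrow> E.eqv (D.lin f) 0" if "Poly_Mapping.keys f \<subseteq> exponents m n" for f
    unfolding K lin[OF that] E.eqv_def E.cls_0 using E.words_path_alg[OF t E.lin_words[OF that]] by simp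
  have unit_exp: "cls m n q (E.X c) = cls m n q (E.lin (Poly_Mapping.single (\<lambda>d\<in>coords m n. if d = c then 1 else 0) 1))
      \<and> D.X c = D.lin (Poly_Mapping.single (\<lambda>d\<in>coords m n. if d = c then 1 else 0) 1)"
    if c: "c \<in> coords m n" for c
  proof -
    have "(\<lambda>d\<in>coords m n. if d = c then 1 else 0) = (\<lambda>d\<in>coords m n. count (mset [c]) d)" by (auto simp: fun_eq_iff)
    then have "expl m n (\<lambda>d\<in>coords m n. if d = c then 1 else 0) = [c]"
      using sorted_eq_expl[of "[c]" m n] c by simp
    then show ?thesis by (simp add: E.lin_single D.lin_single E.Xs_def D.Xs_def)
  qed
  define G where "G = {xgen m n q {} t c | c. c \<in> B \<and> nth_coord m n t < c}
     \<union> {qminor m n q t I J | I J. I \<subseteq> {1..m} \<and> J \<subseteq> {1..n} \<and> card I = card J \<and> I \<noteq> {} \<and>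
          qminor m n q t I J \<in> K \<and> (Max I, Max J) \<le> nth_coord m n t}"
  have late_zero: "D.X c = 0" if c: "c \<in> B" "rs < c" for c
  proof -
    have "\<not> D.vpath c a" for a using D.late_white[of c a] c by (auto simp: D.W_def not_le)
    then show ?thesis by (simp add: D.X_def)
  qed
  have late_K: "xgen m n q {} t c \<in> K" if c: "c \<in> B" "rs < c" for c
  proof -
    have cc: "c \<in> coords m n" using c Bc by blast
    have "Poly_Mapping.keys (Poly_Mapping.single (\<lambda>d\<in>coords m n. if d = c then 1 else 0 :: nat) (1::'k)) \<subseteq> exponents m n"
      by (auto simp: exponents_def)
    from lin_K[OF this] show ?thesis
      using unit_exp[OF cc] late_zero[OF c] E.xgen_cls[OF cc t] by simp
  qed
  have ideal: "right_ideal K ?PE"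
  proof -
    have "ring_hom_ring ?PE ?PD \<sigma>"
      by (rule ring_hom_ringI2[OF E.ring_path_alg[OF t] D.ring_path_alg[OF t] hom])
    then have "ideal K ?PE" unfolding assms(10) by (rule ring_hom_ring.kernel_is_ideal)
    from ideal.axioms(1)[OF this] ideal.I_r_closed[OF this] show ?thesis by (simp add: right_ideal_def)
  qed
  have finG: "finite G"
  proof -
    have "finite B" using Bc finite_subset by (metis finite_coords)
    then have "finite {xgen m n q {} t c | c. c \<in> B \<and> nth_coord m n t < c}"
      by (rule finite_subset[OF _ finite_imageI[of B "xgen m n q {} t"], rotated]) auto
    moreover have "finite {qminor m n q t I J | I J. I \<subseteq> {1..m} \<and> J \<subseteq> {1..n} \<and> card I = card J \<and> I \<noteq> {} \<and>
        qminor m n q t I J \<in> K \<and> (Max I, Max J) \<le> nth_coord m n t}"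
      by (rule finite_subset[OF _ finite_imageI[of "Pow {1..m} \<times> Pow {1..n}" "\<lambda>(I, J). qminor m n q t I J"]]) auto
    ultimately show ?thesis unfolding G_def by (rule finite_UnI)
  qed
  have GK: "G \<subseteq> K" unfolding G_def using late_K by (auto simp: rs_def)
  have main: "\<exists>g \<in> G. g \<noteq> \<zero>\<^bsub>?T\<^esub> \<and> xmonom_dvd m n q t (leading_term m n q t g) (leading_term m n q t a)"
    if a: "a \<in> K" "a \<noteq> \<zero>\<^bsub>?T\<^esub>" for a
  proof -
    obtain f where f: "Poly_Mapping.keys f \<subseteq> exponents m n" "a = cls m n q (E.lin f)"
      using E.path_alg_lin[OF t] a(1) K by metis
    have "f \<noteq> 0" using a(2) f(2) by (auto simp: E.cls_0)
    then have "Poly_Mapping.keys f \<noteq> {}" by simp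
    then obtain N where N: "N \<in> Poly_Mapping.keys f"
      and max: "\<And>M. M \<in> Poly_Mapping.keys f \<Longrightarrow> M \<noteq> N \<Longrightarrow> matrix_less m n M N"
      using matrix_greatest_exists[OF finite_keys _ f(1)] by blast
    have lt_a: "leading_term m n q t a = xmonom m n q t N"
      unfolding f(2) by (rule E.leading_term_lin(1)[OF refl t f(1) N max])
    have NE: "N \<in> exponents m n" using N f(1) by blast
    define S where "S = {c \<in> coords m n. N c > 0}"
    \<comment> \<open>A least family for the support of \<open>N\<close> would make
      \<open>\<sigma> a\<close> nonzero by \<open>D.top_nonzero\<close>.\<close>
    have bad: "\<nexists>P. D.least_family S P"
      using D.top_nonzero[OF f(1) N max] lin_K[OF f(1)] a(1) f(2) unfolding S_def by blast
    have dvd: "xmonom_dvd m n q t (xmonom m n q t M) (leading_term m n q t a)"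
      if "M \<in> exponents m n" "\<And>c. c \<in> coords m n \<Longrightarrow> M c \<le> N c" for M
      unfolding xmonom_dvd_def lt_a using that NE by blast
    show ?thesis
    proof (cases "\<exists>c\<in>S. c \<in> B \<and> rs < c")
      case True
      then obtain c where c: "c \<in> S" "c \<in> B" "rs < c" by blast
      let ?M = "\<lambda>d\<in>coords m n. if d = c then 1 else 0 :: nat"
      let ?f = "Poly_Mapping.single ?M (1::'k)"
      have cc: "c \<in> coords m n" using c(1) by (simp add: S_def)
      have kf: "Poly_Mapping.keys ?f \<subseteq> exponents m n" "?M \<in> Poly_Mapping.keys ?f" by (auto simp: exponents_def)
      have mx: "matrix_less m n M ?M" if "M \<in> Poly_Mapping.keys ?f" "M \<noteq> ?M" for M using that by simp
      have g: "xgen m n q {} t c = cls m n q (E.lin ?f)" using unit_exp[OF cc] E.xgen_cls[OF cc t] by simp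
      note L = E.leading_term_lin[OF refl t kf mx, folded g]
      have "xgen m n q {} t c \<in> G" unfolding G_def using c(2,3) unfolding rs_def by blast
      moreover have "xmonom_dvd m n q t (xmonom m n q t ?M) (leading_term m n q t a)"
        by (rule dvd) (use c(1) in \<open>auto simp: exponents_def S_def\<close>)
      ultimately show ?thesis using L by (intro bexI[of _ "xgen m n q {} t c"]) simp_all
    next
      case False
      \<comment> \<open>A support all of whose chains have systems has a least family, so some chain
        has none. Black coordinates beyond \<open>rs\<close> are already dealt with, so those of
        this chain beyond \<open>rs\<close> are white, as \<open>bad_chain\<close> demands.\<close>
      obtain C0 where C0: "D.chain C0" "set C0 \<subseteq> S" "\<nexists>Q. D.system C0 Q"
        using bad D.least_family_exists[of S] by metis
      have "c \<in> D.W" if "c \<in> set C0" "\<not> c \<le> rs" for c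
      proof -
        have c: "c \<in> S" "rs < c" using that C0(2) by auto
        then have "c \<notin> B" using False by blast
        then show ?thesis using c(1) by (simp add: D.W_def S_def)
      qed
      then obtain C where C: "D.chain C" "set C \<subseteq> S" "hd C \<le> rs" "\<nexists>Q. D.system C Q"
        using D.bad_chain[OF C0(1,3)] C0(2) by blast
      \<comment> \<open>Chains begin with their south-easternmost coordinate, whereas a minor lists
        rows and columns increasingly.\<close>
      define zs where "zs = rev C"
      have ne: "zs \<noteq> []" using C(1) by (simp add: zs_def D.chain_def)
      have nws: "sorted_wrt D.nw zs"
      proof -
        have "D.nw (zs ! i) (zs ! Suc i)" if i: "Suc i < length zs" for i
        proof -
          have "D.nw (C ! Suc (length C - Suc (Suc i))) (C ! (length C - Suc (Suc i)))"
            using C(1) i by (simp add: D.chain_def zs_def)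
          moreover have "Suc (length C - Suc (Suc i)) = length C - Suc i" using i by (simp add: zs_def)
          ultimately show ?thesis using i by (simp add: zs_def rev_nth)
        qed
        moreover have "transp D.nw" by (auto simp: transp_def D.nw_def)
        ultimately show ?thesis by (simp add: sorted_wrt_iff_nth_Suc_transp)
      qed
      define "is" where "is = map fst zs"
      define js where "js = map snd zs"
      have srt: "sorted_wrt (<) is" "sorted_wrt (<) js"
        unfolding is_def js_def sorted_wrt_map by (rule sorted_wrt_mono_rel[OF _ nws], simp add: D.nw_def)+
      have len: "length js = length is" by (simp add: is_def js_def)
      have zsS: "set zs \<subseteq> coords m n" using C(2) by (auto simp: zs_def S_def)
      have rng: "set is \<subseteq> {1..m}" "set js \<subseteq> {1..n}" using zsS by (auto simp: is_def js_def coords_def)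
      have zip: "zip is js = zs" by (simp add: is_def js_def zip_map_fst_snd)
      define I where "I = set is"
      define J where "J = set js"
      have dist: "distinct is" "distinct js" using srt strict_sorted_iff by blast+
      have sl: "sorted_list_of_set I = is" "sorted_list_of_set J = js"
        unfolding I_def J_def using srt by (simp_all add: sorted_list_of_set.idem_if_sorted_distinct strict_sorted_iff)
      have card: "card I = card J" by (simp add: I_def J_def distinct_card dist len)
      have ne': "is \<noteq> []" "js \<noteq> []" using ne by (simp_all add: is_def js_def)
      have MaxI: "Max I = last is" "Max J = last js"
      proof -
        have "Max (set xs) = last xs" if "sorted_wrt (<) xs" "xs \<noteq> []" for xs :: "nat list"
        proof (rule Max_eqI)
          fix y assume "y \<in> set xs"
          then obtain i where "i < length xs" "y = xs ! i" by (auto simp: in_set_conv_nth)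
          then show "y \<le> last xs"
            using that by (auto simp: last_conv_nth strict_sorted_iff intro!: sorted_nth_mono)
        qed (use that in simp_all)
        then show "Max I = last is" "Max J = last js" using srt ne' by (simp_all add: I_def J_def)
      qed
      have lasts: "(last is, last js) = hd C"
        using ne by (simp add: is_def js_def last_map zs_def last_rev)
      let ?f = "E.minor_coeffs is js"
      note top = E.minor_leading[OF len srt rng]
      have q: "qminor m n q t I J = cls m n q (E.lin ?f)"
        using E.qminor_cls[OF refl t _ _ card] rng E.minor_lin[OF len srt rng] unfolding sl by (simp add: I_def J_def)
      have "E.eqv (D.minor is js) 0"
        unfolding D.minor_def by (rule D.minor_vanishes[OF len srt]) (use C lasts zip in \<open>simp_all add: zs_def\<close>)
      then have "E.eqv (D.lin ?f) 0"
        using D.minor_lin[OF len srt rng] by (simp add: E.minor_coeffs_def D.minor_coeffs_def E.perm_exp_def[abs_def] D.perm_exp_def[abs_def])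
      then have qK: "qminor m n q t I J \<in> K" unfolding q lin_K[OF top(1)] .
      note L = E.leading_term_lin[OF refl t top, folded q]
      have "qminor m n q t I J \<in> G"
      proof -
        have "I \<subseteq> {1..m}" "J \<subseteq> {1..n}" "I \<noteq> {}" using rng ne' by (simp_all add: I_def J_def)
        moreover have "(Max I, Max J) \<le> nth_coord m n t" using MaxI lasts C(3) by (simp add: rs_def)
        ultimately show ?thesis unfolding G_def using card qK by blast
      qed
      \<comment> \<open>The diagonal term contains each coordinate of the chain exactly once, and
        all of them lie in the support of \<open>N\<close>.\<close>
      moreover have "xmonom_dvd m n q t (xmonom m n q t (E.perm_exp is js id)) (leading_term m n q t a)"
      proof (rule dvd)
        show "E.perm_exp is js id \<in> exponents m n" by (simp add: E.perm_exp_def exponents_def)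
        have m: "map (\<lambda>l. (is ! l, js ! id l)) [0..<length is] = zs"
          by (rule nth_equalityI) (simp_all add: is_def js_def)
        have "distinct zs" using dist(1) by (simp add: is_def distinct_map)
        show "E.perm_exp is js id c \<le> N c" if c: "c \<in> coords m n" for c
        proof -
          have "E.perm_exp is js id c = count (mset zs) c" using c unfolding E.perm_exp_def m by simp
          also have "count (mset zs) c = (if c \<in> set zs then 1 else 0)"
            using distinct_count_atmost_1[THEN iffD1, OF \<open>distinct zs\<close>] by blast
          also have "\<dots> \<le> N c"
          proof (cases "c \<in> set zs")
            case True
            then have "0 < N c" using C(2) by (auto simp: zs_def S_def)
            then show ?thesis using True by simp
          qed simp
          finally show ?thesis .
        qed
      qed
      ultimately show ?thesis using L by (intro bexI[of _ "qminor m n q t I J"]) simp_all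
    qed
  qed
  show ?thesis unfolding groebner_basis_def G_def[symmetric] using ideal finG GK main by simp
qed

end
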